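(* Suppose $K\subset\mathbb{R}^n$ is a $C^1$ convex body containing the origin in its interior. If there is an integer $l$ with $1\leq l\leq n-2$ such that $$\widetilde{W}_l\big(K\cap\xi^\perp\big)=\max_{t\in\mathbb{R}}\ \widetilde{W}_l\Big((K-t\xi)\cap\xi^\perp\Big)\quad\text{for all }\xi\in S^{n-1},$$ where the dual quermassintegrals $\widetilde{W}_l$ are taken in the $(n-1)$-dimensional space $\xi^\perp$, then $K=-K$.
   Context: A convex body in $\mathbb{R}^n$ is a convex and compact subset of $\mathbb{R}^n$ with non-empty interior. For a convex body $K$ containing the origin in its interior, its radial function is $\rho_K(\xi):=\max\{a>0:a\xi\in K\}$, $\xi\in S^{n-1}$, where $S^{n-1}$ is the unit sphere. $K$ is a $C^1$ convex body if its boundary is a $C^1$ manifold, or equivalently $\rho_K\in C^1(S^{n-1})$. For $\xi\in S^{n-1}$, $\xi^\perp:=\{x\in\mathbb{R}^n:\langle x,\xi\rangle=0\}$, and $K-t\xi=\{x-t\xi:x\in K\}$. Dual quermassintegrals: let $L$ be a convex body in an $N$-dimensional Euclidean space $E$ (here $E=\xi^\perp$, $N=n-1$) containing the origin $o$ in its relative interior, and let $B$ be the closed unit ball of $E$ centred at $o$. For $s\geq 0$ the radial sum is $$L\,\widetilde{+}\,sB:=\{o\}\cup\big\{x\in E\setminus\{o\}:|x|_2\leq\rho_L(x/|x|_2)+s\big\},$$ where $|\cdot|_2$ is the Euclidean norm and $\rho_L$ is the radial function of $L$ on the unit sphere of $E$. The dual quermassintegrals $\widetilde{W}_l(L)$,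 $0\leq l\leq N$, are the coefficients in the expansion $$\mathrm{vol}_N\big(L\,\widetilde{+}\,sB\big)=\sum_{l=0}^N\binom{N}{l}\widetilde{W}_l(L)\,s^l,\qquad s\geq 0.$$ For $0\leq l\leq N-1$ this gives $\widetilde{W}_l(L)=\frac1N\int_{S_E}\rho_L(\theta)^{N-l}\,d\theta=\frac{N-l}{N}\int_L|x|_2^{-l}\,dx$, with $S_E$ the unit sphere of $E$. For compact convex sets $L\subset E$ that do not contain the origin in their relative interior, or that are empty or lower-dimensional, $\widetilde{W}_l(L)$ is understood as $\frac{N-l}{N}\int_L|x|_2^{-l}\,dx$ (with $dx$ being $N$-dimensional Lebesgue measure on $E$). *)

theory Defs
  imports "HOL-Analysis.Analysis"
begin

definition convex_body_in :: "'a::euclidean_space set \<Rightarrow> 'a set \<Rightarrow> bool" where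
  "convex_body_in E L \<longleftrightarrow>
     L \<subseteq> E \<and> convex L \<and> compact L \<and> (top_of_set E) interior_of L \<noteq> {}"

abbreviation convex_body :: "'a::euclidean_space set \<Rightarrow> bool" where
  "convex_body K \<equiv> convex_body_in UNIV K"

definition radial_function :: "'a::euclidean_space set \<Rightarrow> 'a \<Rightarrow> real" where
  "radial_function K \<xi> = (GREATEST a. 0 < a \<and> a *\<^sub>R \<xi> \<in> K)"

text \<open>A function on the unit sphere is of class \<open>C\<^sup>1\<close>, the sphere being a closed submanifold,
  iff it is the restriction of a \<open>C\<^sup>1\<close> function on an open neighbourhood of the sphere.\<close>

definition C1_on_sphere :: "('a::euclidean_space \<Rightarrow> real) \<Rightarrow> bool" where
  "C1_on_sphere f \<longleftrightarrow>
     (\<exists>U g (g' :: 'a \<Rightarrow> 'a \<Rightarrow>\<^sub>L real).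
        open U \<and> sphere 0 1 \<subseteq> U \<and>
        (\<forall>x\<in>U. (g has_derivative blinfun_apply (g' x)) (at x)) \<and>
        continuous_on U g' \<and>
        (\<forall>x\<in>sphere 0 1. g x = f x))"

text \<open>For a convex body with the origin in its interior, the boundary is a \<open>C\<^sup>1\<close> manifold iff
  the radial function is \<open>C\<^sup>1\<close> on the sphere; the latter form is used here.\<close>

definition C1_convex_body :: "'a::euclidean_space set \<Rightarrow> bool" where
  "C1_convex_body K \<longleftrightarrow>
     convex_body K \<and> 0 \<in> interior K \<and> C1_on_sphere (radial_function K)"

definition perp :: "'a::euclidean_space \<Rightarrow> 'a set" where
  "perp \<xi> = {x. x \<bullet> \<xi> = 0}"

definition orthonormal_basis_of :: "'a::euclidean_space set \<Rightarrow> 'a set \<Rightarrow> bool" where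
  "orthonormal_basis_of E B \<longleftrightarrow>
     pairwise orthogonal B \<and> (\<forall>b\<in>B. norm b = 1) \<and> span B = E"

text \<open>The \<open>dim E\<close>-dimensional Lebesgue measure on a linear subspace \<open>E\<close>, as a Borel measure on
  the ambient space concentrated on \<open>E\<close>. It is built as \<^const>\<open>lborel\<close> is, with an orthonormal
  basis of \<open>E\<close> in place of \<^const>\<open>Basis\<close>; by rotation invariance the choice of the basis does
  not matter.\<close>

definition lborel_subspace :: "'a::euclidean_space set \<Rightarrow> 'a measure" where
  "lborel_subspace E =
     (let B = (SOME B. orthonormal_basis_of E B)
      in distr (\<Pi>\<^sub>M b\<in>B. (lborel :: real measure)) borel (\<lambda>c. \<Sum>b\<in>B. c b *\<^sub>R b))"

definition radial_sum_ball :: "'a::euclidean_space set \<Rightarrow> 'a set \<Rightarrow> real \<Rightarrow> 'a set" where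
  "radial_sum_ball E L s =
     {0} \<union> {x \<in> E - {0}. norm x \<le> radial_function L (x /\<^sub>R norm x) + s}"

text \<open>The case distinction follows the two-part definition of \<open>W\<^sub>l(L)\<close>: a coefficient of the volume
  of the radial sum if \<open>L\<close> is a convex body in \<open>E\<close> with the origin in its relative interior, and
  the integral expression for all other sets. The coefficients of the expansion are unique for
  \<open>l \<le> dim E\<close>. At \<open>x = 0\<close> the integrand is irrelevant, \<open>{0}\<close> being a null set if \<open>dim E > 0\<close>.\<close>

definition dual_quermassintegral :: "'a::euclidean_space set \<Rightarrow> nat \<Rightarrow> 'a set \<Rightarrow> real" where
  "dual_quermassintegral E l L =
     (if convex_body_in E L \<and> 0 \<in> rel_interior L
      then (THE w. \<exists>W :: nat \<Rightarrow> real. w = W l \<and>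
              (\<forall>s\<ge>0. measure (lborel_subspace E) (radial_sum_ball E L s) =
                 (\<Sum>j\<le>dim E. real (dim E choose j) * W j * s ^ j)))
      else (real (dim E) - real l) / real (dim E) *
             (LINT x:L|lborel_subspace E. 1 / norm x ^ l))"

definition is_max_over_reals :: "(real \<Rightarrow> real) \<Rightarrow> real \<Rightarrow> bool" where
  "is_max_over_reals f m \<longleftrightarrow> m \<in> range f \<and> (\<forall>t. f t \<le> m)"

end

theory Submission
  imports Defs "HOL-Probability.Distributions"
begin

text \<open>
  Let \<open>A(\<xi>, t)\<close> be the integral of \<open>|y|\<^sup>-\<^sup>l\<close> over the section of \<open>K\<close> at height \<open>t\<close> over \<open>\<xi>\<^sup>\<bottom>\<close>, shifted
  into \<open>\<xi>\<^sup>\<bottom>\<close>. Polar coordinates in \<open>\<xi>\<^sup>\<bottom>\<close> show that it is the dual quermassintegral up to a constant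
  (\<open>dual_quermassintegral_section\<close>), so \<open>A(\<xi>, t) \<le> A(\<xi>, 0)\<close> for all \<open>\<xi>\<close> and \<open>t\<close>.

  Instead of differentiating \<open>A(\<xi>, \<sqdot>)\<close>, which leads to derivatives of the radial function \<open>\<rho>\<close>, one
  averages over all directions with a positive weight:
  \<open>P(t) = \<integral> exp (\<xi> \<bullet> \<eta> - |\<xi>|\<^sup>2 / 2) |\<xi>|\<^sup>-\<^sup>2 A(\<xi> / |\<xi>|, t) d\<xi>\<close> still has its maximum at \<open>t = 0\<close>. After
  exchanging the integrations the body enters only as the domain of integration for \<open>x\<close>, while for
  fixed \<open>x = |x| \<theta>\<close> the directions \<open>\<xi>\<close> from which \<open>x\<close> is seen at height \<open>t\<close> contribute a smooth
  function of \<open>t / |x|\<close> (\<open>weight_over_directions\<close>). A ball \<open>r B \<subseteq> K\<close> is treated separately: its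
  contribution is a constant times \<open>(r\<^sup>2 - t\<^sup>2)\<^sup>p\<^sup>/\<^sup>2\<close> with \<open>p = n - 1 - l\<close>, which has derivative 0 at
  \<open>t = 0\<close>. For the rest of \<open>K\<close> the derivative of the
  directional integral at 0 is a Gaussian integral over \<open>\<theta>\<^sup>\<bottom>\<close>, and \<open>P'(0) \<le> 0\<close> becomes
  \<open>\<integral> |x|\<^sup>-\<^sup>l\<^sup>-\<^sup>2 (\<theta> \<bullet> \<eta>) exp (- (\<theta> \<bullet> \<eta>)\<^sup>2 / 2) dx \<le> 0\<close> over \<open>x \<in> K - r B\<close>
  (\<open>first_variation_nonpos\<close>). The left hand side is odd in \<open>\<eta>\<close>, so it vanishes.

  Linear combinations of the functions \<open>s exp (- j s\<^sup>2)\<close> approximate \<open>sinh s\<close> uniformly on bounded intervals, and the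
  exponentials \<open>exp (\<theta> \<bullet> \<eta>)\<close> span an algebra to which the Stone-Weierstrass theorem applies. Hence
  \<open>\<integral> |x|\<^sup>-\<^sup>l\<^sup>-\<^sup>2 (q(\<theta>) - q(-\<theta>)) dx = 0\<close> over \<open>K - r B\<close> for every continuous \<open>q\<close> on the sphere
  (\<open>odd_moments_vanish\<close>). For \<open>q = \<rho>\<close>, subtracting the equally vanishing integral over \<open>- K\<close> yields
  the integral of \<open>(1\<^sub>K - 1\<^bsub>-K\<^esub>) (\<rho>(\<theta>) - \<rho>(-\<theta>))\<close> against a positive density. That integrand is nonnegative and is
  positive wherever \<open>1\<^sub>K \<noteq> 1\<^bsub>-K\<^esub>\<close>, which forces \<open>K = - K\<close> (\<open>central_symmetry_from_sections\<close>).
\<close>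

abbreviation (input) dir :: "'a::real_normed_vector \<Rightarrow> 'a" where
  "dir x \<equiv> x /\<^sub>R norm x"

section \<open>Lebesgue measure on subspaces\<close>

lemma measurable_sum_PiM_lborel [measurable]:
  fixes B :: "'a::euclidean_space set"
  shows "(\<lambda>c. \<Sum>b\<in>B. c b *\<^sub>R b) \<in> borel_measurable (Pi\<^sub>M B (\<lambda>_. lborel :: real measure))"
  by (rule borel_measurable_sum) measurable

text \<open>The measures \<^const>\<open>lborel_subspace\<close> are images of such products, so this is the source of their
  translation invariance (\<open>k = 1\<close>) and of their scaling behaviour (\<open>v = 0\<close>).\<close>

lemma nn_integral_PiM_lborel_affine:
  fixes G :: "'a::euclidean_space \<Rightarrow> ennreal" and v :: "'a \<Rightarrow> real"
  assumes "finite B" and k: "k > 0" and "G \<in> borel_measurable borel"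
  shows "(\<integral>\<^sup>+c. G (\<Sum>b\<in>B. (k * c b + v b) *\<^sub>R b) \<partial>Pi\<^sub>M B (\<lambda>_. lborel))
       = ennreal ((1 / k) ^ card B) * (\<integral>\<^sup>+c. G (\<Sum>b\<in>B. c b *\<^sub>R b) \<partial>Pi\<^sub>M B (\<lambda>_. lborel))"
  using assms(1,3)
proof (induction B arbitrary: G)
  case empty
  then show ?case by (simp add: nn_integral_cmult)
next
  case (insert b B)
  interpret product_sigma_finite "\<lambda>_::'a. lborel :: real measure" by standard
  note [measurable] = insert.prems
  have sum_upd: "(\<Sum>b'\<in>B. (k * (c(b := y)) b' + v b') *\<^sub>R b') = (\<Sum>b'\<in>B. (k * c b' + v b') *\<^sub>R b')"
       "(\<Sum>b'\<in>B. (c(b := y)) b' *\<^sub>R b') = (\<Sum>b'\<in>B. c b' *\<^sub>R b')" for c y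
    using insert.hyps by (auto intro!: sum.cong)
  have m1: "(\<lambda>c. \<Sum>b\<in>insert b B. (k * c b + v b) *\<^sub>R b) \<in> borel_measurable (Pi\<^sub>M (insert b B) (\<lambda>_. lborel :: real measure))"
    by (rule borel_measurable_sum) measurable
  have "(\<integral>\<^sup>+c. G (\<Sum>b\<in>insert b B. (k * c b + v b) *\<^sub>R b) \<partial>Pi\<^sub>M (insert b B) (\<lambda>_. lborel))
      = (\<integral>\<^sup>+c. \<integral>\<^sup>+y. G (\<Sum>b'\<in>insert b B. (k * (c(b := y)) b' + v b') *\<^sub>R b') \<partial>lborel \<partial>Pi\<^sub>M B (\<lambda>_. lborel))"
    by (rule product_nn_integral_insert[OF insert.hyps]) (rule measurable_compose[OF m1 insert.prems])
  also have "\<dots> = (\<integral>\<^sup>+c. (\<lambda>z. \<integral>\<^sup>+y. G ((k * y + v b) *\<^sub>R b + z) \<partial>lborel) (\<Sum>b'\<in>B. (k * c b' + v b') *\<^sub>R b') \<partial>Pi\<^sub>M B (\<lambda>_. lborel))"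
    using insert.hyps by (simp add: sum_upd del: fun_upd_apply) simp
  also have "\<dots> = ennreal ((1 / k) ^ card B) * (\<integral>\<^sup>+c. (\<lambda>z. \<integral>\<^sup>+y. G ((k * y + v b) *\<^sub>R b + z) \<partial>lborel) (\<Sum>b'\<in>B. c b' *\<^sub>R b') \<partial>Pi\<^sub>M B (\<lambda>_. lborel))"
    by (rule insert.IH) measurable
  also have "(\<lambda>z. \<integral>\<^sup>+y. G ((k * y + v b) *\<^sub>R b + z) \<partial>lborel) = (\<lambda>z. ennreal (1 / k) * (\<integral>\<^sup>+y. G (y *\<^sub>R b + z) \<partial>lborel))"
  proof
    fix z
    have "(\<integral>\<^sup>+y. G (y *\<^sub>R b + z) \<partial>lborel) = ennreal k * (\<integral>\<^sup>+y. G ((k * y + v b) *\<^sub>R b + z) \<partial>lborel)"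
      using k by (subst nn_integral_real_affine[where c = k and t = "v b"]) (auto simp: add.commute)
    then show "(\<integral>\<^sup>+y. G ((k * y + v b) *\<^sub>R b + z) \<partial>lborel) = ennreal (1 / k) * (\<integral>\<^sup>+y. G (y *\<^sub>R b + z) \<partial>lborel)"
      using k by (simp add: mult.assoc[symmetric] ennreal_mult[symmetric])
  qed
  also have "(\<integral>\<^sup>+c. ennreal (1 / k) * (\<integral>\<^sup>+y. G (y *\<^sub>R b + (\<Sum>b'\<in>B. c b' *\<^sub>R b')) \<partial>lborel) \<partial>Pi\<^sub>M B (\<lambda>_. lborel))
     = ennreal (1 / k) * (\<integral>\<^sup>+c. \<integral>\<^sup>+y. G (\<Sum>b'\<in>insert b B. (c(b := y)) b' *\<^sub>R b') \<partial>lborel \<partial>Pi\<^sub>M B (\<lambda>_. lborel))"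
    using insert.hyps by (subst nn_integral_cmult) (auto simp: sum_upd simp del: fun_upd_apply, simp)
  also have "(\<integral>\<^sup>+c. \<integral>\<^sup>+y. G (\<Sum>b'\<in>insert b B. (c(b := y)) b' *\<^sub>R b') \<partial>lborel \<partial>Pi\<^sub>M B (\<lambda>_. lborel))
     = (\<integral>\<^sup>+c. G (\<Sum>b\<in>insert b B. c b *\<^sub>R b) \<partial>Pi\<^sub>M (insert b B) (\<lambda>_. lborel))"
    by (rule product_nn_integral_insert[OF insert.hyps, symmetric])
       (rule measurable_compose[OF measurable_sum_PiM_lborel insert.prems])
  also have "ennreal ((1 / k) ^ card B) * (ennreal (1 / k) * (\<integral>\<^sup>+c. G (\<Sum>b\<in>insert b B. c b *\<^sub>R b) \<partial>Pi\<^sub>M (insert b B) (\<lambda>_. lborel)))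
     = ennreal ((1 / k) ^ card (insert b B)) * (\<integral>\<^sup>+c. G (\<Sum>b\<in>insert b B. c b *\<^sub>R b) \<partial>Pi\<^sub>M (insert b B) (\<lambda>_. lborel))"
    using insert.hyps k by (simp add: mult.assoc[symmetric] ennreal_mult[symmetric] mult.commute)
  finally show ?case .
qed

definition gauss_mass :: ennreal where
  "gauss_mass = (\<integral>\<^sup>+t. ennreal (exp (- t\<^sup>2 / 2)) \<partial>lborel)"

lemma gauss_mass_finite_pos: "gauss_mass < \<infinity>" "gauss_mass > 0"
proof -
  have "integrable lborel (\<lambda>t::real. exp (- t\<^sup>2 / 2))"
    using integrable_mult_right[OF integrable_normal_density[of 1 0], of "sqrt (2 * pi)"]
    by (simp add: normal_density_def)
  then show "gauss_mass < \<infinity>" 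
    unfolding gauss_mass_def by (simp add: integrable_iff_bounded)
  show "gauss_mass > 0"
    unfolding gauss_mass_def
    by (subst zero_less_iff_neq_zero, subst nn_integral_0_iff) (auto simp: ennreal_eq_0_iff not_le)
qed

text \<open>The Gaussian factorises in every orthonormal basis, so its mass depends on the dimension only; it
  is the normalisation by which measures built from different bases are compared.\<close>

lemma gauss_PiM_orthonormal:
  fixes B :: "'a::euclidean_space set"
  assumes "finite B" "pairwise orthogonal B" "\<And>b. b \<in> B \<Longrightarrow> norm b = 1"
  shows "(\<integral>\<^sup>+c. ennreal (exp (- (norm (\<Sum>b\<in>B. c b *\<^sub>R b))\<^sup>2 / 2)) \<partial>Pi\<^sub>M B (\<lambda>_. lborel)) = gauss_mass ^ card B"
proof -
  interpret product_sigma_finite "\<lambda>_::'a. lborel :: real measure" by standard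
  have "(norm (\<Sum>b\<in>B. c b *\<^sub>R b))\<^sup>2 = (\<Sum>b\<in>B. (c b)\<^sup>2)" for c :: "'a \<Rightarrow> real"
  proof -
    have "(norm (\<Sum>b\<in>B. c b *\<^sub>R b))\<^sup>2 = (\<Sum>b\<in>B. (norm (c b *\<^sub>R b))\<^sup>2)"
      using assms by (intro norm_sum_Pythagorean) (auto simp: pairwise_def orthogonal_def)
    also have "\<dots> = (\<Sum>b\<in>B. (c b)\<^sup>2)"
      using assms by (intro sum.cong) auto
    finally show ?thesis .
  qed
  then have "ennreal (exp (- (norm (\<Sum>b\<in>B. c b *\<^sub>R b))\<^sup>2 / 2)) = (\<Prod>b\<in>B. ennreal (exp (- (c b)\<^sup>2 / 2)))" for c :: "'a \<Rightarrow> real"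
    using assms(1) by (simp add: prod_ennreal sum_negf[symmetric] sum_divide_distrib exp_sum)
  then show ?thesis
    using assms(1) by (simp add: product_nn_integral_prod[where f="\<lambda>_ t. ennreal (exp (- (t\<^sup>2 / 2)))"] gauss_mass_def)
qed

lemma sigma_finite_if_gauss_finite:
  fixes \<nu> :: "'a::euclidean_space measure"
  assumes [measurable_cong]: "sets \<nu> = sets borel"
    and fin: "(\<integral>\<^sup>+x. ennreal (exp (- (norm x)\<^sup>2 / 2)) \<partial>\<nu>) < \<infinity>"
  shows "sigma_finite_measure \<nu>"
proof
  define A where "A = (\<lambda>n. cball (0::'a) (real n))"
  have [measurable]: "A n \<in> sets borel" for n by (simp add: A_def)
  have "emeasure \<nu> (A n) < \<infinity>" for n
  proof -
    have "emeasure \<nu> (A n) = (\<integral>\<^sup>+x. indicator (A n) x \<partial>\<nu>)"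
      by (simp add: assms(1))
    also have "\<dots> \<le> (\<integral>\<^sup>+x. ennreal (exp ((real n)\<^sup>2 / 2)) * ennreal (exp (- (norm x)\<^sup>2 / 2)) \<partial>\<nu>)"
      by (intro nn_integral_mono)
         (auto simp: A_def indicator_def ennreal_mult[symmetric] exp_add[symmetric] simp flip: ennreal_1 intro!: power_mono)
    also have "\<dots> = ennreal (exp ((real n)\<^sup>2 / 2)) * (\<integral>\<^sup>+x. ennreal (exp (- (norm x)\<^sup>2 / 2)) \<partial>\<nu>)"
      by (rule nn_integral_cmult) measurable
    also have "\<dots> < \<infinity>"
      using fin by (simp add: ennreal_mult_less_top)
    finally show ?thesis .
  qed
  then show "\<exists>C. countable C \<and> C \<subseteq> sets \<nu> \<and> \<Union>C = space \<nu> \<and> (\<forall>a\<in>C. emeasure \<nu> a \<noteq> \<infinity>)"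
    using sets_eq_imp_space_eq[OF assms(1)]
    by (intro exI[of _ "range A"]) (auto simp: A_def less_top real_arch_simple assms(1))
qed

text \<open>Both measures are compared through \<open>\<integral>\<integral> g x 1\<^sub>A (y + x) d\<nu> y dx\<close>, \<open>g\<close> the Gaussian: shifting
  \<open>y\<close> resp. \<open>x\<close> turns it into \<open>(\<integral> g dx) \<nu> A\<close> resp. \<open>|A| \<integral> g d\<nu>\<close>.\<close>

lemma translation_invariant_eq_lborel:
  fixes \<nu> :: "'a::euclidean_space measure"
  assumes [simp]: "sets \<nu> = sets borel"
    and inv: "\<And>G v. G \<in> borel_measurable borel \<Longrightarrow> (\<integral>\<^sup>+x. G (x + v) \<partial>\<nu>) = (\<integral>\<^sup>+x. G x \<partial>\<nu>)"
    and mass: "(\<integral>\<^sup>+x. ennreal (exp (- (norm x)\<^sup>2 / 2)) \<partial>\<nu>) = Z"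
      "(\<integral>\<^sup>+x. ennreal (exp (- (norm (x::'a))\<^sup>2 / 2)) \<partial>lborel) = Z" "0 < Z" "Z < \<infinity>"
  shows "\<nu> = (lborel :: 'a measure)"
proof (rule measure_eqI)
  show "sets \<nu> = sets lborel" by simp
  fix A assume "A \<in> sets \<nu>"
  then have [measurable]: "A \<in> sets borel" by simp
  interpret \<nu>: sigma_finite_measure \<nu>
    using mass by (intro sigma_finite_if_gauss_finite) auto
  interpret pair_sigma_finite \<nu> lborel by standard
  have [measurable_cong]: "sets \<nu> = sets borel" by simp
  define g :: "'a \<Rightarrow> ennreal" where "g = (\<lambda>x. ennreal (exp (- (norm x)\<^sup>2 / 2)))"
  have [measurable]: "g \<in> borel_measurable borel" unfolding g_def by measurable
  have linv: "(\<integral>\<^sup>+x. G (x + v) \<partial>lborel) = (\<integral>\<^sup>+x. G x \<partial>lborel)" if [measurable]: "G \<in> borel_measurable borel" for G and v :: 'a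
  proof -
    have "(\<integral>\<^sup>+x. G x \<partial>lborel) = (\<integral>\<^sup>+x. G x \<partial>(density (distr lborel borel (\<lambda>x. v + 1 *\<^sub>R x)) (\<lambda>_. ennreal (\<bar>1\<bar>^DIM('a)))))"
      by (subst lborel_affine[of 1 v, symmetric]) auto
    then show ?thesis by (simp add: nn_integral_density nn_integral_distr add.commute)
  qed
  have "Z * emeasure \<nu> A = (\<integral>\<^sup>+x. g x * (\<integral>\<^sup>+y. indicator A y \<partial>\<nu>) \<partial>lborel)"
    using mass(2) by (simp add: nn_integral_multc g_def)
  also have "\<dots> = (\<integral>\<^sup>+x. \<integral>\<^sup>+y. g x * indicator A (y + x) \<partial>\<nu> \<partial>lborel)"
  proof (rule nn_integral_cong)
    fix x :: 'a
    show "g x * (\<integral>\<^sup>+y. indicator A y \<partial>\<nu>) = (\<integral>\<^sup>+y. g x * indicator A (y + x) \<partial>\<nu>)"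
      by (subst inv[of "indicator A" x, symmetric]) (auto simp: nn_integral_cmult)
  qed
  also have "\<dots> = (\<integral>\<^sup>+y. \<integral>\<^sup>+x. g x * indicator A (y + x) \<partial>lborel \<partial>\<nu>)"
    by (rule Fubini') measurable
  also have "\<dots> = (\<integral>\<^sup>+y. \<integral>\<^sup>+x. g (y - x) * indicator A x \<partial>lborel \<partial>\<nu>)"
  proof (rule nn_integral_cong)
    fix y :: 'a
    show "(\<integral>\<^sup>+x. g x * indicator A (y + x) \<partial>lborel) = (\<integral>\<^sup>+x. g (y - x) * indicator A x \<partial>lborel)"
      by (subst linv[of "\<lambda>x. g (y - x) * indicator A x" y, symmetric]) (auto simp: g_def add.commute)
  qed
  also have "\<dots> = (\<integral>\<^sup>+x. \<integral>\<^sup>+y. g (y - x) * indicator A x \<partial>\<nu> \<partial>lborel)"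
    by (rule Fubini'[symmetric]) measurable
  also have "\<dots> = (\<integral>\<^sup>+x. Z * indicator A x \<partial>lborel)"
  proof (rule nn_integral_cong)
    fix x :: 'a
    show "(\<integral>\<^sup>+y. g (y - x) * indicator A x \<partial>\<nu>) = Z * indicator A x"
      using mass(1) inv[of g "-x"] by (auto simp: nn_integral_multc g_def)
  qed
  also have "\<dots> = Z * emeasure lborel A"
    by (simp add: nn_integral_cmult)
  finally show "emeasure \<nu> A = emeasure lborel A"
    using mass(3,4) by (auto simp: ennreal_mult_cancel_left)
qed

lemma orthonormal_basis_of_exists:
  fixes E :: "'a::euclidean_space set"
  assumes "subspace E"
  shows "\<exists>B. orthonormal_basis_of E B"
  unfolding orthonormal_basis_of_def
  using orthonormal_basis_subspace[OF assms] by metis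

lemma lborel_subspace_basis:
  fixes E :: "'a::euclidean_space set"
  assumes "subspace E"
  obtains B where "finite B" "pairwise orthogonal B" "\<forall>b\<in>B. norm b = 1" "span B = E"
    "independent B" "card B = dim E"
    "lborel_subspace E = distr (Pi\<^sub>M B (\<lambda>_. lborel)) borel (\<lambda>c. \<Sum>b\<in>B. c b *\<^sub>R b)"
proof -
  define B where "B = (SOME B. orthonormal_basis_of E B)"
  have B: "orthonormal_basis_of E B"
    unfolding B_def by (rule someI_ex[OF orthonormal_basis_of_exists[OF assms]])
  then have *: "pairwise orthogonal B" "\<forall>b\<in>B. norm b = 1" "span B = E"
    by (auto simp: orthonormal_basis_of_def)
  then have "0 \<notin> B" by force
  with * have ind: "independent B" by (simp add: pairwise_orthogonal_independent)
  have "lborel_subspace E = distr (Pi\<^sub>M B (\<lambda>_. lborel)) borel (\<lambda>c. \<Sum>b\<in>B. c b *\<^sub>R b)"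
    unfolding lborel_subspace_def B_def[symmetric] Let_def ..
  with * ind show ?thesis
    using dim_span_eq_card_independent[OF ind] independent_imp_finite[OF ind] by (intro that[of B]) auto
qed

lemma sets_lborel_subspace [simp, measurable_cong]: "sets (lborel_subspace E) = sets borel"
  by (simp add: lborel_subspace_def Let_def)

lemma space_lborel_subspace [simp]: "space (lborel_subspace E) = UNIV"
  by (simp add: lborel_subspace_def Let_def)

lemma measurable_lborel_subspace [simp]: "measurable (lborel_subspace E) M = measurable borel M"
  by (rule measurable_cong_sets) simp_all

lemma nn_integral_lborel_subspace_basis:
  fixes G :: "'a::euclidean_space \<Rightarrow> ennreal"
  assumes "G \<in> borel_measurable borel"
  shows "(\<integral>\<^sup>+x. G x \<partial>distr (Pi\<^sub>M B (\<lambda>_. lborel :: real measure)) borel (\<lambda>c. \<Sum>b\<in>B. c b *\<^sub>R b))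
       = (\<integral>\<^sup>+c. G (\<Sum>b\<in>B. c b *\<^sub>R b) \<partial>Pi\<^sub>M B (\<lambda>_. lborel))"
  using assms by (intro nn_integral_distr) auto

lemma AE_lborel_subspace:
  fixes E :: "'a::euclidean_space set"
  assumes "subspace E"
  shows "AE x in lborel_subspace E. x \<in> E"
proof -
  obtain B where B: "finite B" "pairwise orthogonal B" "\<forall>b\<in>B. norm b = 1" "span B = E"
    "independent B" "card B = dim E"
    "lborel_subspace E = distr (Pi\<^sub>M B (\<lambda>_. lborel)) borel (\<lambda>c. \<Sum>b\<in>B. c b *\<^sub>R b)"
    by (rule lborel_subspace_basis[OF assms])
  have cl: "closed E" by (rule closed_subspace[OF assms])
  then have "{x \<in> space borel. x \<in> E} \<in> sets borel" by simp
  moreover have "(\<Sum>b\<in>B. c b *\<^sub>R b) \<in> E" for c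
    unfolding B(4)[symmetric] by (intro span_sum span_scale span_base)
  ultimately show ?thesis
    unfolding B(7) by (subst AE_distr_iff) auto
qed

lemma nn_integral_lborel_subspace_translate:
  fixes E :: "'a::euclidean_space set"
  assumes E: "subspace E" and v: "v \<in> E" and [measurable]: "G \<in> borel_measurable borel"
  shows "(\<integral>\<^sup>+x. G (x + v) \<partial>lborel_subspace E) = (\<integral>\<^sup>+x. G x \<partial>lborel_subspace E)"
proof -
  obtain B where B: "finite B" "pairwise orthogonal B" "\<forall>b\<in>B. norm b = 1" "span B = E"
    "independent B" "card B = dim E"
    "lborel_subspace E = distr (Pi\<^sub>M B (\<lambda>_. lborel)) borel (\<lambda>c. \<Sum>b\<in>B. c b *\<^sub>R b)"
    by (rule lborel_subspace_basis[OF E])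
  obtain u where u: "v = (\<Sum>b\<in>B. u b *\<^sub>R b)"
    using v B(1,4) by (auto simp: span_finite)
  have "(\<integral>\<^sup>+x. G (x + v) \<partial>lborel_subspace E) = (\<integral>\<^sup>+c. G (\<Sum>b\<in>B. (1 * c b + u b) *\<^sub>R b) \<partial>Pi\<^sub>M B (\<lambda>_. lborel))"
    unfolding B(7) by (subst nn_integral_lborel_subspace_basis) (simp_all add: u sum.distrib scaleR_add_left)
  also have "\<dots> = (\<integral>\<^sup>+x. G x \<partial>lborel_subspace E)"
    unfolding B(7) by (subst nn_integral_lborel_subspace_basis) (simp_all add: nn_integral_PiM_lborel_affine[OF B(1), where k=1, simplified])
  finally show ?thesis .
qed

lemma nn_integral_lborel_subspace_scale:
  fixes E :: "'a::euclidean_space set"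
  assumes E: "subspace E" and k: "k > 0" and [measurable]: "G \<in> borel_measurable borel"
  shows "(\<integral>\<^sup>+x. G (k *\<^sub>R x) \<partial>lborel_subspace E) = ennreal ((1 / k) ^ dim E) * (\<integral>\<^sup>+x. G x \<partial>lborel_subspace E)"
proof -
  obtain B where B: "finite B" "pairwise orthogonal B" "\<forall>b\<in>B. norm b = 1" "span B = E"
    "independent B" "card B = dim E"
    "lborel_subspace E = distr (Pi\<^sub>M B (\<lambda>_. lborel)) borel (\<lambda>c. \<Sum>b\<in>B. c b *\<^sub>R b)"
    by (rule lborel_subspace_basis[OF E])
  have "(\<integral>\<^sup>+x. G (k *\<^sub>R x) \<partial>lborel_subspace E) = (\<integral>\<^sup>+c. G (\<Sum>b\<in>B. (k * c b + 0) *\<^sub>R b) \<partial>Pi\<^sub>M B (\<lambda>_. lborel))"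
    unfolding B(7) by (subst nn_integral_lborel_subspace_basis) (simp_all add: scaleR_sum_right)
  also have "\<dots> = ennreal ((1 / k) ^ dim E) * (\<integral>\<^sup>+x. G x \<partial>lborel_subspace E)"
    unfolding B(7) by (subst nn_integral_lborel_subspace_basis)
      (simp_all add: nn_integral_PiM_lborel_affine[OF B(1) k, of G "\<lambda>_. 0", simplified] B(6))
  finally show ?thesis .
qed

lemma gauss_lborel_subspace:
  fixes E :: "'a::euclidean_space set"
  assumes E: "subspace E"
  shows "(\<integral>\<^sup>+x. ennreal (exp (- (norm x)\<^sup>2 / 2)) \<partial>lborel_subspace E) = gauss_mass ^ dim E"
proof -
  obtain B where B: "finite B" "pairwise orthogonal B" "\<forall>b\<in>B. norm b = 1" "span B = E"
    "independent B" "card B = dim E"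
    "lborel_subspace E = distr (Pi\<^sub>M B (\<lambda>_. lborel)) borel (\<lambda>c. \<Sum>b\<in>B. c b *\<^sub>R b)"
    by (rule lborel_subspace_basis[OF E])
  show ?thesis
    using gauss_PiM_orthonormal[OF B(1,2) B(3)[rule_format]]
    by (simp add: B(6,7) nn_integral_lborel_subspace_basis)
qed

lemma sigma_finite_lborel_subspace:
  fixes E :: "'a::euclidean_space set"
  assumes E: "subspace E"
  shows "sigma_finite_measure (lborel_subspace E)"
  using gauss_lborel_subspace[OF E] gauss_mass_finite_pos
  by (intro sigma_finite_if_gauss_finite) (auto simp: power_less_top_ennreal)

lemma gauss_lborel:
  "(\<integral>\<^sup>+x. ennreal (exp (- (norm x)\<^sup>2 / 2)) \<partial>(lborel :: 'a::euclidean_space measure)) = gauss_mass ^ DIM('a)"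
proof -
  have "pairwise orthogonal (Basis :: 'a set)"
    by (auto simp: pairwise_def orthogonal_def inner_Basis)
  from gauss_PiM_orthonormal[OF finite_Basis this norm_Basis]
  show ?thesis
    by (subst lborel_eq) (subst nn_integral_lborel_subspace_basis, simp_all)
qed

lemma perp_subspace: "subspace (perp \<xi>)"
  by (auto simp: perp_def subspace_def inner_add_left)

lemma dim_perp:
  fixes \<xi> :: "'a::euclidean_space"
  assumes "norm \<xi> = 1"
  shows "dim (perp \<xi>) = DIM('a) - 1"
  using dim_hyperplane[of \<xi>] assms by (force simp: perp_def inner_commute)

text \<open>Adjoining \<open>\<xi>\<close> to the basis chosen for \<open>\<xi>\<^sup>\<bottom>\<close> gives an orthonormal basis of the whole space, and the
  product measure over it is Lebesgue measure, both being translation invariant with the same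
  Gaussian mass.\<close>

lemma nn_integral_lborel_perp:
  fixes \<xi> :: "'a::euclidean_space"
  assumes \<xi>: "norm \<xi> = 1" and [measurable]: "G \<in> borel_measurable borel"
  shows "(\<integral>\<^sup>+x. G x \<partial>lborel) = (\<integral>\<^sup>+y. \<integral>\<^sup>+t. G (y + t *\<^sub>R \<xi>) \<partial>lborel \<partial>lborel_subspace (perp \<xi>))"
proof -
  obtain B where B: "finite B" "pairwise orthogonal B" "\<forall>b\<in>B. norm b = 1" "span B = perp \<xi>"
    "independent B" "card B = dim (perp \<xi>)"
    "lborel_subspace (perp \<xi>) = distr (Pi\<^sub>M B (\<lambda>_. lborel)) borel (\<lambda>c. \<Sum>b\<in>B. c b *\<^sub>R b)"
    by (rule lborel_subspace_basis[OF perp_subspace[of \<xi>]])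
  interpret product_sigma_finite "\<lambda>_::'a. lborel :: real measure" by standard
  define C where "C = insert \<xi> B"
  have Bp: "b \<bullet> \<xi> = 0" if "b \<in> B" for b
    using span_base[OF that] B(4) by (auto simp: perp_def)
  then have \<xi>B: "\<xi> \<notin> B" using \<xi> by force
  have C: "finite C" "pairwise orthogonal C" "\<And>b. b \<in> C \<Longrightarrow> norm b = 1"
    using B Bp \<xi> \<xi>B by (auto simp: C_def pairwise_insert orthogonal_def inner_commute)
  have cardC: "card C = DIM('a)"
    using B(1,6) \<xi>B dim_perp[OF \<xi>] by (simp add: C_def)
  have "independent C"
    using C(2,3) by (intro pairwise_orthogonal_independent) force+
  then have spanC: "span C = UNIV"
    using cardC by (metis card_eq_dim dim_UNIV span_eq subset_UNIV span_UNIV span_mono C(1))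
  define \<nu> where "\<nu> = distr (Pi\<^sub>M C (\<lambda>_. lborel :: real measure)) borel (\<lambda>c. \<Sum>b\<in>C. c b *\<^sub>R b)"
  have gC: "(\<integral>\<^sup>+x. ennreal (exp (- (norm x)\<^sup>2 / 2)) \<partial>\<nu>) = gauss_mass ^ DIM('a)"
    using gauss_PiM_orthonormal[OF C] cardC by (simp add: \<nu>_def nn_integral_lborel_subspace_basis)
  have "\<nu> = lborel"
  proof (rule translation_invariant_eq_lborel)
    show "sets \<nu> = sets borel" by (simp add: \<nu>_def)
    show "(\<integral>\<^sup>+x. G (x + v) \<partial>\<nu>) = (\<integral>\<^sup>+x. G x \<partial>\<nu>)" if [measurable]: "G \<in> borel_measurable borel" for G v
    proof -
      obtain u where u: "v = (\<Sum>b\<in>C. u b *\<^sub>R b)"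
        using spanC C(1) by (auto simp: span_finite)
      have "(\<integral>\<^sup>+x. G (x + v) \<partial>\<nu>) = (\<integral>\<^sup>+c. G (\<Sum>b\<in>C. (1 * c b + u b) *\<^sub>R b) \<partial>Pi\<^sub>M C (\<lambda>_. lborel))"
        unfolding \<nu>_def by (subst nn_integral_lborel_subspace_basis) (simp_all add: u sum.distrib scaleR_add_left)
      also have "\<dots> = (\<integral>\<^sup>+x. G x \<partial>\<nu>)"
        unfolding \<nu>_def by (subst nn_integral_lborel_subspace_basis) (simp_all add: nn_integral_PiM_lborel_affine[OF C(1), where k=1, simplified])
      finally show ?thesis .
    qed
    show "(\<integral>\<^sup>+x. ennreal (exp (- (norm x)\<^sup>2 / 2)) \<partial>\<nu>) = gauss_mass ^ DIM('a)" by (rule gC)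
    show "(\<integral>\<^sup>+x. ennreal (exp (- (norm (x::'a))\<^sup>2 / 2)) \<partial>lborel) = gauss_mass ^ DIM('a)"
      by (rule gauss_lborel)
  qed (use gauss_mass_finite_pos in \<open>auto simp: power_less_top_ennreal zero_less_iff_neq_zero\<close>)
  have mC: "(\<lambda>c. G (\<Sum>b\<in>C. c b *\<^sub>R b)) \<in> borel_measurable (Pi\<^sub>M C (\<lambda>_. lborel))"
    by measurable
  have sum_upd: "(\<Sum>b\<in>B. (c(\<xi> := t)) b *\<^sub>R b) = (\<Sum>b\<in>B. c b *\<^sub>R b)" for c and t :: real
    using \<xi>B by (auto intro!: sum.cong)
  have "(\<integral>\<^sup>+x. G x \<partial>lborel) = (\<integral>\<^sup>+c. G (\<Sum>b\<in>C. c b *\<^sub>R b) \<partial>Pi\<^sub>M C (\<lambda>_. lborel))"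
    by (subst \<open>\<nu> = lborel\<close>[symmetric]) (simp add: \<nu>_def nn_integral_lborel_subspace_basis)
  also have "\<dots> = (\<integral>\<^sup>+c. \<integral>\<^sup>+t. G (\<Sum>b\<in>C. (c(\<xi> := t)) b *\<^sub>R b) \<partial>lborel \<partial>Pi\<^sub>M B (\<lambda>_. lborel))"
    using mC unfolding C_def by (intro product_nn_integral_insert[OF B(1) \<xi>B]) simp
  also have "\<dots> = (\<integral>\<^sup>+c. \<integral>\<^sup>+t. G ((\<Sum>b\<in>B. c b *\<^sub>R b) + t *\<^sub>R \<xi>) \<partial>lborel \<partial>Pi\<^sub>M B (\<lambda>_. lborel))"
    using B(1) \<xi>B by (simp add: C_def sum_upd del: fun_upd_apply) (simp add: add.commute)
  also have "\<dots> = (\<integral>\<^sup>+y. \<integral>\<^sup>+t. G (y + t *\<^sub>R \<xi>) \<partial>lborel \<partial>lborel_subspace (perp \<xi>))"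
    unfolding B(7) by (subst nn_integral_lborel_subspace_basis) auto
  finally show ?thesis .
qed

section \<open>Polar coordinates in a subspace\<close>

lemma AE_lborel_subspace_neq_0:
  fixes E :: "'a::euclidean_space set"
  assumes E: "subspace E" and d: "dim E \<ge> 1"
  shows "AE x in lborel_subspace E. x \<noteq> 0"
proof -
  let ?m = "emeasure (lborel_subspace E) {0}"
  have "?m \<le> (\<integral>\<^sup>+x. ennreal (exp (- (norm x)\<^sup>2 / 2)) \<partial>lborel_subspace E)"
  proof -
    have "?m = (\<integral>\<^sup>+x. indicator {0} x \<partial>lborel_subspace E)" by simp
    also have "\<dots> \<le> (\<integral>\<^sup>+x. ennreal (exp (- (norm x)\<^sup>2 / 2)) \<partial>lborel_subspace E)"
      by (intro nn_integral_mono) (auto simp: indicator_def)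
    finally show ?thesis .
  qed
  also have "\<dots> < \<infinity>"
    using gauss_lborel_subspace[OF E] gauss_mass_finite_pos by (simp add: power_less_top_ennreal)
  finally have fin: "?m < \<infinity>" .
  have "?m = (\<integral>\<^sup>+x. indicator {0} (2 *\<^sub>R x) \<partial>lborel_subspace E)"
  proof -
    have "?m = (\<integral>\<^sup>+x. indicator {0} x \<partial>lborel_subspace E)" by simp
    also have "\<dots> = (\<integral>\<^sup>+x. indicator {0} (2 *\<^sub>R x) \<partial>lborel_subspace E)"
      by (rule nn_integral_cong) (auto simp: indicator_def)
    finally show ?thesis .
  qed
  also have "\<dots> = ennreal ((1 / 2) ^ dim E) * ?m"
    by (subst nn_integral_lborel_subspace_scale[OF E]) auto
  finally have eq: "?m = ennreal ((1 / 2) ^ dim E) * ?m" .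
  obtain r where r: "?m = ennreal r" "r \<ge> 0" using fin by (cases ?m) auto
  have "r = (1 / 2) ^ dim E * r"
    using eq unfolding r(1) using r(2) by (simp add: ennreal_mult[symmetric])
  moreover have "(1 / 2 :: real) ^ dim E < 1"
    using d by (simp add: power_less_one_iff)
  ultimately have "r = 0" by (metis mult_cancel_right1 less_irrefl)
  then have "emeasure (lborel_subspace E) {0} = 0" using r by simp
  then show ?thesis
    by (intro AE_I[where N = "{0}"]) auto
qed

text \<open>Insert \<open>1 = \<integral> N (|y| / u)\<^sup>N 1\<^bsub>|y| \<le> u\<^esub> du / u\<close> into \<open>\<integral> G\<close>, swap the integrals and rescale \<open>y\<close> by \<open>u\<close>:
  this produces polar coordinates, the unit ball taking the role of the sphere.\<close>

lemma nn_integral_polar: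
  fixes E :: "'a::euclidean_space set"
  assumes E: "subspace E" and N: "dim E \<ge> 1" and [measurable]: "G \<in> borel_measurable borel"
  shows "(\<integral>\<^sup>+y. G y \<partial>lborel_subspace E)
    = (\<integral>\<^sup>+y. indicator (cball 0 1) y * (ennreal (real (dim E)) *
         (\<integral>\<^sup>+v. G ((v / norm y) *\<^sub>R y) * ennreal (v ^ (dim E - 1)) * indicator {0<..} v \<partial>lborel)) \<partial>lborel_subspace E)"
proof -
  let ?\<mu> = "lborel_subspace E" and ?N = "dim E"
  interpret \<mu>: sigma_finite_measure ?\<mu> by (rule sigma_finite_lborel_subspace[OF E])
  interpret pair_sigma_finite lborel ?\<mu> by standard
  \<comment> \<open>The measure \<open>\<psi>(|y| / u) du / u\<close> has total mass 1 for each \<open>y \<noteq> 0\<close>.\<close>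
  define \<psi> :: "real \<Rightarrow> ennreal" where "\<psi> = (\<lambda>r. ennreal (real ?N * r ^ ?N) * indicator {..1} r)"
  have [measurable]: "\<psi> \<in> borel_measurable borel" by (auto simp: \<psi>_def)
  have one: "(\<integral>\<^sup>+u. \<psi> (norm y / u) * ennreal (1 / u) * indicator {0<..} u \<partial>lborel) = 1" if "y \<noteq> 0" for y :: 'a
  proof -
    have "(\<integral>\<^sup>+u. \<psi> (norm y / u) * ennreal (1 / u) * indicator {0<..} u \<partial>lborel)
        = (\<integral>\<^sup>+u. ennreal (real ?N * norm y ^ ?N / u ^ (?N + 1)) * indicator {norm y..} u \<partial>lborel)"
      using that by (intro nn_integral_cong)
        (auto simp: \<psi>_def indicator_def ennreal_mult[symmetric] field_simps, smt (verit) zero_less_norm_iff)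
    also have "\<dots> = ennreal (0 - (- ((norm y / norm y) ^ ?N)))"
    proof (rule nn_integral_FTC_atLeast[where F = "\<lambda>u. - ((norm y / u) ^ ?N)"])
      have "((\<lambda>u. - ((norm y / u) ^ ?N)) \<longlongrightarrow> - (0 ^ ?N)) at_top"
        by (intro tendsto_intros tendsto_divide_0[OF tendsto_const] filterlim_at_top_imp_at_infinity filterlim_ident)
      then show "((\<lambda>u. - ((norm y / u) ^ ?N)) \<longlongrightarrow> 0) at_top" using N by (simp add: zero_power)
      show "((\<lambda>u. - ((norm y / u) ^ ?N)) has_field_derivative real ?N * norm y ^ ?N / x ^ (?N + 1)) (at x)"
        if "norm y \<le> x" for x
      proof -
        have "x > 0" using that \<open>y \<noteq> 0\<close> by (meson less_le_trans zero_less_norm_iff)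
        moreover obtain m where "?N = Suc m" using N by (cases ?N) auto
        moreover have "((\<lambda>u. norm y / u) has_field_derivative - norm y / x\<^sup>2) (at x)"
          using \<open>x > 0\<close> by (auto intro!: derivative_eq_intros simp: power2_eq_square)
        from DERIV_minus[OF DERIV_power[OF this, of ?N]]
        have "((\<lambda>u. - ((norm y / u) ^ ?N)) has_field_derivative
            - (real ?N * (- norm y / x\<^sup>2 * (norm y / x) ^ (?N - 1)))) (at x)" by simp
        ultimately show ?thesis
          by (simp add: power_divide field_simps power2_eq_square)
      qed
    qed (use that in \<open>auto intro!: divide_nonneg_nonneg mult_nonneg_nonneg zero_le_power
          intro: order_trans[OF norm_ge_zero]\<close>)
    finally show ?thesis using that by simp
  qed
  have "(\<integral>\<^sup>+y. G y \<partial>?\<mu>) = (\<integral>\<^sup>+y. \<integral>\<^sup>+u. G y * (\<psi> (norm y / u) * ennreal (1 / u) * indicator {0<..} u) \<partial>lborel \<partial>?\<mu>)"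
    using AE_lborel_subspace_neq_0[OF E N]
    by (intro nn_integral_cong_AE) (auto simp: nn_integral_cmult one)
  also have "\<dots> = (\<integral>\<^sup>+u. \<integral>\<^sup>+y. G y * (\<psi> (norm y / u) * ennreal (1 / u) * indicator {0<..} u) \<partial>?\<mu> \<partial>lborel)"
    by (rule Fubini') measurable
  also have "\<dots> = (\<integral>\<^sup>+u. \<integral>\<^sup>+y. \<psi> (norm y) * (G (u *\<^sub>R y) * ennreal (u ^ (?N - 1)) * indicator {0<..} u) \<partial>?\<mu> \<partial>lborel)"
  proof (rule nn_integral_cong)
    fix u :: real
    show "(\<integral>\<^sup>+y. G y * (\<psi> (norm y / u) * ennreal (1 / u) * indicator {0<..} u) \<partial>?\<mu>)
       = (\<integral>\<^sup>+y. \<psi> (norm y) * (G (u *\<^sub>R y) * ennreal (u ^ (?N - 1)) * indicator {0<..} u) \<partial>?\<mu>)"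
    proof (cases "u > 0")
      case True
      have "(\<integral>\<^sup>+y. G (u *\<^sub>R y) * \<psi> (norm y) \<partial>?\<mu>) = ennreal ((1 / u) ^ ?N) * (\<integral>\<^sup>+y. G y * \<psi> (norm y / u) \<partial>?\<mu>)"
        using True nn_integral_lborel_subspace_scale[OF E True, of "\<lambda>y. G y * \<psi> (norm y / u)"] by simp
      then have "(\<integral>\<^sup>+y. G (u *\<^sub>R y) * \<psi> (norm y) \<partial>?\<mu>) * ennreal (u ^ (?N - 1))
          = (\<integral>\<^sup>+y. G y * \<psi> (norm y / u) \<partial>?\<mu>) * (ennreal ((1 / u) ^ ?N) * ennreal (u ^ (?N - 1)))"
        by (simp add: mult_ac)
      also have "ennreal ((1 / u) ^ ?N) * ennreal (u ^ (?N - 1)) = ennreal (1 / u)"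
      proof -
        obtain m where "?N = Suc m" using N by (cases ?N) auto
        then show ?thesis using True by (simp add: ennreal_mult[symmetric] field_simps power_divide)
      qed
      also have "(\<integral>\<^sup>+y. G y * \<psi> (norm y / u) \<partial>?\<mu>) * ennreal (1 / u)
          = (\<integral>\<^sup>+y. G y * (\<psi> (norm y / u) * ennreal (1 / u) * indicator {0<..} u) \<partial>?\<mu>)"
        using True by (subst nn_integral_multc[symmetric]) (auto simp: mult_ac)
      also have "(\<integral>\<^sup>+y. G (u *\<^sub>R y) * \<psi> (norm y) \<partial>?\<mu>) * ennreal (u ^ (?N - 1))
          = (\<integral>\<^sup>+y. \<psi> (norm y) * (G (u *\<^sub>R y) * ennreal (u ^ (?N - 1)) * indicator {0<..} u) \<partial>?\<mu>)"
        using True by (subst nn_integral_multc[symmetric]) (auto simp: mult_ac)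
      finally show ?thesis ..
    qed simp
  qed
  also have "\<dots> = (\<integral>\<^sup>+y. \<integral>\<^sup>+u. \<psi> (norm y) * (G (u *\<^sub>R y) * ennreal (u ^ (?N - 1)) * indicator {0<..} u) \<partial>lborel \<partial>?\<mu>)"
    by (rule Fubini'[symmetric]) measurable
  also have "\<dots> = (\<integral>\<^sup>+y. indicator (cball 0 1) y * (ennreal (real (dim E)) *
         (\<integral>\<^sup>+v. G ((v / norm y) *\<^sub>R y) * ennreal (v ^ (dim E - 1)) * indicator {0<..} v \<partial>lborel)) \<partial>?\<mu>)"
  proof (rule nn_integral_cong_AE, use AE_lborel_subspace_neq_0[OF E N] in eventually_elim)
    fix y :: 'a assume "y \<noteq> 0"
    then have y: "norm y > 0" by simp
    have "(\<integral>\<^sup>+v. G ((v / norm y) *\<^sub>R y) * ennreal (v ^ (?N - 1)) * indicator {0<..} v \<partial>lborel)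
      = ennreal (norm y) * (\<integral>\<^sup>+u. G (u *\<^sub>R y) * ennreal ((norm y * u) ^ (?N - 1)) * indicator {0<..} u \<partial>lborel)"
      using y by (subst nn_integral_real_affine[where c = "norm y" and t = 0])
        (auto intro!: arg_cong[where f="(*) (ennreal (norm y))"] nn_integral_cong simp: indicator_def zero_less_mult_iff)
    also have "\<dots> = ennreal (norm y) * (\<integral>\<^sup>+u. ennreal (norm y ^ (?N - 1)) * (G (u *\<^sub>R y) * ennreal (u ^ (?N - 1)) * indicator {0<..} u) \<partial>lborel)"
      by (intro arg_cong[where f="(*) (ennreal (norm y))"] nn_integral_cong)
         (auto simp: indicator_def power_mult_distrib ennreal_mult mult_ac)
    also have "\<dots> = ennreal (norm y ^ ?N) * (\<integral>\<^sup>+u. G (u *\<^sub>R y) * ennreal (u ^ (?N - 1)) * indicator {0<..} u \<partial>lborel)"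
    proof -
      obtain m where "?N = Suc m" using N by (cases ?N) auto
      then show ?thesis by (subst nn_integral_cmult) (auto simp: mult.assoc[symmetric] ennreal_mult[symmetric])
    qed
    finally have "ennreal (real ?N) * (\<integral>\<^sup>+v. G ((v / norm y) *\<^sub>R y) * ennreal (v ^ (?N - 1)) * indicator {0<..} v \<partial>lborel)
      = ennreal (real ?N * norm y ^ ?N) * (\<integral>\<^sup>+u. G (u *\<^sub>R y) * ennreal (u ^ (?N - 1)) * indicator {0<..} u \<partial>lborel)"
      by (simp add: ennreal_mult mult.assoc)
    then show "(\<integral>\<^sup>+u. \<psi> (norm y) * (G (u *\<^sub>R y) * ennreal (u ^ (?N - 1)) * indicator {0<..} u) \<partial>lborel)
      = indicator (cball 0 1) y * (ennreal (real ?N) *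
         (\<integral>\<^sup>+v. G ((v / norm y) *\<^sub>R y) * ennreal (v ^ (?N - 1)) * indicator {0<..} v \<partial>lborel))"
      by (subst nn_integral_cmult) (auto simp: \<psi>_def indicator_def)
  qed
  finally show ?thesis .
qed

lemma nn_integral_power_segment:
  assumes "R \<ge> 0" "p \<ge> 1"
  shows "(\<integral>\<^sup>+v. ennreal (v ^ (p - 1)) * indicator {0<..R} v \<partial>lborel) = ennreal (R ^ p / real p)"
proof -
  obtain q where q: "p = Suc q" using assms(2) by (cases p) auto
  have "(\<integral>\<^sup>+v. ennreal (v ^ (p - 1)) * indicator {0<..R} v \<partial>lborel)
      = (\<integral>\<^sup>+v. ennreal (v ^ (p - 1)) * indicator {0..R} v \<partial>lborel)"
    by (intro nn_integral_cong_AE, use AE_lborel_singleton[of 0] in eventually_elim) (auto simp: indicator_def)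
  also have "\<dots> = ennreal (R ^ p / real p - 0 ^ p / real p)"
  proof (rule nn_integral_FTC_Icc[where F = "\<lambda>v. v ^ p / real p"])
    fix v :: real
    have "((\<lambda>v. v ^ p / real p) has_real_derivative (real p * v ^ (p - 1)) / real p) (at v)"
      using DERIV_pow[of p v UNIV] by (intro DERIV_cdivide) simp
    moreover have "real p * v ^ (p - 1) / real p = v ^ (p - 1)"
      using q by simp
    ultimately show "((\<lambda>v. v ^ p / real p) has_real_derivative v ^ (p - 1)) (at v)"
      by simp
  qed (use assms q in auto)
  finally show ?thesis using q by simp
qed

text \<open>The mass of the unit ball of an \<open>N\<close>-dimensional subspace, read off from the Gaussian integral
  in polar coordinates; the formula shows that it does not depend on the subspace.\<close>

definition unit_ball_mass :: "nat \<Rightarrow> ennreal" where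
  "unit_ball_mass N = gauss_mass ^ N /
     (ennreal (real N) * (\<integral>\<^sup>+v. ennreal (exp (- v\<^sup>2 / 2)) * ennreal (v ^ (N - 1)) * indicator {0<..} v \<partial>lborel))"

lemma nn_integral_radial_aux:
  fixes E :: "'a::euclidean_space set"
  assumes E: "subspace E" and N: "dim E \<ge> 1" and [measurable]: "g \<in> borel_measurable borel"
  shows "(\<integral>\<^sup>+y. g (norm y) \<partial>lborel_subspace E) = emeasure (lborel_subspace E) (cball 0 1) * (ennreal (real (dim E)) *
         (\<integral>\<^sup>+v. g v * ennreal (v ^ (dim E - 1)) * indicator {0<..} v \<partial>lborel))"
proof -
  have "(\<integral>\<^sup>+y. g (norm y) \<partial>lborel_subspace E) = (\<integral>\<^sup>+y. indicator (cball 0 1) y * (ennreal (real (dim E)) *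
         (\<integral>\<^sup>+v. g v * ennreal (v ^ (dim E - 1)) * indicator {0<..} v \<partial>lborel)) \<partial>lborel_subspace E)"
  proof (subst nn_integral_polar[OF E N], measurable,
      rule nn_integral_cong_AE, use AE_lborel_subspace_neq_0[OF E N] in eventually_elim)
    fix y :: 'a assume y: "y \<noteq> 0"
    have "(\<integral>\<^sup>+v. g (norm ((v / norm y) *\<^sub>R y)) * ennreal (v ^ (dim E - 1)) * indicator {0<..} v \<partial>lborel)
        = (\<integral>\<^sup>+v. g v * ennreal (v ^ (dim E - 1)) * indicator {0<..} v \<partial>lborel)"
      using y by (intro nn_integral_cong) (auto split: split_indicator)
    then show "indicator (cball 0 1) y * (ennreal (real (dim E)) *
        (\<integral>\<^sup>+v. g (norm ((v / norm y) *\<^sub>R y)) * ennreal (v ^ (dim E - 1)) * indicator {0<..} v \<partial>lborel))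
      = indicator (cball 0 1) y * (ennreal (real (dim E)) *
        (\<integral>\<^sup>+v. g v * ennreal (v ^ (dim E - 1)) * indicator {0<..} v \<partial>lborel))"
      by simp
  qed
  also have "\<dots> = (\<integral>\<^sup>+y. indicator (cball 0 1) y \<partial>lborel_subspace E) * (ennreal (real (dim E)) *
         (\<integral>\<^sup>+v. g v * ennreal (v ^ (dim E - 1)) * indicator {0<..} v \<partial>lborel))"
    by (rule nn_integral_multc) (simp add: borel_measurable_indicator)
  finally show ?thesis by simp
qed

lemma emeasure_unit_ball:
  fixes E :: "'a::euclidean_space set"
  assumes E: "subspace E" and N: "dim E \<ge> 1"
  shows "emeasure (lborel_subspace E) (cball 0 1) = unit_ball_mass (dim E)"
    and "unit_ball_mass (dim E) > 0" "unit_ball_mass (dim E) < \<infinity>"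
proof -
  define I where "I = ennreal (real (dim E)) * (\<integral>\<^sup>+v. ennreal (exp (- v\<^sup>2 / 2)) * ennreal (v ^ (dim E - 1)) * indicator {0<..} v \<partial>lborel)"
  define m where "m = emeasure (lborel_subspace E) (cball 0 1)"
  have eq: "gauss_mass ^ dim E = m * I"
    unfolding m_def I_def
    using nn_integral_radial_aux[OF E N, of "\<lambda>v. ennreal (exp (- v\<^sup>2 / 2))"] gauss_lborel_subspace[OF E] by simp
  have g: "gauss_mass ^ dim E > 0" "gauss_mass ^ dim E < \<infinity>"
    using gauss_mass_finite_pos by (auto simp: power_less_top_ennreal zero_less_iff_neq_zero)
  have mI: "m \<noteq> 0" "I \<noteq> 0" "m \<noteq> \<infinity>" "I \<noteq> \<infinity>"
    using g unfolding eq by (auto simp: ennreal_mult_less_top)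
  have "unit_ball_mass (dim E) = m"
    unfolding unit_ball_mass_def eq I_def[symmetric]
    using mI by (simp add: ennreal_mult_divide_eq)
  then show "emeasure (lborel_subspace E) (cball 0 1) = unit_ball_mass (dim E)" "unit_ball_mass (dim E) > 0" "unit_ball_mass (dim E) < \<infinity>"
    using mI by (auto simp: m_def zero_less_iff_neq_zero top.not_eq_extremum)
qed

lemma nn_integral_radial:
  fixes E :: "'a::euclidean_space set"
  assumes E: "subspace E" and N: "dim E \<ge> 1" and "g \<in> borel_measurable borel"
  shows "(\<integral>\<^sup>+y. g (norm y) \<partial>lborel_subspace E) = unit_ball_mass (dim E) * (ennreal (real (dim E)) *
         (\<integral>\<^sup>+v. g v * ennreal (v ^ (dim E - 1)) * indicator {0<..} v \<partial>lborel))"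
  using nn_integral_radial_aux[OF assms] emeasure_unit_ball[OF E N] by simp

text \<open>On the ray through \<open>y\<close> the set \<open>L\<close> is the segment up to \<open>R\<close>, and \<open>\<integral>\<^sub>0\<^sup>R v\<^sup>N\<^sup>-\<^sup>1\<^sup>-\<^sup>l dv = R\<^sup>N\<^sup>-\<^sup>l / (N - l)\<close>. The case
  \<open>l = 0\<close> computes the volumes of radial sums.\<close>

lemma nn_integral_star:
  fixes E :: "'a::euclidean_space set" and R :: "'a \<Rightarrow> real"
  assumes E: "subspace E" and l: "l < dim E" and [measurable]: "L \<in> sets borel"
    and [measurable]: "R \<in> borel_measurable borel" and R: "\<And>x. R x \<ge> 0"
    and L: "\<And>y. y \<in> E \<Longrightarrow> y \<noteq> 0 \<Longrightarrow> y \<in> L \<longleftrightarrow> norm y \<le> R (dir y)"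
  shows "(\<integral>\<^sup>+y. indicator L y * ennreal (1 / norm y ^ l) \<partial>lborel_subspace E)
    = ennreal (real (dim E) / real (dim E - l)) * (\<integral>\<^sup>+y. indicator (cball 0 1) y * ennreal (R (dir y) ^ (dim E - l)) \<partial>lborel_subspace E)"
proof -
  let ?N = "dim E"
  have N: "?N \<ge> 1" using l by simp
  have "(\<integral>\<^sup>+y. indicator L y * ennreal (1 / norm y ^ l) \<partial>lborel_subspace E) =
     (\<integral>\<^sup>+y. ennreal (real ?N / real (?N - l)) * (indicator (cball 0 1) y * ennreal (R (dir y) ^ (?N - l))) \<partial>lborel_subspace E)"
  proof (subst nn_integral_polar[OF E N], measurable, rule nn_integral_cong_AE, use AE_lborel_subspace_neq_0[OF E N] AE_lborel_subspace[OF E] in eventually_elim)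
    fix y :: 'a assume y: "y \<noteq> 0" "y \<in> E"
    have "(\<integral>\<^sup>+v. indicator L ((v / norm y) *\<^sub>R y) * ennreal (1 / norm ((v / norm y) *\<^sub>R y) ^ l) * ennreal (v ^ (?N - 1)) * indicator {0<..} v \<partial>lborel)
      = (\<integral>\<^sup>+v. ennreal (v ^ (?N - l - 1)) * indicator {0<..R (dir y)} v \<partial>lborel)"
    proof (rule nn_integral_cong)
      fix v :: real
      show "indicator L ((v / norm y) *\<^sub>R y) * ennreal (1 / norm ((v / norm y) *\<^sub>R y) ^ l) * ennreal (v ^ (?N - 1)) * indicator {0<..} v
        = ennreal (v ^ (?N - l - 1)) * indicator {0<..R (dir y)} v"
      proof (cases "v > 0")
        case True
        have "(v / norm y) *\<^sub>R y \<in> L \<longleftrightarrow> v \<le> R (dir y)"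
        proof -
          have "norm ((v / norm y) *\<^sub>R y) = v" "((v / norm y) *\<^sub>R y) /\<^sub>R v = dir y"
            using y True by (simp_all add: field_simps)
          then show ?thesis
            using L[of "(v / norm y) *\<^sub>R y"] y True subspace_scale[OF E y(2)] by simp
        qed
        moreover have "1 / v ^ l * v ^ (?N - 1) = v ^ (?N - l - 1)"
          using True l by (simp add: power_diff field_simps flip: power_add)
        ultimately show ?thesis
          using True y by (auto simp: indicator_def ennreal_mult[symmetric])
      qed simp
    qed
    also have "\<dots> = ennreal (R (dir y) ^ (?N - l) / real (?N - l))"
      using R l by (intro nn_integral_power_segment) auto
    finally show "indicator (cball 0 1) y * (ennreal (real ?N) *
        (\<integral>\<^sup>+v. indicator L ((v / norm y) *\<^sub>R y) * ennreal (1 / norm ((v / norm y) *\<^sub>R y) ^ l) * ennreal (v ^ (?N - 1)) * indicator {0<..} v \<partial>lborel))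
      = ennreal (real ?N / real (?N - l)) * (indicator (cball 0 1) y * ennreal (R (dir y) ^ (?N - l)))"
      using R by (auto simp: indicator_def ennreal_mult[symmetric])
  qed
  also have "\<dots> = ennreal (real ?N / real (?N - l)) * (\<integral>\<^sup>+y. indicator (cball 0 1) y * ennreal (R (dir y) ^ (?N - l)) \<partial>lborel_subspace E)"
  proof (rule nn_integral_cmult)
    have [measurable]: "cball (0::'a) 1 \<in> sets borel" by simp
    show "(\<lambda>y. indicator (cball 0 1) y * ennreal (R (dir y) ^ (?N - l))) \<in> borel_measurable (lborel_subspace E)"
      unfolding measurable_lborel_subspace by measurable
  qed
  finally show ?thesis .
qed

section \<open>Dual quermassintegrals of hyperplane sections\<close>

lemma radial_function_props:
  fixes L :: "'a::euclidean_space set"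
  assumes L: "compact L" "convex L" "0 \<in> L" and e: "e > 0" "e *\<^sub>R x \<in> L" and x: "norm x = 1"
  shows "0 < radial_function L x" and "a > 0 \<Longrightarrow> a *\<^sub>R x \<in> L \<longleftrightarrow> a \<le> radial_function L x"
proof -
  define S where "S = {a. e \<le> a \<and> a *\<^sub>R x \<in> L}"
  obtain M where M: "\<And>y. y \<in> L \<Longrightarrow> norm y \<le> M"
    using compact_imp_bounded[OF L(1)] by (auto simp: bounded_iff)
  have "S = {e..M} \<inter> (\<lambda>a. a *\<^sub>R x) -` L"
    using M x e by (force simp: S_def)
  moreover have "closed ((\<lambda>a. a *\<^sub>R x) -` L)"
    using compact_imp_closed[OF L(1)] by (intro closed_vimage continuous_intros) auto
  ultimately have "compact S" by (simp add: compact_Int_closed)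
  moreover have "e \<in> S" using e by (simp add: S_def)
  ultimately obtain m where m: "m \<in> S" "\<And>a. a \<in> S \<Longrightarrow> a \<le> m"
    using compact_attains_sup[of S] by auto
  have "radial_function L x = m"
    unfolding radial_function_def
  proof (rule Greatest_equality)
    show "0 < m \<and> m *\<^sub>R x \<in> L" using m(1) e by (auto simp: S_def)
    show "a \<le> m" if "0 < a \<and> a *\<^sub>R x \<in> L" for a
      using m(2)[of a] m(1) that by (force simp: S_def)
  qed
  then show pos: "0 < radial_function L x" using m(1) e by (auto simp: S_def)
  show "a *\<^sub>R x \<in> L \<longleftrightarrow> a \<le> radial_function L x" if a: "a > 0"
  proof
    assume "a *\<^sub>R x \<in> L"
    then show "a \<le> radial_function L x"
      unfolding \<open>radial_function L x = m\<close> using m(2)[of a] m(1) by (force simp: S_def)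
  next
    assume le: "a \<le> radial_function L x"
    have "(1 - a / m) *\<^sub>R 0 + (a / m) *\<^sub>R (m *\<^sub>R x) \<in> L"
      using L(2,3) m(1) le pos a unfolding \<open>radial_function L x = m\<close>
      by (intro convexD) (auto simp: S_def)
    then show "a *\<^sub>R x \<in> L" using pos \<open>radial_function L x = m\<close> by simp
  qed
qed

text \<open>A non-empty relatively open subset of \<open>E\<close> has affine hull \<open>E\<close>, so the relative interior of \<open>L\<close> is
  taken with respect to \<open>E\<close>.\<close>

lemma rel_interior_0_ball:
  fixes L :: "'a::euclidean_space set"
  assumes E: "subspace E" and L: "convex_body_in E L" "0 \<in> rel_interior L"
  obtains e where "e > 0" "cball 0 e \<inter> E \<subseteq> L"
proof -
  let ?I = "(top_of_set E) interior_of L"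
  have "openin (top_of_set (affine hull E)) ?I"
    using openin_interior_of[of "top_of_set E" L] subspace_imp_affine[OF E] by (simp add: affine_hull_eq[THEN iffD2])
  then have "affine hull ?I = affine hull E"
    using L(1) by (intro affine_hull_openin) (auto simp: convex_body_in_def)
  moreover have "?I \<subseteq> L" by (rule interior_of_subset)
  ultimately have "E \<subseteq> affine hull L"
    using subspace_imp_affine[OF E] by (metis hull_mono affine_hull_eq)
  with L(2) show ?thesis
    unfolding mem_rel_interior_cball using that by blast
qed

text \<open>In polar coordinates \<open>vol (L + s B) = \<integral> (\<rho> + s)\<^sup>N\<close> over the unit ball, \<open>\<rho>\<close> the radial function,
  and the binomial theorem identifies the coefficients.\<close>

lemma dual_quermassintegral_eq:
  fixes E :: "'a::euclidean_space set"
  assumes E: "subspace E" and l: "l < dim E" and L: "compact L" "convex L" "L \<subseteq> E"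
  shows "dual_quermassintegral E l L = (real (dim E) - real l) / real (dim E) *
     enn2real (\<integral>\<^sup>+y. indicator L y * ennreal (1 / norm y ^ l) \<partial>lborel_subspace E)"
proof (cases "convex_body_in E L \<and> 0 \<in> rel_interior L")
  case False
  have [measurable]: "L \<in> sets borel" using L by (simp add: borel_compact)
  have "(LINT x:L|lborel_subspace E. 1 / norm x ^ l)
      = enn2real (\<integral>\<^sup>+y. ennreal (indicator L y *\<^sub>R (1 / norm y ^ l)) \<partial>lborel_subspace E)"
    unfolding set_lebesgue_integral_def by (rule integral_eq_nn_integral) auto
  also have "\<dots> = enn2real (\<integral>\<^sup>+y. indicator L y * ennreal (1 / norm y ^ l) \<partial>lborel_subspace E)"
    by (intro arg_cong[where f = enn2real] nn_integral_cong) (auto simp: indicator_def)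
  finally show ?thesis
    unfolding dual_quermassintegral_def by (subst if_not_P[OF False]) simp
next
  case True
  let ?N = "dim E" and ?\<mu> = "lborel_subspace E" and ?B = "cball (0::'a) 1"
  have N: "?N \<ge> 1" using l by simp
  have [measurable]: "L \<in> sets borel" "?B \<in> sets borel" "E \<in> sets borel"
    using L closed_subspace[OF E] by (simp_all add: borel_compact)
  obtain e where e: "e > 0" "cball 0 e \<inter> E \<subseteq> L"
    using rel_interior_0_ball[OF E] True by blast
  have "0 \<in> L" using True rel_interior_subset by blast
  have rad: "0 < radial_function L x" "a > 0 \<Longrightarrow> a *\<^sub>R x \<in> L \<longleftrightarrow> a \<le> radial_function L x"
    if "x \<in> E" "norm x = 1" for x a
  proof -
    have "e *\<^sub>R x \<in> L"
      using that e(1) subspace_scale[OF E that(1), of e] by (intro subsetD[OF e(2)]) auto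
    from radial_function_props[OF L(1,2) \<open>0 \<in> L\<close> e(1) this that(2)]
    show "0 < radial_function L x" "a > 0 \<Longrightarrow> a *\<^sub>R x \<in> L \<longleftrightarrow> a \<le> radial_function L x" by auto
  qed
  define R where "R = (\<lambda>x. if x \<in> E \<and> norm x = 1 then radial_function L x else 0)"
  have R0: "R x \<ge> 0" for x using rad(1)[of x] by (auto simp: R_def)
  obtain M where M: "\<And>y. y \<in> L \<Longrightarrow> norm y \<le> M" "M > 0"
    using compact_imp_bounded[OF L(1)] by (auto simp: bounded_pos)
  have RM: "R x \<le> M" for x
    using rad(1)[of x] rad(2)[of x "R x"] M(1)[of "R x *\<^sub>R x"] M(2) by (auto simp: R_def)
  have [measurable]: "R \<in> borel_measurable borel"
    unfolding borel_measurable_iff_ge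
  proof
    fix a :: real
    show "{w \<in> space borel. a \<le> R w} \<in> sets borel"
    proof (cases "a > 0")
      case True
      then have "{w \<in> space borel. a \<le> R w} = E \<inter> sphere 0 1 \<inter> (\<lambda>w. a *\<^sub>R w) -` L"
        using rad(2)[of _ a] by (auto simp: R_def)
      moreover have "closed (E \<inter> sphere 0 1 \<inter> (\<lambda>w. a *\<^sub>R w) -` L)"
        using compact_imp_closed[OF L(1)] closed_subspace[OF E]
        by (intro closed_Int closed_vimage closed_sphere continuous_intros) auto
      ultimately show ?thesis by simp
    next
      case False
      then have "{w \<in> space borel. a \<le> R w} = UNIV" using R0 by (auto intro: order_trans[of a 0])
      then show ?thesis by simp
    qed
  qed
  have unit: "dir y \<in> E" "norm (dir y) = 1" if "y \<in> E" "y \<noteq> 0" for y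
    using that subspace_scale[OF E] by auto
  define m where "m = (\<lambda>j. LINT y|?\<mu>. indicator ?B y * R (dir y) ^ (?N - j))"
  have intg: "integrable ?\<mu> (\<lambda>y. indicator ?B y * R (dir y) ^ k)" for k
  proof (rule integrableI_bounded_set[where A = ?B and B = "M ^ k"])
    show "emeasure ?\<mu> ?B < \<infinity>" using emeasure_unit_ball[OF E N] by simp
    show "AE x in ?\<mu>. x \<in> ?B \<longrightarrow> norm (indicator ?B x * R (dir x) ^ k) \<le> M ^ k"
      using R0 RM by (auto intro!: power_mono)
  qed auto
  have nn: "(\<integral>\<^sup>+y. indicator ?B y * ennreal (R (dir y) ^ (?N - j)) \<partial>?\<mu>) = ennreal (m j)" for j
    unfolding m_def
    by (subst nn_integral_eq_integral[symmetric, OF intg])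
       (auto simp: R0 indicator_def intro!: nn_integral_cong)
  have vol: "measure ?\<mu> (radial_sum_ball E L s) = (\<Sum>j\<le>?N. real (?N choose j) * m j * s ^ j)" if s: "s \<ge> 0" for s
  proof -
    let ?S = "radial_sum_ball E L s"
    have "?S = {0} \<union> {x. x \<in> E \<and> x \<noteq> 0 \<and> norm x \<le> R (dir x) + s}"
      using unit by (auto simp: radial_sum_ball_def R_def)
    moreover have "{x. x \<in> E \<and> x \<noteq> 0 \<and> norm x \<le> R (dir x) + s} \<in> sets borel"
      by measurable
    ultimately have [measurable]: "?S \<in> sets borel" by simp
    have "emeasure ?\<mu> ?S = (\<integral>\<^sup>+y. indicator ?S y * ennreal (1 / norm y ^ 0) \<partial>?\<mu>)" by simp
    also have "\<dots> = ennreal (real ?N / real (?N - 0)) * (\<integral>\<^sup>+y. indicator ?B y * ennreal ((R (dir y) + s) ^ (?N - 0)) \<partial>?\<mu>)"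
    proof (rule nn_integral_star[OF E])
      show "y \<in> ?S \<longleftrightarrow> norm y \<le> R (dir y) + s" if "y \<in> E" "y \<noteq> 0" for y
        using that unit[OF that] by (auto simp: radial_sum_ball_def R_def)
    qed (use N R0 s in auto)
    also have "\<dots> = (\<integral>\<^sup>+y. ennreal (\<Sum>j\<le>?N. real (?N choose j) * s ^ j * (indicator ?B y * R (dir y) ^ (?N - j))) \<partial>?\<mu>)"
    proof -
      have "indicator ?B y * ennreal ((R (dir y) + s) ^ ?N)
         = ennreal (\<Sum>j\<le>?N. real (?N choose j) * s ^ j * (indicator ?B y * R (dir y) ^ (?N - j)))" for y
        by (subst add.commute, subst binomial_ring) (auto simp: indicator_def)
      then show ?thesis using N by (simp del: dim_eq_0)
    qed
    also have "\<dots> = ennreal (\<Sum>j\<le>?N. real (?N choose j) * m j * s ^ j)"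
    proof (subst nn_integral_eq_integral)
      have intg': "integrable ?\<mu> (\<lambda>y. real (?N choose j) * s ^ j * (indicator ?B y * R (dir y) ^ (?N - j)))" for j
        by (intro integrable_mult_right intg)
      then show "integrable ?\<mu> (\<lambda>y. \<Sum>j\<le>?N. real (?N choose j) * s ^ j * (indicator ?B y * R (dir y) ^ (?N - j)))"
        by (rule Bochner_Integration.integrable_sum)
      show "ennreal (LINT y|?\<mu>. (\<Sum>j\<le>?N. real (?N choose j) * s ^ j * (indicator ?B y * R (dir y) ^ (?N - j))))
          = ennreal (\<Sum>j\<le>?N. real (?N choose j) * m j * s ^ j)"
        by (subst Bochner_Integration.integral_sum[OF intg']) (simp only: integral_mult_right_zero, simp only: m_def mult_ac)
    qed (auto intro!: sum_nonneg simp: R0 s)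
    finally show ?thesis
      using s by (simp add: measure_def m_def R0 sum_nonneg Bochner_Integration.integral_nonneg)
  qed
  have uniq: "W l = m l" if W: "\<forall>s\<ge>0. measure ?\<mu> (radial_sum_ball E L s) = (\<Sum>j\<le>?N. real (?N choose j) * W j * s ^ j)" for W
  proof (rule ccontr)
    assume "W l \<noteq> m l"
    define c where "c = (\<lambda>j. real (?N choose j) * (W j - m j))"
    have "c l \<noteq> 0" using l \<open>W l \<noteq> m l\<close> by (simp add: c_def)
    then have "finite {z. (\<Sum>j\<le>?N. c j * z ^ j) = 0}"
      using l unfolding polyfun_finite_roots by (intro exI[of _ l]) auto
    moreover have "{0::real..} \<subseteq> {z. (\<Sum>j\<le>?N. c j * z ^ j) = 0}"
    proof
      fix s :: real assume "s \<in> {0..}"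
      then have "(\<Sum>j\<le>?N. real (?N choose j) * W j * s ^ j) = (\<Sum>j\<le>?N. real (?N choose j) * m j * s ^ j)"
        using W vol by simp
      then show "s \<in> {z. (\<Sum>j\<le>?N. c j * z ^ j) = 0}"
        by (simp add: c_def algebra_simps sum_subtractf)
    qed
    ultimately show False using infinite_Ici finite_subset by blast
  qed
  have "dual_quermassintegral E l L = m l"
    unfolding dual_quermassintegral_def using True vol uniq by (auto intro!: the_equality)
  moreover have "(\<integral>\<^sup>+y. indicator L y * ennreal (1 / norm y ^ l) \<partial>?\<mu>)
      = ennreal (real ?N / real (?N - l)) * ennreal (m l)"
  proof (subst nn[symmetric], rule nn_integral_star[OF E l])
    show "y \<in> L \<longleftrightarrow> norm y \<le> R (dir y)" if "y \<in> E" "y \<noteq> 0" for y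
      using rad(2)[OF unit[OF that], of "norm y"] unit[OF that] that by (simp add: R_def)
  qed (use R0 in auto)
  moreover have "m l \<ge> 0" unfolding m_def by (auto intro!: Bochner_Integration.integral_nonneg simp: R0)
  ultimately show ?thesis
    using l by (simp add: ennreal_mult[symmetric] of_nat_diff del: dim_eq_0)
qed

text \<open>Up to a factor, the dual quermassintegral of the section at height \<open>t\<close> over \<open>u\<^sup>\<bottom>\<close>, see
  \<open>dual_quermassintegral_section\<close> below.\<close>

definition section_moment :: "'a::euclidean_space set \<Rightarrow> nat \<Rightarrow> 'a \<Rightarrow> real \<Rightarrow> ennreal" where
  "section_moment K l u t = (\<integral>\<^sup>+y. indicator K (y + t *\<^sub>R u) * ennreal (1 / norm y ^ l) \<partial>lborel_subspace (perp u))"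

lemma norm_add_perp:
  fixes y u :: "'a::euclidean_space"
  assumes "norm u = 1" "y \<in> perp u"
  shows "(norm (y + t *\<^sub>R u))\<^sup>2 = (norm y)\<^sup>2 + t\<^sup>2"
proof -
  have "u \<bullet> u = 1" using assms by (simp add: dot_square_norm)
  then show ?thesis using assms
    unfolding power2_norm_eq_inner
    by (simp add: perp_def inner_add_left inner_add_right inner_commute power2_eq_square)
qed

lemma section_moment_ball:
  fixes u :: "'a::euclidean_space"
  assumes u: "norm u = 1" and l: "l + 2 \<le> DIM('a)" and t: "\<bar>t\<bar> \<le> r"
  shows "section_moment (cball 0 r) l u t =
    unit_ball_mass (DIM('a) - 1) * ennreal (real (DIM('a) - 1) / real (DIM('a) - 1 - l) * sqrt (r\<^sup>2 - t\<^sup>2) ^ (DIM('a) - 1 - l))"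
proof -
  let ?N = "DIM('a) - 1" and ?s = "sqrt (r\<^sup>2 - t\<^sup>2)"
  have tr: "t\<^sup>2 \<le> r\<^sup>2" using t by (metis abs_ge_zero abs_le_square_iff abs_of_nonneg order_trans)
  have N: "dim (perp u) = ?N" by (rule dim_perp[OF u])
  have "section_moment (cball 0 r) l u t = (\<integral>\<^sup>+y. indicator {..?s} (norm y) * ennreal (1 / norm y ^ l) \<partial>lborel_subspace (perp u))"
    unfolding section_moment_def
  proof (rule nn_integral_cong_AE, use AE_lborel_subspace[OF perp_subspace] in eventually_elim)
    fix y assume y: "y \<in> perp u"
    have "norm (y + t *\<^sub>R u) \<le> r \<longleftrightarrow> (norm (y + t *\<^sub>R u))\<^sup>2 \<le> r\<^sup>2"
      using t by (metis abs_ge_zero abs_le_square_iff abs_norm_cancel abs_of_nonneg order_trans)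
    also have "\<dots> \<longleftrightarrow> norm y \<le> ?s"
      unfolding norm_add_perp[OF u y] using real_sqrt_le_iff[of "(norm y)\<^sup>2" "r\<^sup>2 - t\<^sup>2"] by (auto simp: field_simps)
    finally show "indicator (cball 0 r) (y + t *\<^sub>R u) * ennreal (1 / norm y ^ l)
        = indicator {..?s} (norm y) * ennreal (1 / norm y ^ l)"
      by (simp add: indicator_def)
  qed
  also have "\<dots> = unit_ball_mass ?N * (ennreal (real ?N) *
      (\<integral>\<^sup>+v. (indicator {..?s} v * ennreal (1 / v ^ l)) * ennreal (v ^ (?N - 1)) * indicator {0<..} v \<partial>lborel))"
    using l N nn_integral_radial[OF perp_subspace, of u "\<lambda>v. indicator {..?s} v * ennreal (1 / v ^ l)"] by simp
  also have "(\<integral>\<^sup>+v. (indicator {..?s} v * ennreal (1 / v ^ l)) * ennreal (v ^ (?N - 1)) * indicator {0<..} v \<partial>lborel)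
      = (\<integral>\<^sup>+v. ennreal (v ^ (?N - l - 1)) * indicator {0<..?s} v \<partial>lborel)"
  proof (rule nn_integral_cong)
    fix v :: real
    have "1 / v ^ l * v ^ (?N - 1) = v ^ (?N - l - 1)" if "v > 0"
      using that l by (simp add: power_diff field_simps flip: power_add)
    then show "(indicator {..?s} v * ennreal (1 / v ^ l)) * ennreal (v ^ (?N - 1)) * indicator {0<..} v
        = ennreal (v ^ (?N - l - 1)) * indicator {0<..?s} v"
      by (auto simp: indicator_def ennreal_mult[symmetric])
  qed
  also have "\<dots> = ennreal (?s ^ (?N - l) / real (?N - l))"
    using l tr by (intro nn_integral_power_segment) auto
  finally show ?thesis using tr by (simp add: ennreal_mult[symmetric])
qed

lemma section_moment_finite:
  fixes K :: "'a::euclidean_space set"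
  assumes u: "norm u = 1" and l: "l + 2 \<le> DIM('a)" and K: "bounded K"
  shows "section_moment K l u t < \<infinity>"
proof -
  obtain M where M: "\<And>y. y \<in> K \<Longrightarrow> norm y \<le> M" using K by (auto simp: bounded_iff)
  define r where "r = max M \<bar>t\<bar>"
  have "section_moment K l u t \<le> section_moment (cball 0 r) l u t"
    unfolding section_moment_def using M
    by (intro nn_integral_mono mult_right_mono) (force simp: indicator_def r_def)+
  also have "\<dots> < \<infinity>"
    using emeasure_unit_ball(3)[OF perp_subspace[of u]] l
    by (subst section_moment_ball[OF u l]) (auto simp: r_def dim_perp[OF u] ennreal_mult_less_top)
  finally show ?thesis .
qed

lemma dual_quermassintegral_section:
  fixes K :: "'a::euclidean_space set"
  assumes u: "norm u = 1" and l: "l + 2 \<le> DIM('a)" and K: "compact K" "convex K"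
  shows "dual_quermassintegral (perp u) l ((\<lambda>x. x - t *\<^sub>R u) ` K \<inter> perp u)
    = (real (DIM('a) - 1) - real l) / real (DIM('a) - 1) * enn2real (section_moment K l u t)"
proof -
  let ?L = "(\<lambda>x. x - t *\<^sub>R u) ` K \<inter> perp u"
  have "compact ((\<lambda>x. x - t *\<^sub>R u) ` K)"
    by (intro compact_continuous_image continuous_intros K)
  then have "compact ?L" using closed_subspace[OF perp_subspace] by (rule compact_Int_closed)
  moreover have "convex ((\<lambda>x. x - t *\<^sub>R u) ` K)"
    using convex_translation[OF K(2), of "- t *\<^sub>R u"] by simp
  then have "convex ?L" using subspace_imp_convex[OF perp_subspace] by (rule convex_Int)
  ultimately have "dual_quermassintegral (perp u) l ?L = (real (DIM('a) - 1) - real l) / real (DIM('a) - 1) *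
     enn2real (\<integral>\<^sup>+y. indicator ?L y * ennreal (1 / norm y ^ l) \<partial>lborel_subspace (perp u))"
    using l dual_quermassintegral_eq[OF perp_subspace, of l u ?L] by (simp add: dim_perp[OF u])
  also have "(\<integral>\<^sup>+y. indicator ?L y * ennreal (1 / norm y ^ l) \<partial>lborel_subspace (perp u)) = section_moment K l u t"
    unfolding section_moment_def
  proof (rule nn_integral_cong_AE, use AE_lborel_subspace[OF perp_subspace] in eventually_elim)
    fix y assume y: "y \<in> perp u"
    then have "y \<in> ?L \<longleftrightarrow> y + t *\<^sub>R u \<in> K"
      by (force simp: image_iff algebra_simps)
    then show "indicator ?L y * ennreal (1 / norm y ^ l) = indicator K (y + t *\<^sub>R u) * ennreal (1 / norm y ^ l)"
      by (simp add: indicator_def)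
  qed
  finally show ?thesis .
qed

lemma section_moment_le_central:
  fixes K :: "'a::euclidean_space set"
  assumes u: "norm u = 1" and l: "l + 2 \<le> DIM('a)" and K: "compact K" "convex K"
    and max: "is_max_over_reals
             (\<lambda>t. dual_quermassintegral (perp u) l ((\<lambda>x. x - t *\<^sub>R u) ` K \<inter> perp u))
             (dual_quermassintegral (perp u) l (K \<inter> perp u))"
  shows "section_moment K l u t \<le> section_moment K l u 0"
proof -
  let ?c = "(real (DIM('a) - 1) - real l) / real (DIM('a) - 1)"
  have c: "?c > 0" using l by auto
  have "K \<inter> perp u = (\<lambda>x. x - 0 *\<^sub>R u) ` K \<inter> perp u" by simp
  then have "?c * enn2real (section_moment K l u t) \<le> ?c * enn2real (section_moment K l u 0)"
    using max unfolding is_max_over_reals_def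
    by (metis dual_quermassintegral_section[OF u l K])
  then have "enn2real (section_moment K l u t) \<le> enn2real (section_moment K l u 0)"
    unfolding mult_le_cancel_left_pos[OF c] .
  moreover have "section_moment K l u s = ennreal (enn2real (section_moment K l u s))" for s
    using section_moment_finite[OF u l compact_imp_bounded[OF K(1)], of s] by simp
  ultimately show ?thesis by (metis ennreal_leI)
qed

text \<open>A convex body contains \<open>q K + (1 - q) r B\<close>, so its slightly shifted sections contain the
  central one shrunk by \<open>q\<close>.\<close>

lemma section_moment_near_central:
  fixes K :: "'a::euclidean_space set"
  assumes u: "norm u = 1" and l: "l + 2 \<le> DIM('a)" and K: "compact K" "convex K" and r: "cball 0 r \<subseteq> K"
    and q: "0 < q" "q < 1" and t: "\<bar>t\<bar> \<le> (1 - q) * r"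
  shows "ennreal (q ^ (DIM('a) - 1 - l)) * section_moment K l u 0 \<le> section_moment K l u t"
proof -
  let ?N = "DIM('a) - 1" and ?\<mu> = "lborel_subspace (perp u)"
  have [measurable]: "K \<in> sets borel" using K by (simp add: borel_compact)
  define H where "H = (\<lambda>y. indicator K (y + t *\<^sub>R u) * ennreal (1 / norm y ^ l))"
  have [measurable]: "H \<in> borel_measurable borel" unfolding H_def by measurable
  have sub: "q *\<^sub>R y + t *\<^sub>R u \<in> K" if "y \<in> K" for y
  proof -
    have "(t / (1 - q)) *\<^sub>R u \<in> K"
      using r t q u by (intro subsetD[OF r]) (auto simp: field_simps)
    then have "q *\<^sub>R y + (1 - q) *\<^sub>R ((t / (1 - q)) *\<^sub>R u) \<in> K"
      using that K q by (intro convexD) auto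
    then show ?thesis using q by simp
  qed
  have "ennreal (1 / q ^ l) * section_moment K l u 0 = (\<integral>\<^sup>+y. ennreal (1 / q ^ l) * (indicator K y * ennreal (1 / norm y ^ l)) \<partial>?\<mu>)"
    by (simp add: section_moment_def nn_integral_cmult)
  also have "\<dots> \<le> (\<integral>\<^sup>+y. H (q *\<^sub>R y) \<partial>?\<mu>)"
    using sub q by (intro nn_integral_mono)
      (auto simp: H_def indicator_def ennreal_mult[symmetric] power_mult_distrib)
  also have "\<dots> = ennreal ((1 / q) ^ ?N) * section_moment K l u t"
    unfolding nn_integral_lborel_subspace_scale[OF perp_subspace q(1) \<open>H \<in> borel_measurable borel\<close>]
    by (simp add: dim_perp[OF u] H_def section_moment_def)
  finally have "ennreal (q ^ ?N) * (ennreal (1 / q ^ l) * section_moment K l u 0)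
      \<le> ennreal (q ^ ?N) * (ennreal ((1 / q) ^ ?N) * section_moment K l u t)"
    by (rule mult_left_mono) simp
  also have "\<dots> = section_moment K l u t"
    using q by (simp add: mult.assoc[symmetric] ennreal_mult[symmetric] power_divide)
  also have "ennreal (q ^ ?N) * (ennreal (1 / q ^ l) * section_moment K l u 0) = ennreal (q ^ (?N - l)) * section_moment K l u 0"
    using q l by (simp add: mult.assoc[symmetric] ennreal_mult[symmetric] power_diff)
  finally show ?thesis .
qed

section \<open>Slab integrals\<close>

text \<open>Section moments integrated over the heights in \<open>I\<close>, written as an integral over the whole space.
  In this form the dependence on \<open>u\<close> is measurable, which is not clear for a single section moment because
  each hyperplane measure is built from an arbitrarily chosen basis.\<close>

definition slab_moment :: "'a::euclidean_space set \<Rightarrow> nat \<Rightarrow> real set \<Rightarrow> 'a \<Rightarrow> ennreal" where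
  "slab_moment K l I u =
     (\<integral>\<^sup>+x. indicator K x * ennreal (1 / norm (x - (x \<bullet> u) *\<^sub>R u) ^ l) * indicator I (x \<bullet> u) \<partial>lborel)"

lemma slab_moment_eq_section_moments:
  fixes u :: "'a::euclidean_space"
  assumes u: "norm u = 1" and [measurable]: "K \<in> sets borel" "I \<in> sets borel"
  shows "slab_moment K l I u = (\<integral>\<^sup>+t. indicator I t * section_moment K l u t \<partial>lborel)"
proof -
  let ?\<mu> = "lborel_subspace (perp u)"
  interpret \<mu>: sigma_finite_measure ?\<mu> by (rule sigma_finite_lborel_subspace[OF perp_subspace])
  interpret pair_sigma_finite lborel ?\<mu> by standard
  have "u \<bullet> u = 1" using u by (simp add: dot_square_norm)
  have "slab_moment K l I u = (\<integral>\<^sup>+y. \<integral>\<^sup>+t. indicator I t * (indicator K (y + t *\<^sub>R u) * ennreal (1 / norm y ^ l)) \<partial>lborel \<partial>?\<mu>)"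
    unfolding slab_moment_def
  proof (subst nn_integral_lborel_perp[OF u], measurable, rule nn_integral_cong_AE,
      use AE_lborel_subspace[OF perp_subspace] in eventually_elim)
    fix y assume "y \<in> perp u"
    then have "(y + t *\<^sub>R u) \<bullet> u = t" for t
      using \<open>u \<bullet> u = 1\<close> by (simp add: perp_def inner_add_left)
    then show "(\<integral>\<^sup>+t. indicator K (y + t *\<^sub>R u) * ennreal (1 / norm (y + t *\<^sub>R u - ((y + t *\<^sub>R u) \<bullet> u) *\<^sub>R u) ^ l)
          * indicator I ((y + t *\<^sub>R u) \<bullet> u) \<partial>lborel)
       = (\<integral>\<^sup>+t. indicator I t * (indicator K (y + t *\<^sub>R u) * ennreal (1 / norm y ^ l)) \<partial>lborel)"
      by (simp add: mult_ac)
  qed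
  also have "\<dots> = (\<integral>\<^sup>+t. \<integral>\<^sup>+y. indicator I t * (indicator K (y + t *\<^sub>R u) * ennreal (1 / norm y ^ l)) \<partial>?\<mu> \<partial>lborel)"
    by (rule Fubini') measurable
  also have "\<dots> = (\<integral>\<^sup>+t. indicator I t * section_moment K l u t \<partial>lborel)"
    unfolding section_moment_def by (intro nn_integral_cong nn_integral_cmult) measurable
  finally show ?thesis .
qed

text \<open>The central section moment bounds the averages over all other height intervals, and is itself bounded by
  its own average over \<open>[-\<kappa>, \<kappa>]\<close> up to a factor that tends to 1 as \<open>\<kappa>\<close> tends to 0.\<close>

lemma slab_moment_le_central:
  fixes K :: "'a::euclidean_space set"
  assumes u: "norm u = 1" and l: "l + 2 \<le> DIM('a)" and K: "compact K" "convex K" and r: "cball 0 r \<subseteq> K"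
    and max: "\<And>t. section_moment K l u t \<le> section_moment K l u 0"
    and \<kappa>: "0 < \<kappa>" "\<kappa> < r"
  shows "ennreal ((1 - \<kappa> / r) ^ (DIM('a) - 1 - l)) * slab_moment K l {a - \<kappa>..a + \<kappa>} u \<le> slab_moment K l {- \<kappa>..\<kappa>} u"
proof -
  let ?q = "ennreal ((1 - \<kappa> / r) ^ (DIM('a) - 1 - l))" and ?A = "section_moment K l u"
  have [measurable]: "K \<in> sets borel" using K by (simp add: borel_compact)
  have "slab_moment K l {a - \<kappa>..a + \<kappa>} u \<le> (\<integral>\<^sup>+t. indicator {a - \<kappa>..a + \<kappa>} t * ?A 0 \<partial>lborel)"
    by (subst slab_moment_eq_section_moments[OF u]) (auto intro!: nn_integral_mono mult_left_mono max)
  also have "\<dots> = ennreal (2 * \<kappa>) * ?A 0"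
    using \<kappa> by (subst nn_integral_multc) auto
  finally have "?q * slab_moment K l {a - \<kappa>..a + \<kappa>} u \<le> ?q * (ennreal (2 * \<kappa>) * ?A 0)"
    by (rule mult_left_mono) simp
  also have "\<dots> = ennreal (2 * \<kappa>) * (?q * ?A 0)" by (simp add: mult_ac)
  also have "\<dots> = (\<integral>\<^sup>+t. indicator {- \<kappa>..\<kappa>} t * (?q * ?A 0) \<partial>lborel)"
    using \<kappa> by (subst nn_integral_multc) auto
  also have "\<dots> \<le> (\<integral>\<^sup>+t. indicator {- \<kappa>..\<kappa>} t * ?A t \<partial>lborel)"
  proof (rule nn_integral_mono)
    fix t :: real
    show "indicator {- \<kappa>..\<kappa>} t * (?q * ?A 0) \<le> indicator {- \<kappa>..\<kappa>} t * ?A t"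
    proof (cases "t \<in> {- \<kappa>..\<kappa>}")
      case True
      then have "\<bar>t\<bar> \<le> (1 - (1 - \<kappa> / r)) * r" using \<kappa> by auto
      then show ?thesis
        using section_moment_near_central[OF u l K r, of "1 - \<kappa> / r" t] \<kappa> True by simp
    qed simp
  qed
  also have "\<dots> = slab_moment K l {- \<kappa>..\<kappa>} u"
    by (rule slab_moment_eq_section_moments[OF u, symmetric]) auto
  finally show ?thesis .
qed

text \<open>The factor \<open>|\<xi>|\<^sup>-\<^sup>2\<close> is chosen so that the derivative at the central section becomes \<open>\<theta> \<bullet> \<eta>\<close> times the
  integral of \<open>exp (\<omega> \<bullet> \<eta> - |\<omega>|\<^sup>2 / 2)\<close> over \<open>\<theta>\<^sup>\<bottom>\<close>, which has a closed form.\<close>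

definition weight :: "'a::euclidean_space \<Rightarrow> 'a \<Rightarrow> real" where
  "weight \<eta> \<xi> = exp (\<xi> \<bullet> \<eta> - (norm \<xi>)\<^sup>2 / 2) / (norm \<xi>)\<^sup>2"

lemma weight_measurable [measurable]: "weight \<eta> \<in> borel_measurable borel"
  unfolding weight_def[abs_def] by measurable

lemma weight_nonneg: "weight \<eta> \<xi> \<ge> 0"
  by (simp add: weight_def)

definition mean_slab_moment :: "'a::euclidean_space \<Rightarrow> 'a set \<Rightarrow> nat \<Rightarrow> real set \<Rightarrow> ennreal" where
  "mean_slab_moment \<eta> K l I = (\<integral>\<^sup>+\<xi>. ennreal (weight \<eta> \<xi>) * slab_moment K l I (dir \<xi>) \<partial>lborel)"

lemma slab_moment_measurable:
  fixes K :: "'a::euclidean_space set"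
  assumes [measurable]: "K \<in> sets borel" "I \<in> sets borel"
  shows "slab_moment K l I \<in> borel_measurable borel"
  unfolding slab_moment_def[abs_def] by measurable

lemma AE_lborel_neq_0: "AE x in lborel. x \<noteq> (0::'a::euclidean_space)"
  by (rule AE_lborel_singleton)

lemma mean_slab_moment_le_central:
  fixes K :: "'a::euclidean_space set"
  assumes l: "l + 2 \<le> DIM('a)" and K: "compact K" "convex K" and r: "cball 0 r \<subseteq> K"
    and max: "\<And>u t. norm u = 1 \<Longrightarrow> section_moment K l u t \<le> section_moment K l u 0"
    and \<kappa>: "0 < \<kappa>" "\<kappa> < r"
  shows "ennreal ((1 - \<kappa> / r) ^ (DIM('a) - 1 - l)) * mean_slab_moment \<eta> K l {a - \<kappa>..a + \<kappa>} \<le> mean_slab_moment \<eta> K l {- \<kappa>..\<kappa>}"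
proof -
  let ?q = "ennreal ((1 - \<kappa> / r) ^ (DIM('a) - 1 - l))"
  have [measurable]: "K \<in> sets borel" using K by (simp add: borel_compact)
  note [measurable] = slab_moment_measurable[of K]
  have "?q * mean_slab_moment \<eta> K l {a - \<kappa>..a + \<kappa>}
      = (\<integral>\<^sup>+\<xi>. ?q * (ennreal (weight \<eta> \<xi>) * slab_moment K l {a - \<kappa>..a + \<kappa>} (dir \<xi>)) \<partial>lborel)"
    unfolding mean_slab_moment_def by (rule nn_integral_cmult[symmetric]) measurable
  also have "\<dots> \<le> mean_slab_moment \<eta> K l {- \<kappa>..\<kappa>}"
    unfolding mean_slab_moment_def
  proof (rule nn_integral_mono_AE, use AE_lborel_neq_0 in eventually_elim)
    fix \<xi> :: 'a assume "\<xi> \<noteq> 0"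
    then have n: "norm (dir \<xi>) = 1" by simp
    have "ennreal (weight \<eta> \<xi>) * (?q * slab_moment K l {a - \<kappa>..a + \<kappa>} (dir \<xi>))
        \<le> ennreal (weight \<eta> \<xi>) * slab_moment K l {- \<kappa>..\<kappa>} (dir \<xi>)"
      by (intro mult_left_mono slab_moment_le_central[OF n l K r max[OF n] \<kappa>]) simp
    then show "?q * (ennreal (weight \<eta> \<xi>) * slab_moment K l {a - \<kappa>..a + \<kappa>} (dir \<xi>))
        \<le> ennreal (weight \<eta> \<xi>) * slab_moment K l {- \<kappa>..\<kappa>} (dir \<xi>)"
      by (simp add: mult_ac)
  qed
  finally show ?thesis .
qed

lemma mean_slab_moment_Un:
  fixes K :: "'a::euclidean_space set"
  assumes [measurable]: "K \<in> sets borel" "L \<in> sets borel" "I \<in> sets borel" and d: "K \<inter> L = {}"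
  shows "mean_slab_moment \<eta> (K \<union> L) l I = mean_slab_moment \<eta> K l I + mean_slab_moment \<eta> L l I"
proof -
  note [measurable] = slab_moment_measurable[of K I] slab_moment_measurable[of L I]
  have "slab_moment (K \<union> L) l I u = slab_moment K l I u + slab_moment L l I u" for u
    unfolding slab_moment_def using d
    by (subst nn_integral_add[symmetric]) (auto intro!: nn_integral_cong simp: indicator_def)
  then show ?thesis
    unfolding mean_slab_moment_def
    by (subst nn_integral_add[symmetric]) (auto intro!: nn_integral_cong simp: distrib_left)
qed

lemma mean_slab_moment_ball:
  fixes \<eta> :: "'a::euclidean_space"
  assumes l: "l + 2 \<le> DIM('a)" and I[measurable]: "I \<in> sets borel" "I \<subseteq> {-r..r}"
  shows "mean_slab_moment \<eta> (cball 0 r) l I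
    = (\<integral>\<^sup>+\<xi>. ennreal (weight \<eta> \<xi>) \<partial>lborel) * unit_ball_mass (DIM('a) - 1) *
      (\<integral>\<^sup>+t. indicator I t * ennreal (real (DIM('a) - 1) / real (DIM('a) - 1 - l) * sqrt (r\<^sup>2 - t\<^sup>2) ^ (DIM('a) - 1 - l)) \<partial>lborel)"
proof -
  let ?b = "\<lambda>t. ennreal (real (DIM('a) - 1) / real (DIM('a) - 1 - l) * sqrt (r\<^sup>2 - t\<^sup>2) ^ (DIM('a) - 1 - l))"
  let ?m = "unit_ball_mass (DIM('a) - 1)"
  have slab: "slab_moment (cball 0 r) l I u = ?m * (\<integral>\<^sup>+t. indicator I t * ?b t \<partial>lborel)" if u: "norm u = 1" for u :: 'a
  proof -
    have "slab_moment (cball 0 r) l I u = (\<integral>\<^sup>+t. ?m * (indicator I t * ?b t) \<partial>lborel)"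
      unfolding slab_moment_eq_section_moments[OF u borel_closed[OF closed_cball] I(1)]
    proof (rule nn_integral_cong)
      fix t
      show "indicator I t * section_moment (cball 0 r) l u t = ?m * (indicator I t * ?b t)"
        using section_moment_ball[OF u l, of t r] subsetD[OF I(2), of t] by (cases "t \<in> I") auto
    qed
    then show ?thesis by (subst (asm) nn_integral_cmult) auto
  qed
  have "mean_slab_moment \<eta> (cball 0 r) l I
     = (\<integral>\<^sup>+\<xi>. ennreal (weight \<eta> \<xi>) * (?m * (\<integral>\<^sup>+t. indicator I t * ?b t \<partial>lborel)) \<partial>lborel)"
    unfolding mean_slab_moment_def
    by (rule nn_integral_cong_AE, use AE_lborel_neq_0 in eventually_elim) (subst slab, auto)
  also have "\<dots> = (\<integral>\<^sup>+\<xi>. ennreal (weight \<eta> \<xi>) \<partial>lborel) * (?m * (\<integral>\<^sup>+t. indicator I t * ?b t \<partial>lborel))"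
    by (rule nn_integral_multc) measurable
  finally show ?thesis by (simp add: mult.assoc)
qed

lemma lborel_subspace_UNIV: "lborel_subspace UNIV = (lborel :: 'a::euclidean_space measure)"
proof (rule translation_invariant_eq_lborel)
  show "(\<integral>\<^sup>+x. G (x + v) \<partial>lborel_subspace UNIV) = (\<integral>\<^sup>+x. G x \<partial>lborel_subspace UNIV)"
    if "G \<in> borel_measurable borel" for G and v :: 'a
    using that by (intro nn_integral_lborel_subspace_translate) auto
  show "(\<integral>\<^sup>+x. ennreal (exp (- (norm x)\<^sup>2 / 2)) \<partial>lborel_subspace (UNIV::'a set)) = gauss_mass ^ DIM('a)"
    using gauss_lborel_subspace[of "UNIV :: 'a set"] by simp
qed (use gauss_mass_finite_pos gauss_lborel in \<open>auto simp: power_less_top_ennreal zero_less_iff_neq_zero\<close>)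

text \<open>The bound depends on \<open>E\<close> through its dimension only, so it serves as a majorant that is uniform over all
  hyperplanes.\<close>

lemma radial_gauss_finite:
  fixes E :: "'a::euclidean_space set"
  assumes E: "subspace E" and d: "dim E = N" "j < N"
  shows "(\<integral>\<^sup>+y. ennreal (exp (c * norm y - (norm y)\<^sup>2 / 2) / norm y ^ j) \<partial>lborel_subspace E)
     \<le> unit_ball_mass N * ennreal (real N * exp ((c + 1)\<^sup>2 / 2) * fact (N - 1 - j))"
proof -
  let ?C = "exp ((c + 1)\<^sup>2 / 2)"
  have le: "exp (c * v - v\<^sup>2 / 2) \<le> ?C * exp (- v)" for v
  proof -
    have "0 \<le> (v - (c + 1))\<^sup>2 / 2" by simp
    then have "c * v - v\<^sup>2 / 2 \<le> (c + 1)\<^sup>2 / 2 + - v"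
      by (simp add: power2_eq_square algebra_simps)
    then show ?thesis by (metis exp_add exp_le_cancel_iff)
  qed
  have "(\<integral>\<^sup>+y. ennreal (exp (c * norm y - (norm y)\<^sup>2 / 2) / norm y ^ j) \<partial>lborel_subspace E)
    = unit_ball_mass N * (ennreal (real N) *
       (\<integral>\<^sup>+v. ennreal (exp (c * v - v\<^sup>2 / 2) / v ^ j) * ennreal (v ^ (N - 1)) * indicator {0<..} v \<partial>lborel))"
    using nn_integral_radial[OF E, of "\<lambda>v. ennreal (exp (c * v - v\<^sup>2 / 2) / v ^ j)"] d by simp
  moreover have "(\<integral>\<^sup>+v. ennreal (exp (c * v - v\<^sup>2 / 2) / v ^ j) * ennreal (v ^ (N - 1)) * indicator {0<..} v \<partial>lborel)
    \<le> (\<integral>\<^sup>+v. ennreal ?C * (ennreal (v ^ (N - 1 - j) * exp (- v)) * indicator {0..} v) \<partial>lborel)"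
  proof (rule nn_integral_mono)
    fix v :: real
    have "exp (c * v - v\<^sup>2 / 2) / v ^ j * v ^ (N - 1) \<le> ?C * (v ^ (N - 1 - j) * exp (- v))" if "v > 0"
    proof -
      have "exp (c * v - v\<^sup>2 / 2) / v ^ j * v ^ (N - 1) = exp (c * v - v\<^sup>2 / 2) * v ^ (N - 1 - j)"
        using that d by (simp add: power_diff)
      also have "\<dots> \<le> ?C * exp (- v) * v ^ (N - 1 - j)"
        using that by (intro mult_right_mono le) auto
      finally show ?thesis by (simp add: mult_ac)
    qed
    then show "ennreal (exp (c * v - v\<^sup>2 / 2) / v ^ j) * ennreal (v ^ (N - 1)) * indicator {0<..} v
        \<le> ennreal ?C * (ennreal (v ^ (N - 1 - j) * exp (- v)) * indicator {0..} v)"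
      by (auto simp: indicator_def ennreal_mult[symmetric] intro!: ennreal_leI)
  qed
  moreover have "(\<integral>\<^sup>+v. ennreal ?C * (ennreal (v ^ (N - 1 - j) * exp (- v)) * indicator {0..} v) \<partial>lborel)
      = ennreal ?C * ennreal (fact (N - 1 - j))"
    by (subst nn_integral_cmult) (auto simp: nn_intergal_power_times_exp_Ici)
  ultimately show ?thesis
    by (simp add: ennreal_mult mult.assoc mult_left_mono)
qed

lemma weight_mass_finite:
  fixes \<eta> :: "'a::euclidean_space"
  assumes "DIM('a) \<ge> 3"
  shows "(\<integral>\<^sup>+\<xi>. ennreal (weight \<eta> \<xi>) \<partial>lborel) < \<infinity>"
proof -
  have "(\<integral>\<^sup>+\<xi>. ennreal (weight \<eta> \<xi>) \<partial>lborel)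
      \<le> (\<integral>\<^sup>+\<xi>. ennreal (exp (norm \<eta> * norm \<xi> - (norm \<xi>)\<^sup>2 / 2) / norm \<xi> ^ 2) \<partial>lborel_subspace (UNIV :: 'a set))"
    unfolding lborel_subspace_UNIV weight_def
    using norm_cauchy_schwarz[of _ \<eta>]
    by (intro nn_integral_mono ennreal_leI divide_right_mono) (auto simp: mult.commute)
  also have "\<dots> \<le> unit_ball_mass (DIM('a)) * ennreal (real (DIM('a)) * exp ((norm \<eta> + 1)\<^sup>2 / 2) * fact (DIM('a) - 1 - 2))"
    using assms by (intro radial_gauss_finite) auto
  also have "\<dots> < \<infinity>"
    using emeasure_unit_ball(3)[of "UNIV :: 'a set"] assms by (simp add: ennreal_mult_less_top)
  finally show ?thesis .
qed

section \<open>The dual side: averaging over the directions for a fixed point\<close>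

text \<open>The substitution \<open>s = w a / sqrt (r\<^sup>2 - a\<^sup>2)\<close>, the inverse of \<open>a = r s / sqrt (w\<^sup>2 + s\<^sup>2)\<close>.\<close>

lemma slab_substitution:
  fixes f :: "real \<Rightarrow> real"
  assumes w: "w > 0" and I: "- r < \<alpha>" "\<alpha> \<le> \<beta>" "\<beta> < r" and [measurable]: "f \<in> borel_measurable borel"
  shows "(\<integral>\<^sup>+s. ennreal (f s) * indicator {\<alpha>..\<beta>} (r * s / sqrt (w\<^sup>2 + s\<^sup>2)) \<partial>lborel)
    = (\<integral>\<^sup>+a. ennreal (f (w * a / sqrt (r\<^sup>2 - a\<^sup>2)) * (w * r\<^sup>2 / sqrt (r\<^sup>2 - a\<^sup>2) ^ 3)) * indicator {\<alpha>..\<beta>} a \<partial>lborel)"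
proof -
  define g where "g = (\<lambda>a. w * a / sqrt (r\<^sup>2 - a\<^sup>2))"
  define g' where "g' = (\<lambda>a. w * r\<^sup>2 / sqrt (r\<^sup>2 - a\<^sup>2) ^ 3)"
  have r: "r > 0" using I by linarith
  have pos: "r\<^sup>2 - a\<^sup>2 > 0" if "- r < a" "a < r" for a
  proof -
    have "(r - a) * (r + a) > 0" using that by (intro mult_pos_pos) auto
    then show ?thesis by (simp add: power2_eq_square algebra_simps)
  qed
  have deriv: "(g has_real_derivative g' a) (at a)" if "- r < a" "a < r" for a
  proof -
    let ?c = "sqrt (r\<^sup>2 - a\<^sup>2)"
    have c: "?c > 0" "?c\<^sup>2 = r\<^sup>2 - a\<^sup>2" using pos[OF that] by auto
    have "((\<lambda>a. w * a / sqrt (r\<^sup>2 - a\<^sup>2)) has_real_derivative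
        (w * ?c - w * a * (- (2 * a) * (inverse ?c / 2))) / (?c * ?c)) (at a)"
      using pos[OF that] by (auto intro!: derivative_eq_intros)
    moreover have "(w * d - w * a * (- (2 * a) * (inverse d / 2))) / (d * d) = w * (d\<^sup>2 + a\<^sup>2) / d ^ 3" if "d > 0" for d
      using that by (simp add: field_simps power2_eq_square power3_eq_cube)
    note this[OF c(1)]
    ultimately show ?thesis using c(2) by (simp add: g_def[abs_def] g'_def)
  qed
  have g'_pos: "g' a > 0" if "- r < a" "a < r" for a
    using pos[OF that] w r by (simp add: g'_def)
  have mono: "g a < g b" if "- r < a" "a < b" "b < r" for a b
  proof (rule DERIV_pos_imp_increasing[OF that(2)])
    fix x assume "a \<le> x" "x \<le> b"
    then show "\<exists>y. (g has_real_derivative y) (at x) \<and> 0 < y"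
      using deriv[of x] g'_pos[of x] that by (intro exI[of _ "g' x"]) auto
  qed
  have inv: "g (r * s / sqrt (w\<^sup>2 + s\<^sup>2)) = s" "- r < r * s / sqrt (w\<^sup>2 + s\<^sup>2)" "r * s / sqrt (w\<^sup>2 + s\<^sup>2) < r" for s
  proof -
    let ?\<rho> = "sqrt (w\<^sup>2 + s\<^sup>2)"
    have \<rho>: "?\<rho> > 0" "?\<rho>\<^sup>2 = w\<^sup>2 + s\<^sup>2" using w by (auto simp: add_pos_nonneg)
    have "\<bar>s\<bar> < ?\<rho>" using w by (intro real_less_rsqrt) auto
    then show "- r < r * s / ?\<rho>" "r * s / ?\<rho> < r"
      using r \<rho>(1) mult_strict_left_mono[of "s" ?\<rho> r] mult_strict_left_mono[of "- s" ?\<rho> r]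
      by (auto simp: field_simps abs_less_iff)
    have "r\<^sup>2 - (r * s / \<rho>)\<^sup>2 = r\<^sup>2 * (\<rho>\<^sup>2 - s\<^sup>2) / \<rho>\<^sup>2" if "\<rho> > 0" for \<rho>
      using that by (simp add: field_simps power_mult_distrib power_divide)
    from this[OF \<rho>(1)] have "r\<^sup>2 - (r * s / ?\<rho>)\<^sup>2 = (r * w / ?\<rho>)\<^sup>2"
      unfolding \<rho>(2) by (simp add: power_mult_distrib power_divide)
    then have "sqrt (r\<^sup>2 - (r * s / ?\<rho>)\<^sup>2) = r * w / ?\<rho>"
      using r w \<rho> by simp
    then show "g (r * s / ?\<rho>) = s" using r w \<rho>(1) by (simp add: g_def)
  qed
  have "r * s / sqrt (w\<^sup>2 + s\<^sup>2) \<in> {\<alpha>..\<beta>} \<longleftrightarrow> s \<in> {g \<alpha>..g \<beta>}" for s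
    using mono[of \<alpha> "r * s / sqrt (w\<^sup>2 + s\<^sup>2)"] mono[of "r * s / sqrt (w\<^sup>2 + s\<^sup>2)" \<alpha>]
      mono[of \<beta> "r * s / sqrt (w\<^sup>2 + s\<^sup>2)"] mono[of "r * s / sqrt (w\<^sup>2 + s\<^sup>2)" \<beta>] inv[of s] I
    by (auto simp: not_le[symmetric]) (smt (verit))+
  then have "(\<integral>\<^sup>+s. ennreal (f s) * indicator {\<alpha>..\<beta>} (r * s / sqrt (w\<^sup>2 + s\<^sup>2)) \<partial>lborel)
     = (\<integral>\<^sup>+s. ennreal (f s) * indicator {g \<alpha>..g \<beta>} s \<partial>lborel)"
    by (intro nn_integral_cong) (simp add: indicator_def)
  also have "\<dots> = (\<integral>\<^sup>+a. ennreal (f (g a) * g' a) * indicator {\<alpha>..\<beta>} a \<partial>lborel)"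
  proof -
    have "(\<integral>\<^sup>+s. ennreal (f s * indicator {g \<alpha>..g \<beta>} s) \<partial>lborel)
       = (\<integral>\<^sup>+a. ennreal (f (g a) * g' a * indicator {\<alpha>..\<beta>} a) \<partial>lborel)"
    proof (rule nn_integral_substitution)
      show "set_borel_measurable borel {g \<alpha>..g \<beta>} f"
        unfolding set_borel_measurable_def by measurable
      show "continuous_on {\<alpha>..\<beta>} g'"
      proof -
        have "\<forall>a\<in>{\<alpha>..\<beta>}. sqrt (r\<^sup>2 - a\<^sup>2) ^ 3 \<noteq> 0"
        proof
          fix a assume "a \<in> {\<alpha>..\<beta>}"
          then show "sqrt (r\<^sup>2 - a\<^sup>2) ^ 3 \<noteq> 0" using pos[of a] I by auto
        qed
        then show ?thesis unfolding g'_def by (intro continuous_intros)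
      qed
      show "g' x \<ge> 0" if "x \<in> {\<alpha>..\<beta>}" for x using g'_pos[of x] that I by auto
      show "(g has_real_derivative g' x) (at x)" if "x \<in> {\<alpha>..\<beta>}" for x
        using that I by (intro deriv) auto
    qed (use I in auto)
    moreover have "ennreal (F * indicator A x) = ennreal F * indicator A x" for F and A and x :: real
      by (auto simp: indicator_def)
    ultimately show ?thesis by simp
  qed
  finally show ?thesis by (simp add: g_def g'_def)
qed

text \<open>The integrand over \<open>\<theta>\<^sup>\<bottom>\<close> produced by \<open>weight_over_directions\<close> below, with \<open>s\<close> the sine of the angle
  between \<open>\<theta>\<close> and the hyperplane \<open>\<xi>\<^sup>\<bottom>\<close>. The two powers of the cosine are kept apart because the
  combined exponent \<open>N - l - 2\<close> can be \<open>-1\<close>.\<close>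

definition kern :: "nat \<Rightarrow> nat \<Rightarrow> 'a::euclidean_space \<Rightarrow> 'a \<Rightarrow> real \<Rightarrow> 'a \<Rightarrow> real" where
  "kern N l \<eta> \<theta> s \<omega> = sqrt (1 - s\<^sup>2) ^ (N - 1) / sqrt (1 - s\<^sup>2) ^ (l + 1) / norm \<omega> *
     exp (sqrt (1 - s\<^sup>2) * (\<omega> \<bullet> \<eta>) + s * norm \<omega> * (\<theta> \<bullet> \<eta>) - (norm \<omega>)\<^sup>2 / 2)"

lemma kern_measurable [measurable (raw)]:
  assumes [measurable]: "f \<in> borel_measurable M" "g \<in> borel_measurable M" "h \<in> borel_measurable M"
  shows "(\<lambda>x. kern N l \<eta> (f x) (g x) (h x)) \<in> borel_measurable M"
  unfolding kern_def by measurable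

abbreviation (input) slab_kernel :: "nat \<Rightarrow> real set \<Rightarrow> 'a::euclidean_space \<Rightarrow> 'a \<Rightarrow> ennreal" where
  "slab_kernel l I u x \<equiv> ennreal (1 / norm (x - (x \<bullet> u) *\<^sub>R u) ^ l) * indicator I (x \<bullet> u)"

text \<open>With \<open>\<theta> = x / |x|\<close> write \<open>\<xi> = \<omega> + s \<theta>\<close>, \<open>\<omega> \<bottom> \<theta>\<close>: the slab condition then only involves
  \<open>s / |\<omega>|\<close>. Substituting the height \<open>a\<close> of \<open>x\<close> over \<open>\<xi>\<^sup>\<bottom>\<close> for \<open>s\<close> and rescaling \<open>\<omega>\<close> by the cosine
  \<open>sqrt (r\<^sup>2 - a\<^sup>2) / r\<close> leaves an integral over \<open>\<theta>\<^sup>\<bottom>\<close> that depends smoothly on \<open>a / r\<close>.\<close>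

lemma weight_over_directions:
  fixes \<eta> \<theta> :: "'a::euclidean_space"
  assumes \<theta>: "norm \<theta> = 1" and N: "N = DIM('a) - 1" "N \<ge> 2" and I: "- r < \<alpha>" "\<alpha> \<le> \<beta>" "\<beta> < r"
  shows "(\<integral>\<^sup>+\<xi>. ennreal (weight \<eta> \<xi>) * (slab_kernel l {\<alpha>..\<beta>} (dir \<xi>) (r *\<^sub>R \<theta>)) \<partial>lborel)
    = (\<integral>\<^sup>+a. indicator {\<alpha>..\<beta>} a * (ennreal (1 / r ^ (l + 1)) *
         (\<integral>\<^sup>+\<omega>. ennreal (kern N l \<eta> \<theta> (a / r) \<omega>) \<partial>lborel_subspace (perp \<theta>))) \<partial>lborel)"
proof -
  let ?\<mu> = "lborel_subspace (perp \<theta>)"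
  interpret \<mu>: sigma_finite_measure ?\<mu> by (rule sigma_finite_lborel_subspace[OF perp_subspace])
  interpret pair_sigma_finite lborel ?\<mu> by standard
  have dN: "dim (perp \<theta>) = N" using dim_perp[OF \<theta>] N by simp
  have r: "r > 0" using I by linarith
  have \<theta>\<theta>: "\<theta> \<bullet> \<theta> = 1" using \<theta> by (simp add: dot_square_norm)
  have pos: "r\<^sup>2 - a\<^sup>2 > 0" if "a \<in> {\<alpha>..\<beta>}" for a
  proof -
    have "(r - a) * (r + a) > 0" using that I by (intro mult_pos_pos) auto
    then show ?thesis by (simp add: power2_eq_square algebra_simps)
  qed
  define H where "H = (\<lambda>a \<omega>. 1 / norm \<omega> / sqrt (r\<^sup>2 - a\<^sup>2) ^ (l + 1) *
     exp (\<omega> \<bullet> \<eta> + norm \<omega> * a / sqrt (r\<^sup>2 - a\<^sup>2) * (\<theta> \<bullet> \<eta>) - (norm \<omega>)\<^sup>2 * r\<^sup>2 / (2 * (r\<^sup>2 - a\<^sup>2))))"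
  have [measurable]: "(\<lambda>p. H (fst p) (snd p)) \<in> borel_measurable (borel \<Otimes>\<^sub>M borel)" "H a \<in> borel_measurable borel" for a
    unfolding H_def by measurable
  have inner: "(\<integral>\<^sup>+s. ennreal (weight \<eta> (\<omega> + s *\<^sub>R \<theta>)) * (slab_kernel l {\<alpha>..\<beta>} (dir (\<omega> + s *\<^sub>R \<theta>)) (r *\<^sub>R \<theta>)) \<partial>lborel)
     = (\<integral>\<^sup>+a. indicator {\<alpha>..\<beta>} a * ennreal (H a \<omega>) \<partial>lborel)"
    if \<omega>: "\<omega> \<in> perp \<theta>" "\<omega> \<noteq> 0" for \<omega>
  proof -
    let ?w = "norm \<omega>"
    have w: "?w > 0" using \<omega> by simp
    define f where "f = (\<lambda>s. exp (\<omega> \<bullet> \<eta> + s * (\<theta> \<bullet> \<eta>) - (?w\<^sup>2 + s\<^sup>2) / 2) / (?w\<^sup>2 + s\<^sup>2) * (sqrt (?w\<^sup>2 + s\<^sup>2) / (r * ?w)) ^ l)"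
    have [measurable]: "f \<in> borel_measurable borel" unfolding f_def by measurable
    have eq: "ennreal (weight \<eta> (\<omega> + s *\<^sub>R \<theta>)) * (slab_kernel l {\<alpha>..\<beta>} (dir (\<omega> + s *\<^sub>R \<theta>)) (r *\<^sub>R \<theta>))
        = ennreal (f s) * indicator {\<alpha>..\<beta>} (r * s / sqrt (?w\<^sup>2 + s\<^sup>2))" for s
    proof -
      define \<rho> where "\<rho> = sqrt (?w\<^sup>2 + s\<^sup>2)"
      define u where "u = (\<omega> + s *\<^sub>R \<theta>) /\<^sub>R \<rho>"
      have \<rho>: "\<rho> > 0" "\<rho>\<^sup>2 = ?w\<^sup>2 + s\<^sup>2" using w by (auto simp: \<rho>_def add_pos_nonneg)
      have n: "norm (\<omega> + s *\<^sub>R \<theta>) = \<rho>"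
        unfolding \<rho>_def norm_add_perp[OF \<theta> \<omega>(1), symmetric] by simp
      have "norm u = 1" using n \<rho> by (simp add: u_def)
      then have uu: "u \<bullet> u = 1" by (simp add: dot_square_norm)
      have xu: "r *\<^sub>R \<theta> \<bullet> u = r * s / \<rho>"
        using \<omega>(1) \<theta>\<theta> by (simp add: u_def perp_def inner_add_right inner_commute divide_inverse mult_ac)
      have "(norm (r *\<^sub>R \<theta> - (r * s / \<rho>) *\<^sub>R u))\<^sup>2 = r\<^sup>2 - (r * s / \<rho>)\<^sup>2"
        using xu uu \<theta>\<theta> unfolding power2_norm_eq_inner
        by (simp add: inner_diff_left inner_diff_right inner_commute power2_eq_square algebra_simps)
      also have "\<dots> = r\<^sup>2 * (\<rho>\<^sup>2 - s\<^sup>2) / \<rho>\<^sup>2"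
        using \<rho>(1) by (simp add: field_simps power_mult_distrib power_divide)
      also have "\<dots> = (r * ?w / \<rho>)\<^sup>2"
        using \<rho>(2) by (simp add: power_mult_distrib power_divide)
      finally have nx: "norm (r *\<^sub>R \<theta> - (r * s / \<rho>) *\<^sub>R u) = r * ?w / \<rho>"
        using r w \<rho>(1) by (subst (asm) power2_eq_iff_nonneg) auto
      have "weight \<eta> (\<omega> + s *\<^sub>R \<theta>) * (1 / (r * ?w / \<rho>) ^ l) = f s"
        using \<rho>(1) by (simp add: weight_def n f_def \<rho>(2)[symmetric] inner_add_left power_divide flip: \<rho>_def)
      then show ?thesis
        unfolding n u_def[symmetric] xu nx \<rho>_def[symmetric]
        using r w \<rho>(1) by (simp add: mult.assoc[symmetric] ennreal_mult[symmetric] weight_nonneg)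
    qed
    have "f (?w * a / sqrt (r\<^sup>2 - a\<^sup>2)) * (?w * r\<^sup>2 / sqrt (r\<^sup>2 - a\<^sup>2) ^ 3) = H a \<omega>" if a: "a \<in> {\<alpha>..\<beta>}" for a
    proof -
      define c where "c = sqrt (r\<^sup>2 - a\<^sup>2)"
      have c: "c > 0" "c\<^sup>2 = r\<^sup>2 - a\<^sup>2" using pos[OF a] by (auto simp: c_def)
      have "?w\<^sup>2 + (?w * a / c)\<^sup>2 = ?w\<^sup>2 * (c\<^sup>2 + a\<^sup>2) / c\<^sup>2"
        using c(1) by (simp add: field_simps power_mult_distrib power_divide)
      then have q: "?w\<^sup>2 + (?w * a / c)\<^sup>2 = (?w * r / c)\<^sup>2" using c(2) by (simp add: power_mult_distrib power_divide)
      have sq: "sqrt ((?w * r / c)\<^sup>2) = ?w * r / c" using w r c(1) by simp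
      have "f (?w * a / c) * (?w * r\<^sup>2 / c ^ 3)
         = exp (\<omega> \<bullet> \<eta> + ?w * a / c * (\<theta> \<bullet> \<eta>) - (?w * r / c)\<^sup>2 / 2) / (?w * r / c)\<^sup>2 * ((?w * r / c) / (r * ?w)) ^ l * (?w * r\<^sup>2 / c ^ 3)"
        unfolding f_def q sq ..
      also have "\<dots> = exp (\<omega> \<bullet> \<eta> + ?w * a / c * (\<theta> \<bullet> \<eta>) - (?w * r / c)\<^sup>2 / 2) * (1 / ?w / c ^ (l + 1))"
        using w r c(1) by (simp add: field_simps power2_eq_square power3_eq_cube power_divide)
      also have "(?w * r / c)\<^sup>2 / 2 = ?w\<^sup>2 * r\<^sup>2 / (2 * (r\<^sup>2 - a\<^sup>2))"
        using c by (simp add: power_mult_distrib power_divide)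
      finally show ?thesis
        unfolding H_def c_def by (simp only: mult.commute)
    qed
    then show ?thesis
      unfolding eq slab_substitution[OF w I \<open>f \<in> borel_measurable borel\<close>]
      by (intro nn_integral_cong) (auto simp: indicator_def)
  qed
  have scale: "(\<integral>\<^sup>+\<omega>. ennreal (H a \<omega>) \<partial>?\<mu>) = ennreal (1 / r ^ (l + 1)) * (\<integral>\<^sup>+\<omega>. ennreal (kern N l \<eta> \<theta> (a / r) \<omega>) \<partial>?\<mu>)"
    if a: "a \<in> {\<alpha>..\<beta>}" for a
  proof -
    define c where "c = sqrt (r\<^sup>2 - a\<^sup>2)"
    define k where "k = c / r"
    have c: "c > 0" "c\<^sup>2 = r\<^sup>2 - a\<^sup>2" using pos[OF a] by (auto simp: c_def)
    have k: "k > 0" using c r by (simp add: k_def)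
    have "1 - (a / r)\<^sup>2 = k\<^sup>2"
      using c r by (simp add: k_def power_divide field_simps)
    then have sk: "sqrt (1 - (a / r)\<^sup>2) = k" using k by simp
    obtain M where M: "N = Suc M" using N(2) by (cases N) auto
    have "k ^ N * H a (k *\<^sub>R \<omega>) = 1 / r ^ (l + 1) * kern N l \<eta> \<theta> (a / r) \<omega>" if "\<omega> \<noteq> 0" for \<omega>
    proof -
      have w: "norm \<omega> > 0" using that by simp
      have e1: "norm (k *\<^sub>R \<omega>) * a / c = a / r * norm \<omega>" using c r by (simp add: k_def)
      have e2: "(norm (k *\<^sub>R \<omega>))\<^sup>2 * r\<^sup>2 / (2 * (r\<^sup>2 - a\<^sup>2)) = (norm \<omega>)\<^sup>2 / 2"
        unfolding c(2)[symmetric] using c(1) r by (simp add: k_def power_mult_distrib power_divide)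
      have "k ^ N * (1 / norm (k *\<^sub>R \<omega>) / c ^ (l + 1)) = 1 / r ^ (l + 1) * (k ^ (N - 1) / k ^ (l + 1) / norm \<omega>)"
        using k w c(1) r by (simp add: M) (simp add: k_def field_simps power_divide)
      then show ?thesis
        unfolding H_def kern_def sk c_def[symmetric] e1 e2 inner_scaleR_left
        by (simp only: mult.assoc[symmetric])
    qed
    then have *: "ennreal (k ^ N) * ennreal (H a (k *\<^sub>R \<omega>)) = ennreal (1 / r ^ (l + 1)) * ennreal (kern N l \<eta> \<theta> (a / r) \<omega>)" if "\<omega> \<noteq> 0" for \<omega>
      using that k r by (simp add: ennreal_mult'[symmetric])
    have "(\<integral>\<^sup>+\<omega>. ennreal (H a (k *\<^sub>R \<omega>)) \<partial>?\<mu>) = ennreal ((1 / k) ^ N) * (\<integral>\<^sup>+\<omega>. ennreal (H a \<omega>) \<partial>?\<mu>)"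
      using nn_integral_lborel_subspace_scale[OF perp_subspace k, of "\<lambda>\<omega>. ennreal (H a \<omega>)" \<theta>] by (simp add: dN)
    then have "(\<integral>\<^sup>+\<omega>. ennreal (H a \<omega>) \<partial>?\<mu>) = ennreal (k ^ N) * (\<integral>\<^sup>+\<omega>. ennreal (H a (k *\<^sub>R \<omega>)) \<partial>?\<mu>)"
      using k by (simp add: mult.assoc[symmetric] ennreal_mult[symmetric] power_divide)
    also have "\<dots> = (\<integral>\<^sup>+\<omega>. ennreal (k ^ N) * ennreal (H a (k *\<^sub>R \<omega>)) \<partial>?\<mu>)"
      by (rule nn_integral_cmult[symmetric]) simp
    also have "\<dots> = (\<integral>\<^sup>+\<omega>. ennreal (1 / r ^ (l + 1)) * ennreal (kern N l \<eta> \<theta> (a / r) \<omega>) \<partial>?\<mu>)"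
    proof (rule nn_integral_cong_AE)
      have "AE \<omega> in ?\<mu>. \<omega> \<noteq> 0" using N dN by (intro AE_lborel_subspace_neq_0 perp_subspace) simp
      then show "AE \<omega> in ?\<mu>. ennreal (k ^ N) * ennreal (H a (k *\<^sub>R \<omega>)) = ennreal (1 / r ^ (l + 1)) * ennreal (kern N l \<eta> \<theta> (a / r) \<omega>)"
        by eventually_elim (rule *)
    qed
    also have "\<dots> = ennreal (1 / r ^ (l + 1)) * (\<integral>\<^sup>+\<omega>. ennreal (kern N l \<eta> \<theta> (a / r) \<omega>) \<partial>?\<mu>)"
      by (rule nn_integral_cmult) simp
    finally show ?thesis .
  qed
  have "(\<integral>\<^sup>+\<xi>. ennreal (weight \<eta> \<xi>) * (slab_kernel l {\<alpha>..\<beta>} (dir \<xi>) (r *\<^sub>R \<theta>)) \<partial>lborel)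
      = (\<integral>\<^sup>+\<omega>. \<integral>\<^sup>+a. indicator {\<alpha>..\<beta>} a * ennreal (H a \<omega>) \<partial>lborel \<partial>?\<mu>)"
  proof (subst nn_integral_lborel_perp[OF \<theta>], measurable, rule nn_integral_cong_AE)
    have "AE \<omega> in ?\<mu>. \<omega> \<noteq> 0" using N dN by (intro AE_lborel_subspace_neq_0 perp_subspace) simp
    with AE_lborel_subspace[OF perp_subspace, of \<theta>]
    show "AE \<omega> in ?\<mu>. (\<integral>\<^sup>+s. ennreal (weight \<eta> (\<omega> + s *\<^sub>R \<theta>)) * (slab_kernel l {\<alpha>..\<beta>} (dir (\<omega> + s *\<^sub>R \<theta>)) (r *\<^sub>R \<theta>)) \<partial>lborel)
       = (\<integral>\<^sup>+a. indicator {\<alpha>..\<beta>} a * ennreal (H a \<omega>) \<partial>lborel)"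
      by eventually_elim (rule inner)
  qed
  also have "\<dots> = (\<integral>\<^sup>+a. \<integral>\<^sup>+\<omega>. indicator {\<alpha>..\<beta>} a * ennreal (H a \<omega>) \<partial>?\<mu> \<partial>lborel)"
    by (rule Fubini') measurable
  also have "\<dots> = (\<integral>\<^sup>+a. indicator {\<alpha>..\<beta>} a * (ennreal (1 / r ^ (l + 1)) *
         (\<integral>\<^sup>+\<omega>. ennreal (kern N l \<eta> \<theta> (a / r) \<omega>) \<partial>?\<mu>)) \<partial>lborel)"
    by (rule nn_integral_cong) (auto simp: scale indicator_def)
  finally show ?thesis .
qed

text \<open>Integration over \<open>\<theta>\<^sup>\<bottom>\<close> as an integral over the whole space, which makes the dependence on
  \<open>\<theta>\<close> visibly measurable.\<close>

lemma nn_integral_perp_as_lborel: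
  fixes \<theta> :: "'a::euclidean_space"
  assumes \<theta>: "norm \<theta> = 1" and [measurable]: "G \<in> borel_measurable borel"
  shows "(\<integral>\<^sup>+\<omega>. G \<omega> \<partial>lborel_subspace (perp \<theta>))
    = (\<integral>\<^sup>+z. G (z - (z \<bullet> \<theta>) *\<^sub>R \<theta>) * indicator {0..1} (z \<bullet> \<theta>) \<partial>lborel)"
proof -
  have \<theta>\<theta>: "\<theta> \<bullet> \<theta> = 1" using \<theta> by (simp add: dot_square_norm)
  have "(\<integral>\<^sup>+z. G (z - (z \<bullet> \<theta>) *\<^sub>R \<theta>) * indicator {0..1} (z \<bullet> \<theta>) \<partial>lborel)
     = (\<integral>\<^sup>+\<omega>. G \<omega> \<partial>lborel_subspace (perp \<theta>))"
  proof (subst nn_integral_lborel_perp[OF \<theta>], measurable, rule nn_integral_cong_AE,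
      use AE_lborel_subspace[OF perp_subspace, of \<theta>] in eventually_elim)
    fix \<omega> assume "\<omega> \<in> perp \<theta>"
    then have "(\<omega> + t *\<^sub>R \<theta>) \<bullet> \<theta> = t" for t
      using \<theta>\<theta> by (simp add: perp_def inner_add_left)
    then show "(\<integral>\<^sup>+t. G (\<omega> + t *\<^sub>R \<theta> - ((\<omega> + t *\<^sub>R \<theta>) \<bullet> \<theta>) *\<^sub>R \<theta>) * indicator {0..1} ((\<omega> + t *\<^sub>R \<theta>) \<bullet> \<theta>) \<partial>lborel) = G \<omega>"
      by (simp add: nn_integral_cmult)
  qed
  then show ?thesis ..
qed

text \<open>The integral of \<^const>\<open>kern\<close> over \<open>\<theta>\<^sup>\<bottom>\<close>, see \<open>dual_section_perp\<close>.\<close>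

definition dual_section :: "nat \<Rightarrow> nat \<Rightarrow> 'a::euclidean_space \<Rightarrow> 'a \<Rightarrow> real \<Rightarrow> ennreal" where
  "dual_section N l \<eta> \<theta> s =
     (\<integral>\<^sup>+z. ennreal (kern N l \<eta> \<theta> s (z - (z \<bullet> \<theta>) *\<^sub>R \<theta>)) * indicator {0..1} (z \<bullet> \<theta>) \<partial>lborel)"

lemma dual_section_measurable [measurable (raw)]:
  assumes [measurable]: "f \<in> borel_measurable M" "g \<in> borel_measurable M"
  shows "(\<lambda>x. dual_section N l \<eta> (f x) (g x)) \<in> borel_measurable M"
  unfolding dual_section_def by measurable

lemma dual_section_perp:
  assumes "norm \<theta> = 1"
  shows "dual_section N l \<eta> \<theta> s = (\<integral>\<^sup>+\<omega>. ennreal (kern N l \<eta> \<theta> s \<omega>) \<partial>lborel_subspace (perp \<theta>))"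
  unfolding dual_section_def by (rule nn_integral_perp_as_lborel[OF assms, symmetric]) measurable

abbreviation (input) outer_density :: "nat \<Rightarrow> nat \<Rightarrow> 'a::euclidean_space \<Rightarrow> real \<Rightarrow> 'a \<Rightarrow> ennreal" where
  "outer_density N l \<eta> a x \<equiv> ennreal (1 / norm x ^ (l + 1)) * dual_section N l \<eta> (dir x) (a / norm x)"

text \<open>The order of integration over directions and points is exchanged. The set \<open>K\<close> stays away from the
  origin so that every height in the interval is smaller than \<open>|x|\<close>.\<close>

lemma mean_slab_moment_dual:
  fixes \<eta> :: "'a::euclidean_space"
  assumes [measurable]: "K \<in> sets borel" and N: "N = DIM('a) - 1" "N \<ge> 2"
    and K: "K \<inter> cball 0 r = {}" and r: "r > 0" and I: "- r < \<alpha>" "\<alpha> \<le> \<beta>" "\<beta> < r"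
  shows "mean_slab_moment \<eta> K l {\<alpha>..\<beta>} = (\<integral>\<^sup>+a. indicator {\<alpha>..\<beta>} a *
     (\<integral>\<^sup>+x. indicator K x * (outer_density N l \<eta> a x) \<partial>lborel) \<partial>lborel)"
proof -
  define G where "G = (\<lambda>x \<xi>. ennreal (weight \<eta> \<xi>) * (slab_kernel l {\<alpha>..\<beta>} (dir \<xi>) x))"
  have [measurable]: "(\<lambda>p. G (fst p) (snd p)) \<in> borel_measurable (borel \<Otimes>\<^sub>M borel)" "G x \<in> borel_measurable borel"
    "(\<lambda>x. G x \<xi>) \<in> borel_measurable borel" for x \<xi>
    unfolding G_def by measurable
  have "mean_slab_moment \<eta> K l {\<alpha>..\<beta>} = (\<integral>\<^sup>+\<xi>. \<integral>\<^sup>+x. indicator K x * G x \<xi> \<partial>lborel \<partial>lborel)"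
    unfolding mean_slab_moment_def slab_moment_def G_def
    by (intro nn_integral_cong) (subst nn_integral_cmult[symmetric], auto simp: mult_ac)
  also have "\<dots> = (\<integral>\<^sup>+x. \<integral>\<^sup>+\<xi>. indicator K x * G x \<xi> \<partial>lborel \<partial>lborel)"
    by (rule lborel_pair.Fubini') measurable
  also have "\<dots> = (\<integral>\<^sup>+x. \<integral>\<^sup>+a. indicator {\<alpha>..\<beta>} a * (indicator K x *
      (outer_density N l \<eta> a x)) \<partial>lborel \<partial>lborel)"
  proof (rule nn_integral_cong)
    fix x :: 'a
    show "(\<integral>\<^sup>+\<xi>. indicator K x * G x \<xi> \<partial>lborel) = (\<integral>\<^sup>+a. indicator {\<alpha>..\<beta>} a * (indicator K x *
      (outer_density N l \<eta> a x)) \<partial>lborel)"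
    proof (cases "x \<in> K")
      case True
      then have xr: "norm x > r" using K by auto
      then have "x \<noteq> 0" using r by auto
      then have \<theta>: "norm (dir x) = 1" "norm x *\<^sub>R (dir x) = x" by auto
      have "(\<integral>\<^sup>+\<xi>. G x \<xi> \<partial>lborel) = (\<integral>\<^sup>+a. indicator {\<alpha>..\<beta>} a *
          (outer_density N l \<eta> a x) \<partial>lborel)"
        using weight_over_directions[OF \<theta>(1) N, of "norm x" \<alpha> \<beta> \<eta> l] xr I
        unfolding dual_section_perp[OF \<theta>(1)] \<theta>(2) by (simp add: G_def)
      then show ?thesis using True by simp
    qed simp
  qed
  also have "\<dots> = (\<integral>\<^sup>+a. \<integral>\<^sup>+x. indicator {\<alpha>..\<beta>} a * (indicator K x *
      (outer_density N l \<eta> a x)) \<partial>lborel \<partial>lborel)"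
    by (rule lborel_pair.Fubini') measurable
  also have "\<dots> = (\<integral>\<^sup>+a. indicator {\<alpha>..\<beta>} a *
     (\<integral>\<^sup>+x. indicator K x * (outer_density N l \<eta> a x) \<partial>lborel) \<partial>lborel)"
    by (intro nn_integral_cong nn_integral_cmult) measurable
  finally show ?thesis .
qed

section \<open>Differentiation at the central section\<close>

text \<open>The shape of \<^const>\<open>kern\<close> as a function of \<open>s\<close>, with \<open>A\<close> and \<open>B\<close> for the two inner products.
  The constant does not depend on \<open>A\<close> and \<open>B\<close>: doubling the exponent absorbs the factor \<open>|A| + |B|\<close> that
  differentiation brings down.\<close>

lemma profile_lipschitz:
  fixes m j :: nat
  defines "f \<equiv> \<lambda>A B s. sqrt (1 - s\<^sup>2) ^ m / sqrt (1 - s\<^sup>2) ^ j * exp (sqrt (1 - s\<^sup>2) * A + s * B)"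
  obtains C where "C > 0"
    "\<And>A B s. \<bar>s\<bar> \<le> 1/2 \<Longrightarrow> f A B s \<le> C * exp (\<bar>A\<bar> + \<bar>B\<bar>)"
    "\<And>A B s t. \<bar>s\<bar> \<le> 1/2 \<Longrightarrow> \<bar>t\<bar> \<le> 1/2 \<Longrightarrow> \<bar>f A B s - f A B t\<bar> \<le> C * exp (2 * (\<bar>A\<bar> + \<bar>B\<bar>)) * \<bar>s - t\<bar>"
    "\<And>A B. (f A B has_real_derivative B * exp A) (at 0)"
proof -
  define c where "c = (\<lambda>s::real. sqrt (1 - s\<^sup>2))"
  define k where "k = (\<lambda>s. c s ^ m / c s ^ j)"
  define c' where "c' = (\<lambda>s. - s / c s)"
  define k' where "k' = (\<lambda>s. (real m * (c' s * c s ^ (m - 1)) * c s ^ j - c s ^ m * (real j * (c' s * c s ^ (j - 1)))) / (c s ^ j * c s ^ j))"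
  let ?I = "{-1/2..1/2 :: real}"
  have sq: "s\<^sup>2 \<le> 1/4" if "s \<in> ?I" for s
    using that abs_le_square_iff[of s "1/2"] by (auto simp: power_divide)
  have c: "c s > 0" "c s \<le> 1" "\<bar>s\<bar> \<le> c s" if "s \<in> ?I" for s
  proof -
    show "c s > 0" "c s \<le> 1" using sq[OF that] by (auto simp: c_def)
    have "s\<^sup>2 \<le> 1 - s\<^sup>2" using sq[OF that] by simp
    then show "\<bar>s\<bar> \<le> c s" unfolding c_def by (metis real_sqrt_abs real_sqrt_le_iff)
  qed
  have cd: "(c has_real_derivative c' s) (at s)" if "s \<in> ?I" for s
    unfolding c_def c'_def using sq[OF that] by (auto intro!: derivative_eq_intros simp: field_simps)
  have kd: "(k has_real_derivative k' s) (at s)" if "s \<in> ?I" for s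
    unfolding k_def k'_def using c[OF that]
    by (intro DERIV_divide DERIV_power[OF cd[OF that], unfolded One_nat_def[symmetric]]) auto
  have fd: "(f A B has_real_derivative (k' s + k s * (c' s * A + B)) * exp (c s * A + s * B)) (at s)" if "s \<in> ?I" for A B s
  proof -
    have "((\<lambda>s. k s * exp (c s * A + s * B)) has_real_derivative (k' s + k s * (c' s * A + B)) * exp (c s * A + s * B)) (at s)"
      using cd[OF that] kd[OF that]
      by (auto intro!: derivative_eq_intros simp: algebra_simps)
    moreover have "f A B = (\<lambda>s. k s * exp (c s * A + s * B))" by (auto simp: f_def k_def c_def)
    ultimately show ?thesis by simp
  qed
  have cc: "continuous_on ?I c" by (intro continuous_at_imp_continuous_on ballI DERIV_isCont[OF cd])
  have cc': "continuous_on ?I c'" unfolding c'_def using c(1) by (intro continuous_intros cc) fastforce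
  have "continuous_on ?I k'"
    unfolding k'_def using c(1) by (intro continuous_intros cc cc') fastforce
  then obtain C0 where C0: "C0 > 0" "\<And>s. s \<in> ?I \<Longrightarrow> \<bar>k' s\<bar> \<le> C0"
    using compact_imp_bounded[OF compact_continuous_image[of ?I k']] by (auto simp: bounded_pos)
  have "continuous_on ?I k" by (intro continuous_at_imp_continuous_on ballI DERIV_isCont[OF kd])
  then obtain C1 where C1: "C1 > 0" "\<And>s. s \<in> ?I \<Longrightarrow> \<bar>k s\<bar> \<le> C1"
    using compact_imp_bounded[OF compact_continuous_image[of ?I k]] by (auto simp: bounded_pos)
  define C where "C = C0 + C1"
  have e: "exp (c s * A + s * B) \<le> exp (\<bar>A\<bar> + \<bar>B\<bar>)" if "s \<in> ?I" for A B s
  proof -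
    have "c s * A \<le> c s * \<bar>A\<bar>" using c[OF that] by (intro mult_left_mono) auto
    also have "\<dots> \<le> 1 * \<bar>A\<bar>" using c[OF that] by (intro mult_right_mono) auto
    finally have "c s * A \<le> 1 * \<bar>A\<bar>" .
    moreover have "s * B \<le> \<bar>s\<bar> * \<bar>B\<bar>" by (metis abs_ge_self abs_mult)
    moreover have "\<bar>s\<bar> * \<bar>B\<bar> \<le> 1 * \<bar>B\<bar>" using that by (intro mult_right_mono) auto
    ultimately show ?thesis by simp
  qed
  show ?thesis
  proof (rule that[of C])
    show "C > 0" using C0 C1 by (simp add: C_def)
    show "f A B s \<le> C * exp (\<bar>A\<bar> + \<bar>B\<bar>)" if "\<bar>s\<bar> \<le> 1/2" for A B s
    proof -
      have s: "s \<in> ?I" using that by auto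
      have "f A B s = k s * exp (c s * A + s * B)" by (simp add: f_def k_def c_def)
      also have "\<dots> \<le> C * exp (\<bar>A\<bar> + \<bar>B\<bar>)"
        using C1(2)[OF s] C0(1) C1(1) e[OF s] by (intro mult_mono) (auto simp: C_def)
      finally show ?thesis .
    qed
    show "\<bar>f A B s - f A B t\<bar> \<le> C * exp (2 * (\<bar>A\<bar> + \<bar>B\<bar>)) * \<bar>s - t\<bar>" if "\<bar>s\<bar> \<le> 1/2" "\<bar>t\<bar> \<le> 1/2" for A B s t
    proof -
      let ?X = "\<bar>A\<bar> + \<bar>B\<bar>"
      have b: "\<bar>(k' s + k s * (c' s * A + B)) * exp (c s * A + s * B)\<bar> \<le> C * exp (2 * ?X)" if s: "s \<in> ?I" for s
      proof -
        have "\<bar>c' s\<bar> \<le> 1" using c[OF s] by (simp add: c'_def abs_divide)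
        then have "\<bar>c' s * A + B\<bar> \<le> ?X"
          using abs_triangle_ineq[of "c' s * A" B] mult_right_mono[of "\<bar>c' s\<bar>" 1 "\<bar>A\<bar>"] by (simp add: abs_mult)
        then have "\<bar>k s * (c' s * A + B)\<bar> \<le> C1 * ?X"
          unfolding abs_mult using C1 s by (intro mult_mono) auto
        then have "\<bar>k' s + k s * (c' s * A + B)\<bar> \<le> C0 + C1 * ?X"
          using C0(2)[OF s] abs_triangle_ineq[of "k' s" "k s * (c' s * A + B)"] by linarith
        also have "\<dots> \<le> C * (1 + ?X)"
          using C0(1) C1(1) by (simp add: C_def algebra_simps)
        also have "\<dots> \<le> C * exp ?X"
          using C0(1) C1(1) by (intro mult_left_mono) (auto simp: C_def)
        finally have "\<bar>k' s + k s * (c' s * A + B)\<bar> * exp (c s * A + s * B) \<le> C * exp ?X * exp ?X"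
          using e[OF s] by (intro mult_mono) auto
        then show ?thesis by (simp add: abs_mult exp_add[symmetric] mult.assoc)
      qed
      have "norm (f A B s - f A B t) \<le> C * exp (2 * ?X) * norm (s - t)"
        by (rule field_differentiable_bound[of ?I "f A B" "\<lambda>s. (k' s + k s * (c' s * A + B)) * exp (c s * A + s * B)"])
           (use fd b that in \<open>auto intro: has_field_derivative_at_within simp: abs_le_iff\<close>)
      then show ?thesis by simp
    qed
    show "(f A B has_real_derivative B * exp A) (at 0)" for A B
      using fd[of 0 A B] by (simp add: k'_def k_def c_def c'_def)
  qed
qed

abbreviation (input) gauss_test :: "'a::euclidean_space \<Rightarrow> 'a \<Rightarrow> real" where
  "gauss_test \<eta> \<theta> \<equiv> (\<theta> \<bullet> \<eta>) * exp (- (\<theta> \<bullet> \<eta>)\<^sup>2 / 2)"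

definition dual_section_real :: "nat \<Rightarrow> nat \<Rightarrow> 'a::euclidean_space \<Rightarrow> 'a \<Rightarrow> real \<Rightarrow> real" where
  "dual_section_real N l \<eta> \<theta> s = enn2real (dual_section N l \<eta> \<theta> s)"

text \<open>Complete the square with the orthogonal projection of \<open>\<eta>\<close> to \<open>\<theta>\<^sup>\<bottom>\<close>.\<close>

lemma gauss_shifted_perp:
  fixes \<eta> \<theta> :: "'a::euclidean_space"
  assumes \<theta>: "norm \<theta> = 1"
  shows "(\<integral>\<^sup>+\<omega>. ennreal (exp (\<omega> \<bullet> \<eta> - (norm \<omega>)\<^sup>2 / 2)) \<partial>lborel_subspace (perp \<theta>))
    = ennreal (exp (((norm \<eta>)\<^sup>2 - (\<theta> \<bullet> \<eta>)\<^sup>2) / 2)) * gauss_mass ^ (DIM('a) - 1)"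
proof -
  let ?\<mu> = "lborel_subspace (perp \<theta>)"
  have \<theta>\<theta>: "\<theta> \<bullet> \<theta> = 1" using \<theta> by (simp add: dot_square_norm)
  define v where "v = \<eta> - (\<theta> \<bullet> \<eta>) *\<^sub>R \<theta>"
  have v: "v \<in> perp \<theta>" using \<theta>\<theta> by (simp add: v_def perp_def inner_diff_left inner_commute[of \<theta> \<eta>])
  have nv: "(norm v)\<^sup>2 = (norm \<eta>)\<^sup>2 - (\<theta> \<bullet> \<eta>)\<^sup>2"
    using \<theta>\<theta> unfolding power2_norm_eq_inner
    by (simp add: v_def inner_diff_left inner_diff_right inner_commute power2_eq_square algebra_simps)
  have "(\<integral>\<^sup>+\<omega>. ennreal (exp (\<omega> \<bullet> \<eta> - (norm \<omega>)\<^sup>2 / 2)) \<partial>?\<mu>)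
      = (\<integral>\<^sup>+\<omega>. ennreal (exp ((norm v)\<^sup>2 / 2)) * ennreal (exp (- (norm (\<omega> + - v))\<^sup>2 / 2)) \<partial>?\<mu>)"
  proof (rule nn_integral_cong_AE, use AE_lborel_subspace[OF perp_subspace, of \<theta>] in eventually_elim)
    fix \<omega> assume "\<omega> \<in> perp \<theta>"
    then have "\<omega> \<bullet> v = \<omega> \<bullet> \<eta>" by (simp add: v_def perp_def inner_diff_right)
    then have "(norm v)\<^sup>2 / 2 + - (norm (\<omega> + - v))\<^sup>2 / 2 = \<omega> \<bullet> \<eta> - (norm \<omega>)\<^sup>2 / 2"
      unfolding power2_norm_eq_inner
      by (simp add: inner_diff_left inner_diff_right inner_commute[of v \<omega>]) (simp add: field_simps)
    then show "ennreal (exp (\<omega> \<bullet> \<eta> - (norm \<omega>)\<^sup>2 / 2)) = ennreal (exp ((norm v)\<^sup>2 / 2)) * ennreal (exp (- (norm (\<omega> + - v))\<^sup>2 / 2))"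
      by (simp only: ennreal_mult[symmetric] exp_ge_zero exp_add[symmetric])
  qed
  also have "\<dots> = ennreal (exp ((norm v)\<^sup>2 / 2)) * (\<integral>\<^sup>+\<omega>. ennreal (exp (- (norm (\<omega> + - v))\<^sup>2 / 2)) \<partial>?\<mu>)"
    by (rule nn_integral_cmult) simp
  also have "(\<integral>\<^sup>+\<omega>. ennreal (exp (- (norm (\<omega> + - v))\<^sup>2 / 2)) \<partial>?\<mu>) = (\<integral>\<^sup>+\<omega>. ennreal (exp (- (norm \<omega>)\<^sup>2 / 2)) \<partial>?\<mu>)"
    using v by (intro nn_integral_lborel_subspace_translate[OF perp_subspace, where G = "\<lambda>x. ennreal (exp (- (norm x)\<^sup>2 / 2))"])
      (auto simp: subspace_neg[OF perp_subspace])
  finally show ?thesis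
    unfolding gauss_lborel_subspace[OF perp_subspace] dim_perp[OF \<theta>] nv .
qed

definition gauss_mass_real :: "nat \<Rightarrow> real" where
  "gauss_mass_real N = enn2real (gauss_mass ^ N)"

lemma gauss_mass_real: "gauss_mass ^ N = ennreal (gauss_mass_real N)" "gauss_mass_real N > 0"
proof -
  have "gauss_mass ^ N \<noteq> 0"
    using gauss_mass_finite_pos(2) by (intro power_not_zero) simp
  then have "gauss_mass ^ N > 0" by (rule zero_less_iff_neq_zero[THEN iffD2])
  have "gauss_mass ^ N < \<infinity>"
    using gauss_mass_finite_pos(1) by (simp add: power_less_top_ennreal)
  then show "gauss_mass ^ N = ennreal (gauss_mass_real N)"
    unfolding gauss_mass_real_def by (subst ennreal_enn2real) simp_all
  show "gauss_mass_real N > 0"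
    unfolding gauss_mass_real_def enn2real_positive_iff
    using \<open>gauss_mass ^ N < \<infinity>\<close> \<open>gauss_mass ^ N > 0\<close> by simp
qed

abbreviation (input) dual_slope :: "nat \<Rightarrow> 'a::euclidean_space \<Rightarrow> 'a \<Rightarrow> real" where
  "dual_slope N \<eta> \<theta> \<equiv> gauss_mass_real N * ((\<theta> \<bullet> \<eta>) * exp (((norm \<eta>)\<^sup>2 - (\<theta> \<bullet> \<eta>)\<^sup>2) / 2))"

text \<open>All bounds, and the passage to the limit, come from one majorant, \<open>exp (4 |\<eta>| |\<omega>| - |\<omega>|\<^sup>2 / 2) / |\<omega>|\<close>, whose integral over
  \<open>\<theta>\<^sup>\<bottom>\<close> does not depend on \<open>\<theta>\<close> and is finite because \<open>N \<ge> 2\<close>.\<close>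

lemma dual_section_regular:
  fixes \<eta> :: "'a::euclidean_space"
  assumes N: "N = DIM('a) - 1" "N \<ge> 2"
  obtains C where "C > 0"
    "\<And>\<theta> s. norm \<theta> = 1 \<Longrightarrow> \<bar>s\<bar> \<le> 1/2 \<Longrightarrow> dual_section N l \<eta> \<theta> s = ennreal (dual_section_real N l \<eta> \<theta> s)"
    "\<And>\<theta> s. norm \<theta> = 1 \<Longrightarrow> \<bar>s\<bar> \<le> 1/2 \<Longrightarrow> dual_section_real N l \<eta> \<theta> s \<le> C"
    "\<And>\<theta> s t. norm \<theta> = 1 \<Longrightarrow> \<bar>s\<bar> \<le> 1/2 \<Longrightarrow> \<bar>t\<bar> \<le> 1/2 \<Longrightarrow>
        \<bar>dual_section_real N l \<eta> \<theta> s - dual_section_real N l \<eta> \<theta> t\<bar> \<le> C * \<bar>s - t\<bar>"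
    "\<And>\<theta> S. norm \<theta> = 1 \<Longrightarrow> S \<longlonglongrightarrow> 0 \<Longrightarrow> (\<And>i. S i \<noteq> 0 \<and> \<bar>S i\<bar> \<le> 1/2) \<Longrightarrow>
        (\<lambda>i. (dual_section_real N l \<eta> \<theta> (S i) - dual_section_real N l \<eta> \<theta> 0) / S i)
          \<longlonglongrightarrow> dual_slope N \<eta> \<theta>"
proof -
  define f where "f = (\<lambda>A B s. sqrt (1 - s\<^sup>2) ^ (N - 1) / sqrt (1 - s\<^sup>2) ^ (l + 1) * exp (sqrt (1 - s\<^sup>2) * A + s * B))"
  obtain C0 where C0: "C0 > 0"
    "\<And>A B s. \<bar>s\<bar> \<le> 1/2 \<Longrightarrow> f A B s \<le> C0 * exp (\<bar>A\<bar> + \<bar>B\<bar>)"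
    "\<And>A B s t. \<bar>s\<bar> \<le> 1/2 \<Longrightarrow> \<bar>t\<bar> \<le> 1/2 \<Longrightarrow> \<bar>f A B s - f A B t\<bar> \<le> C0 * exp (2 * (\<bar>A\<bar> + \<bar>B\<bar>)) * \<bar>s - t\<bar>"
    "\<And>A B. (f A B has_real_derivative B * exp A) (at 0)"
    unfolding f_def by (rule profile_lipschitz[of "N - 1" "l + 1"]) blast
  let ?h = "norm \<eta>"
  define D where "D = (\<lambda>\<omega>::'a. exp (4 * ?h * norm \<omega> - (norm \<omega>)\<^sup>2 / 2) / norm \<omega> ^ 1)"
  have [measurable]: "D \<in> borel_measurable borel" unfolding D_def by measurable
  define D0 where "D0 = enn2real (unit_ball_mass N * ennreal (real N * exp ((4 * ?h + 1)\<^sup>2 / 2) * fact (N - 1 - 1)))"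
  have D: "(\<integral>\<^sup>+\<omega>. ennreal (D \<omega>) \<partial>lborel_subspace (perp \<theta>)) \<le> ennreal D0" if \<theta>: "norm \<theta> = 1" for \<theta> :: 'a
  proof -
    have dN: "dim (perp \<theta>) = N" using dim_perp[OF \<theta>] N by simp
    have "unit_ball_mass N < \<infinity>" using emeasure_unit_ball(3)[OF perp_subspace[of \<theta>]] dN N by simp
    then have "unit_ball_mass N * ennreal (real N * exp ((4 * ?h + 1)\<^sup>2 / 2) * fact (N - 1 - 1)) = ennreal D0"
      unfolding D0_def by (subst ennreal_enn2real) (auto simp: ennreal_mult_less_top)
    then show ?thesis
      unfolding D_def using radial_gauss_finite[OF perp_subspace dN, of 1 "4 * ?h"] N by simp
  qed
  have D0: "D0 \<ge> 0" by (simp add: D0_def)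
  have kern_f: "kern N l \<eta> \<theta> s \<omega> = f (\<omega> \<bullet> \<eta>) (norm \<omega> * (\<theta> \<bullet> \<eta>)) s * (exp (- (norm \<omega>)\<^sup>2 / 2) / norm \<omega>)" for \<theta> s and \<omega> :: 'a
  proof -
    have "exp (sqrt (1 - s\<^sup>2) * (\<omega> \<bullet> \<eta>) + s * norm \<omega> * (\<theta> \<bullet> \<eta>) - (norm \<omega>)\<^sup>2 / 2)
        = exp (sqrt (1 - s\<^sup>2) * (\<omega> \<bullet> \<eta>) + s * (norm \<omega> * (\<theta> \<bullet> \<eta>))) * exp (- (norm \<omega>)\<^sup>2 / 2)"
      unfolding exp_add[symmetric] by (simp add: algebra_simps)
    then show ?thesis by (simp add: kern_def f_def)
  qed
  have AB: "\<bar>\<omega> \<bullet> \<eta>\<bar> + \<bar>norm \<omega> * (\<theta> \<bullet> \<eta>)\<bar> \<le> 2 * ?h * norm \<omega>" if "norm \<theta> = 1" for \<theta> \<omega> :: 'a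
  proof -
    have "\<bar>\<omega> \<bullet> \<eta>\<bar> \<le> norm \<omega> * ?h" "\<bar>\<theta> \<bullet> \<eta>\<bar> \<le> norm \<theta> * ?h" by (rule Cauchy_Schwarz_ineq2)+
    then show ?thesis
      using that mult_left_mono[of "\<bar>\<theta> \<bullet> \<eta>\<bar>" ?h "norm \<omega>"] by (simp add: abs_mult mult_ac)
  qed
  have DD: "exp (2 * (\<bar>\<omega> \<bullet> \<eta>\<bar> + \<bar>norm \<omega> * (\<theta> \<bullet> \<eta>)\<bar>)) * (exp (- (norm \<omega>)\<^sup>2 / 2) / norm \<omega>) \<le> D \<omega>"
    if "norm \<theta> = 1" for \<theta> \<omega>
  proof -
    have "exp (2 * (\<bar>\<omega> \<bullet> \<eta>\<bar> + \<bar>norm \<omega> * (\<theta> \<bullet> \<eta>)\<bar>)) \<le> exp (4 * ?h * norm \<omega>)"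
      using AB[OF that, of \<omega>] by simp
    then have "exp (2 * (\<bar>\<omega> \<bullet> \<eta>\<bar> + \<bar>norm \<omega> * (\<theta> \<bullet> \<eta>)\<bar>)) * (exp (- (norm \<omega>)\<^sup>2 / 2) / norm \<omega>)
        \<le> exp (4 * ?h * norm \<omega>) * (exp (- (norm \<omega>)\<^sup>2 / 2) / norm \<omega>)"
      by (rule mult_right_mono) simp
    also have "\<dots> = D \<omega>" by (simp add: D_def exp_add[symmetric])
    finally show ?thesis .
  qed
  have kern_nonneg: "kern N l \<eta> \<theta> s \<omega> \<ge> 0" if "\<bar>s\<bar> \<le> 1/2" for \<theta> s and \<omega> :: 'a
  proof -
    have "s\<^sup>2 \<le> 1" using that by (simp add: abs_square_le_1)
    then show ?thesis by (simp add: kern_def)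
  qed
  have kern_le: "kern N l \<eta> \<theta> s \<omega> \<le> C0 * D \<omega>" if "norm \<theta> = 1" "\<bar>s\<bar> \<le> 1/2" for \<theta> s \<omega>
  proof -
    let ?X = "\<bar>\<omega> \<bullet> \<eta>\<bar> + \<bar>norm \<omega> * (\<theta> \<bullet> \<eta>)\<bar>"
    have "f (\<omega> \<bullet> \<eta>) (norm \<omega> * (\<theta> \<bullet> \<eta>)) s \<le> C0 * exp (2 * ?X)"
      using C0(2)[OF that(2), of "\<omega> \<bullet> \<eta>" "norm \<omega> * (\<theta> \<bullet> \<eta>)"] C0(1)
      by (elim order_trans) (intro mult_left_mono, auto)
    then have "kern N l \<eta> \<theta> s \<omega> \<le> C0 * exp (2 * ?X) * (exp (- (norm \<omega>)\<^sup>2 / 2) / norm \<omega>)"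
      unfolding kern_f by (rule mult_right_mono) simp
    also have "\<dots> \<le> C0 * D \<omega>"
      using DD[OF that(1)] C0(1) by (simp only: mult.assoc) (intro mult_left_mono, auto)
    finally show ?thesis .
  qed
  have kern_lip: "\<bar>kern N l \<eta> \<theta> s \<omega> - kern N l \<eta> \<theta> t \<omega>\<bar> \<le> C0 * D \<omega> * \<bar>s - t\<bar>"
    if "norm \<theta> = 1" "\<bar>s\<bar> \<le> 1/2" "\<bar>t\<bar> \<le> 1/2" for \<theta> s t \<omega>
  proof -
    let ?X = "\<bar>\<omega> \<bullet> \<eta>\<bar> + \<bar>norm \<omega> * (\<theta> \<bullet> \<eta>)\<bar>" and ?g = "exp (- (norm \<omega>)\<^sup>2 / 2) / norm \<omega>"
    have "\<bar>kern N l \<eta> \<theta> s \<omega> - kern N l \<eta> \<theta> t \<omega>\<bar>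
        = \<bar>f (\<omega> \<bullet> \<eta>) (norm \<omega> * (\<theta> \<bullet> \<eta>)) s - f (\<omega> \<bullet> \<eta>) (norm \<omega> * (\<theta> \<bullet> \<eta>)) t\<bar> * ?g"
      unfolding kern_f left_diff_distrib[symmetric] abs_mult by simp
    also have "\<dots> \<le> (C0 * exp (2 * ?X) * \<bar>s - t\<bar>) * ?g"
      by (rule mult_right_mono[OF C0(3)[OF that(2,3)]]) simp
    also have "\<dots> = C0 * \<bar>s - t\<bar> * (exp (2 * ?X) * ?g)" by (simp only: mult_ac)
    also have "\<dots> \<le> C0 * \<bar>s - t\<bar> * D \<omega>"
      using DD[OF that(1)] C0(1) by (intro mult_left_mono) auto
    finally show ?thesis by (simp only: mult_ac)
  qed
  have D_nonneg: "D \<omega> \<ge> 0" for \<omega> by (simp add: D_def)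
  have intD: "integrable (lborel_subspace (perp \<theta>)) D" "(LINT \<omega>|lborel_subspace (perp \<theta>). D \<omega>) \<le> D0"
    if \<theta>: "norm \<theta> = 1" for \<theta> :: 'a
  proof -
    show i: "integrable (lborel_subspace (perp \<theta>)) D"
      using D[OF \<theta>] D_nonneg by (intro integrableI_bounded) (auto simp: order_le_less_trans)
    show "(LINT \<omega>|lborel_subspace (perp \<theta>). D \<omega>) \<le> D0"
      using D[OF \<theta>] D0 nn_integral_eq_integral[OF i] D_nonneg by simp
  qed
  have intk: "integrable (lborel_subspace (perp \<theta>)) (kern N l \<eta> \<theta> s)" if "norm \<theta> = 1" "\<bar>s\<bar> \<le> 1/2" for \<theta> s
    by (rule Bochner_Integration.integrable_bound[OF integrable_mult_right[OF intD(1)[OF that(1)], of C0]])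
       (use kern_le[OF that] kern_nonneg[OF that(2)] C0(1) D_nonneg in auto)
  have ds: "dual_section N l \<eta> \<theta> s = ennreal (LINT \<omega>|lborel_subspace (perp \<theta>). kern N l \<eta> \<theta> s \<omega>)"
    if "norm \<theta> = 1" "\<bar>s\<bar> \<le> 1/2" for \<theta> s
    unfolding dual_section_perp[OF that(1)]
    using intk[OF that] kern_nonneg[OF that(2)] by (intro nn_integral_eq_integral) auto
  have dsr: "dual_section_real N l \<eta> \<theta> s = (LINT \<omega>|lborel_subspace (perp \<theta>). kern N l \<eta> \<theta> s \<omega>)"
    if "norm \<theta> = 1" "\<bar>s\<bar> \<le> 1/2" for \<theta> s
    unfolding dual_section_real_def ds[OF that] using kern_nonneg[OF that(2)] by simp
  show ?thesis
  proof (rule that[of "C0 * D0 + 1"])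
    show "C0 * D0 + 1 > 0" using C0(1) D0 by (simp add: add_nonneg_pos)
    show "dual_section N l \<eta> \<theta> s = ennreal (dual_section_real N l \<eta> \<theta> s)" if "norm \<theta> = 1" "\<bar>s\<bar> \<le> 1/2" for \<theta> s
      using ds[OF that] dsr[OF that] by simp
    show "dual_section_real N l \<eta> \<theta> s \<le> C0 * D0 + 1" if "norm \<theta> = 1" "\<bar>s\<bar> \<le> 1/2" for \<theta> s
    proof -
      have "(LINT \<omega>|lborel_subspace (perp \<theta>). kern N l \<eta> \<theta> s \<omega>) \<le> (LINT \<omega>|lborel_subspace (perp \<theta>). C0 * D \<omega>)"
        using intk[OF that] intD(1)[OF that(1)] kern_le[OF that] by (intro integral_mono) auto
      also have "\<dots> \<le> C0 * D0" using intD(2)[OF that(1)] C0(1) by simp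
      finally show ?thesis using dsr[OF that] by simp
    qed
    show "\<bar>dual_section_real N l \<eta> \<theta> s - dual_section_real N l \<eta> \<theta> t\<bar> \<le> (C0 * D0 + 1) * \<bar>s - t\<bar>"
      if "norm \<theta> = 1" "\<bar>s\<bar> \<le> 1/2" "\<bar>t\<bar> \<le> 1/2" for \<theta> s t
    proof -
      let ?\<mu> = "lborel_subspace (perp \<theta>)"
      have "\<bar>dual_section_real N l \<eta> \<theta> s - dual_section_real N l \<eta> \<theta> t\<bar>
         = \<bar>LINT \<omega>|?\<mu>. (kern N l \<eta> \<theta> s \<omega> - kern N l \<eta> \<theta> t \<omega>)\<bar>"
        using intk that by (simp add: dsr)
      also have "\<dots> \<le> (LINT \<omega>|?\<mu>. \<bar>kern N l \<eta> \<theta> s \<omega> - kern N l \<eta> \<theta> t \<omega>\<bar>)" by (rule integral_abs_bound)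
      also have "\<dots> \<le> (LINT \<omega>|?\<mu>. C0 * \<bar>s - t\<bar> * D \<omega>)"
        using intk intD(1) kern_lip that by (intro integral_mono integrable_abs Bochner_Integration.integrable_diff) (auto simp: mult_ac)
      also have "\<dots> \<le> C0 * \<bar>s - t\<bar> * D0"
        using intD(2)[OF that(1)] C0(1) by (simp add: mult_left_mono)
      also have "\<dots> \<le> (C0 * D0 + 1) * \<bar>s - t\<bar>" by (simp add: algebra_simps)
      finally show ?thesis .
    qed
    show "(\<lambda>i. (dual_section_real N l \<eta> \<theta> (S i) - dual_section_real N l \<eta> \<theta> 0) / S i)
          \<longlonglongrightarrow> dual_slope N \<eta> \<theta>"
      if \<theta>: "norm \<theta> = 1" and S: "S \<longlonglongrightarrow> 0" "\<And>i. S i \<noteq> 0 \<and> \<bar>S i\<bar> \<le> 1/2" for \<theta> and S :: "nat \<Rightarrow> real"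
    proof -
      let ?\<mu> = "lborel_subspace (perp \<theta>)"
      let ?L = "\<lambda>\<omega>. (\<theta> \<bullet> \<eta>) * exp (\<omega> \<bullet> \<eta> - (norm \<omega>)\<^sup>2 / 2)"
      have lim: "(\<lambda>i. LINT \<omega>|?\<mu>. (kern N l \<eta> \<theta> (S i) \<omega> - kern N l \<eta> \<theta> 0 \<omega>) / S i) \<longlonglongrightarrow> (LINT \<omega>|?\<mu>. ?L \<omega>)"
      proof (rule integral_dominated_convergence[where w = "\<lambda>\<omega>. C0 * D \<omega>"])
        have "AE \<omega> in ?\<mu>. \<omega> \<noteq> 0"
          using N dim_perp[OF \<theta>] by (intro AE_lborel_subspace_neq_0 perp_subspace) simp
        then show "AE \<omega> in ?\<mu>. (\<lambda>i. (kern N l \<eta> \<theta> (S i) \<omega> - kern N l \<eta> \<theta> 0 \<omega>) / S i) \<longlonglongrightarrow> ?L \<omega>"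
        proof eventually_elim
          fix \<omega> :: 'a assume \<omega>: "\<omega> \<noteq> 0"
          let ?A = "\<omega> \<bullet> \<eta>" and ?B = "norm \<omega> * (\<theta> \<bullet> \<eta>)" and ?g = "exp (- (norm \<omega>)\<^sup>2 / 2) / norm \<omega>"
          have "((\<lambda>h. (f ?A ?B h - f ?A ?B 0) / h) \<longlongrightarrow> ?B * exp ?A) (at 0)"
            using C0(4)[of ?A ?B] by (simp add: DERIV_def)
          moreover have "filterlim S (at 0) sequentially"
            using S by (auto simp: filterlim_at)
          ultimately have "(\<lambda>i. (f ?A ?B (S i) - f ?A ?B 0) / S i * ?g) \<longlonglongrightarrow> ?B * exp ?A * ?g"
            by (intro tendsto_mult tendsto_const) (rule filterlim_compose)
          moreover have "?B * exp ?A * ?g = ?L \<omega>"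
            using \<omega> exp_add[of "\<omega> \<bullet> \<eta>" "- (norm \<omega>)\<^sup>2 / 2"] by simp
          ultimately show "(\<lambda>i. (kern N l \<eta> \<theta> (S i) \<omega> - kern N l \<eta> \<theta> 0 \<omega>) / S i) \<longlonglongrightarrow> ?L \<omega>"
            unfolding kern_f left_diff_distrib[symmetric] by (simp add: mult.commute)
        qed
        show "AE \<omega> in ?\<mu>. norm ((kern N l \<eta> \<theta> (S i) \<omega> - kern N l \<eta> \<theta> 0 \<omega>) / S i) \<le> C0 * D \<omega>" for i
          using kern_lip[OF \<theta>, of "S i" 0] S(2)[of i] by (intro AE_I2) (auto simp: abs_divide divide_le_eq)
      qed (use intD(1)[OF \<theta>] in auto)
      have "(LINT \<omega>|?\<mu>. exp (\<omega> \<bullet> \<eta> - (norm \<omega>)\<^sup>2 / 2)) = enn2real (ennreal (exp (((norm \<eta>)\<^sup>2 - (\<theta> \<bullet> \<eta>)\<^sup>2) / 2)) * gauss_mass ^ N)"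
        using gauss_shifted_perp[OF \<theta>, of \<eta>] N(1) by (subst integral_eq_nn_integral) auto
      also have "\<dots> = exp (((norm \<eta>)\<^sup>2 - (\<theta> \<bullet> \<eta>)\<^sup>2) / 2) * gauss_mass_real N"
        using gauss_mass_real(2)[of N] by (simp add: gauss_mass_real(1) ennreal_mult[symmetric])
      finally have E1: "(LINT \<omega>|?\<mu>. ?L \<omega>) = dual_slope N \<eta> \<theta>"
        by (simp add: mult_ac)
      have E2: "(LINT \<omega>|?\<mu>. (kern N l \<eta> \<theta> (S i) \<omega> - kern N l \<eta> \<theta> 0 \<omega>) / S i)
          = (dual_section_real N l \<eta> \<theta> (S i) - dual_section_real N l \<eta> \<theta> 0) / S i" for i
        using intk[OF \<theta>] S(2)[of i] by (simp add: dsr[OF \<theta>])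
      show ?thesis using lim unfolding E1 E2 .
    qed
  qed
qed

text \<open>The directional estimates are integrated over a set outside the ball of radius \<open>r\<close>, where
  \<open>|a| \<le> r / 2\<close> keeps \<open>a / |x|\<close> in the range \<open>[-1/2, 1/2]\<close> on which they are uniform.\<close>

lemma outer_moment_regular:
  fixes \<eta> :: "'a::euclidean_space"
  assumes N: "N = DIM('a) - 1" "N \<ge> 2" and [measurable]: "K \<in> sets borel" and K: "bounded K" "K \<inter> cball 0 r = {}" and r: "r > 0"
  obtains M C where "C > 0"
    "\<And>a. \<bar>a\<bar> \<le> r / 2 \<Longrightarrow> 0 \<le> M a \<and> (\<integral>\<^sup>+x. indicator K x * (outer_density N l \<eta> a x) \<partial>lborel) = ennreal (M a)"
    "\<And>a b. \<bar>a\<bar> \<le> r / 2 \<Longrightarrow> \<bar>b\<bar> \<le> r / 2 \<Longrightarrow> \<bar>M a - M b\<bar> \<le> C * \<bar>a - b\<bar>"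
    "\<And>S. S \<longlonglongrightarrow> 0 \<Longrightarrow> (\<And>i. S i \<noteq> 0 \<and> \<bar>S i\<bar> \<le> r / 2) \<Longrightarrow> (\<lambda>i. (M (S i) - M 0) / S i) \<longlonglongrightarrow>
       (LINT x|lborel. indicator K x * (dual_slope N \<eta> (dir x) / norm x ^ (l + 2)))"
proof -
  let ?\<Gamma> = "dual_section_real N l \<eta>"
  obtain C where C: "C > 0"
    "\<And>\<theta> s. norm \<theta> = 1 \<Longrightarrow> \<bar>s\<bar> \<le> 1/2 \<Longrightarrow> dual_section N l \<eta> \<theta> s = ennreal (?\<Gamma> \<theta> s)"
    "\<And>\<theta> s. norm \<theta> = 1 \<Longrightarrow> \<bar>s\<bar> \<le> 1/2 \<Longrightarrow> ?\<Gamma> \<theta> s \<le> C"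
    "\<And>\<theta> s t. norm \<theta> = 1 \<Longrightarrow> \<bar>s\<bar> \<le> 1/2 \<Longrightarrow> \<bar>t\<bar> \<le> 1/2 \<Longrightarrow> \<bar>?\<Gamma> \<theta> s - ?\<Gamma> \<theta> t\<bar> \<le> C * \<bar>s - t\<bar>"
    "\<And>\<theta> S. norm \<theta> = 1 \<Longrightarrow> S \<longlonglongrightarrow> 0 \<Longrightarrow> (\<And>i. S i \<noteq> 0 \<and> \<bar>S i\<bar> \<le> 1/2) \<Longrightarrow>
        (\<lambda>i. (?\<Gamma> \<theta> (S i) - ?\<Gamma> \<theta> 0) / S i) \<longlonglongrightarrow> dual_slope N \<eta> \<theta>"
    using dual_section_regular[OF N, of l \<eta>] by blast
  have [measurable]: "(\<lambda>x. ?\<Gamma> (f x) (g x)) \<in> borel_measurable borel"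
    if [measurable]: "f \<in> borel_measurable borel" "g \<in> borel_measurable borel" for f :: "'a \<Rightarrow> 'a" and g
    unfolding dual_section_real_def by measurable
  define F where "F = (\<lambda>a x. indicator K x * (1 / norm x ^ (l + 1) * ?\<Gamma> (dir x) (a / norm x)))"
  have [measurable]: "F a \<in> borel_measurable borel" for a unfolding F_def by measurable
  define M where "M = (\<lambda>a. LINT x|lborel. F a x)"
  have \<Gamma>0: "?\<Gamma> \<theta> s \<ge> 0" for \<theta> s by (simp add: dual_section_real_def)
  have xK: "norm x > r" "norm (dir x) = 1" "x \<noteq> 0" if "x \<in> K" for x
  proof -
    show *: "norm x > r" using that K(2) by auto
    then show "x \<noteq> 0" using r by auto
    then show "norm (dir x) = 1" by simp
  qed
  have ax: "\<bar>a / norm x\<bar> \<le> 1/2" if "x \<in> K" "\<bar>a\<bar> \<le> r / 2" for a x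
  proof -
    have n: "norm x > r" by (rule xK(1)[OF that(1)])
    then have "\<bar>a\<bar> \<le> 1/2 * norm x" using that(2) by simp
    then show ?thesis using n r by (simp add: abs_divide divide_le_eq)
  qed
  have inv: "1 / norm x ^ k \<le> 1 / r ^ k" if "x \<in> K" for x k
  proof -
    have "norm x > 0" "r \<le> norm x" using xK(1)[OF that] r by auto
    then show ?thesis using r by (intro divide_left_mono power_mono mult_pos_pos zero_less_power) auto
  qed
  have fin: "emeasure lborel K < \<infinity>" using emeasure_bounded_finite[OF K(1)] .
  have F_bound: "\<bar>F a x\<bar> \<le> 1 / r ^ (l + 1) * C" if "\<bar>a\<bar> \<le> r / 2" "x \<in> K" for a x
  proof -
    have "\<bar>F a x\<bar> = 1 / norm x ^ (l + 1) * ?\<Gamma> (dir x) (a / norm x)"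
      using that \<Gamma>0 by (simp add: F_def abs_mult)
    also have "\<dots> \<le> 1 / r ^ (l + 1) * C"
      using C(3)[OF xK(2)[OF that(2)] ax[OF that(2,1)]] \<Gamma>0 r by (intro mult_mono inv[OF that(2)]) auto
    finally show ?thesis .
  qed
  have intF: "integrable lborel (F a)" if "\<bar>a\<bar> \<le> r / 2" for a
  proof (rule integrableI_bounded_set[where A = K and B = "1 / r ^ (l + 1) * C"])
    show "AE x in lborel. x \<in> K \<longrightarrow> norm (F a x) \<le> 1 / r ^ (l + 1) * C"
      using F_bound[OF that] by auto
  qed (use fin in \<open>auto simp: F_def\<close>)
  have F_lip: "\<bar>F a x - F b x\<bar> \<le> indicator K x * (1 / r ^ (l + 1) * (C / r)) * \<bar>a - b\<bar>"
    if "\<bar>a\<bar> \<le> r / 2" "\<bar>b\<bar> \<le> r / 2" for a b x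
  proof (cases "x \<in> K")
    case True
    have "\<bar>?\<Gamma> (dir x) (a / norm x) - ?\<Gamma> (dir x) (b / norm x)\<bar> \<le> C * \<bar>a / norm x - b / norm x\<bar>"
      using C(4)[OF xK(2)[OF True] ax[OF True that(1)] ax[OF True that(2)]] .
    also have "\<dots> = C * \<bar>a - b\<bar> * (1 / norm x ^ 1)"
      by (simp add: diff_divide_distrib[symmetric] abs_divide)
    also have "\<dots> \<le> C * \<bar>a - b\<bar> * (1 / r ^ 1)"
      using inv[OF True, of 1] C(1) by (intro mult_left_mono) auto
    finally have *: "\<bar>?\<Gamma> (dir x) (a / norm x) - ?\<Gamma> (dir x) (b / norm x)\<bar> \<le> C / r * \<bar>a - b\<bar>" by simp
    have "\<bar>F a x - F b x\<bar> = 1 / norm x ^ (l + 1) * \<bar>?\<Gamma> (dir x) (a / norm x) - ?\<Gamma> (dir x) (b / norm x)\<bar>"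
      using True unfolding F_def by (simp add: abs_divide diff_divide_distrib[symmetric] del: power_Suc)
    also have "\<dots> \<le> 1 / r ^ (l + 1) * (C / r * \<bar>a - b\<bar>)"
      using * r C(1) by (intro mult_mono inv[OF True]) auto
    finally show ?thesis using True by simp
  qed (simp add: F_def)
  have intK: "integrable lborel (\<lambda>x. indicator K x * c :: real)" for c
    using fin by (intro integrable_mult_left) (auto intro: integrable_real_indicator)
  define D where "D = measure lborel K * (1 / r ^ (l + 1) * (C / r))"
  have D: "D \<ge> 0" using r C(1) by (simp add: D_def)
  show ?thesis
  proof (rule that[of "D + 1" M])
    show "D + 1 > 0" using D by simp
    show "0 \<le> M a \<and> (\<integral>\<^sup>+x. indicator K x * (outer_density N l \<eta> a x) \<partial>lborel) = ennreal (M a)"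
      if a: "\<bar>a\<bar> \<le> r / 2" for a
    proof
      have F0: "F a x \<ge> 0" for x by (simp add: F_def \<Gamma>0)
      then show "0 \<le> M a" by (simp add: M_def)
      have "(\<integral>\<^sup>+x. indicator K x * (outer_density N l \<eta> a x) \<partial>lborel)
          = (\<integral>\<^sup>+x. ennreal (F a x) \<partial>lborel)"
      proof (rule nn_integral_cong)
        fix x
        show "indicator K x * (outer_density N l \<eta> a x) = ennreal (F a x)"
          using C(2)[OF xK(2)[of x] ax[of x a]] a \<Gamma>0 by (cases "x \<in> K") (auto simp: F_def ennreal_mult[symmetric])
      qed
      also have "\<dots> = ennreal (M a)"
        unfolding M_def using F0 intF[OF a] by (intro nn_integral_eq_integral) auto
      finally show "(\<integral>\<^sup>+x. indicator K x * (outer_density N l \<eta> a x) \<partial>lborel) = ennreal (M a)" .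
    qed
    show "\<bar>M a - M b\<bar> \<le> (D + 1) * \<bar>a - b\<bar>" if ab: "\<bar>a\<bar> \<le> r / 2" "\<bar>b\<bar> \<le> r / 2" for a b
    proof -
      have "\<bar>M a - M b\<bar> = \<bar>LINT x|lborel. (F a x - F b x)\<bar>"
        using intF ab by (simp add: M_def)
      also have "\<dots> \<le> (LINT x|lborel. \<bar>F a x - F b x\<bar>)" by (rule integral_abs_bound)
      also have "\<dots> \<le> (LINT x|lborel. indicator K x * (1 / r ^ (l + 1) * (C / r) * \<bar>a - b\<bar>))"
      proof (rule integral_mono)
        show "integrable lborel (\<lambda>x. \<bar>F a x - F b x\<bar>)"
          by (intro integrable_abs Bochner_Integration.integrable_diff intF ab)
        show "integrable lborel (\<lambda>x. indicator K x * (1 / r ^ (l + 1) * (C / r) * \<bar>a - b\<bar>))" by (rule intK)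
        show "\<bar>F a x - F b x\<bar> \<le> indicator K x * (1 / r ^ (l + 1) * (C / r) * \<bar>a - b\<bar>)" for x
          using F_lip[OF ab, of x] by (simp only: mult.assoc)
      qed
      also have "\<dots> = D * \<bar>a - b\<bar>" by (simp add: D_def)
      also have "\<dots> \<le> (D + 1) * \<bar>a - b\<bar>" by (simp add: algebra_simps)
      finally show ?thesis .
    qed
    show "(\<lambda>i. (M (S i) - M 0) / S i) \<longlonglongrightarrow>
       (LINT x|lborel. indicator K x * (dual_slope N \<eta> (dir x) / norm x ^ (l + 2)))"
      (is "_ \<longlonglongrightarrow> (LINT x|lborel. ?L x)")
      if S: "S \<longlonglongrightarrow> 0" "\<And>i. S i \<noteq> 0 \<and> \<bar>S i\<bar> \<le> r / 2" for S :: "nat \<Rightarrow> real"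
    proof -
      have "(\<lambda>i. LINT x|lborel. (F (S i) x - F 0 x) / S i) \<longlonglongrightarrow> (LINT x|lborel. ?L x)"
      proof (rule integral_dominated_convergence[where w = "\<lambda>x. indicator K x * (1 / r ^ (l + 1) * (C / r))"])
        show "AE x in lborel. norm ((F (S i) x - F 0 x) / S i) \<le> indicator K x * (1 / r ^ (l + 1) * (C / r))" for i
          using F_lip[of "S i" 0] S(2)[of i] r by (intro AE_I2) (auto simp: abs_divide divide_le_eq)
        show "AE x in lborel. (\<lambda>i. (F (S i) x - F 0 x) / S i) \<longlonglongrightarrow> ?L x"
        proof (rule AE_I2)
          fix x :: 'a
          show "(\<lambda>i. (F (S i) x - F 0 x) / S i) \<longlonglongrightarrow> ?L x"
          proof (cases "x \<in> K")
            case True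
            let ?\<theta> = "dir x" and ?n = "norm x"
            have n: "?n > 0" using xK(3)[OF True] by simp
            have "(\<lambda>i. (?\<Gamma> ?\<theta> (S i / ?n) - ?\<Gamma> ?\<theta> 0) / (S i / ?n)) \<longlonglongrightarrow>
                dual_slope N \<eta> ?\<theta>"
            proof (rule C(5)[OF xK(2)[OF True]])
              show "(\<lambda>i. S i / ?n) \<longlonglongrightarrow> 0" using tendsto_divide[OF S(1) tendsto_const[of ?n]] n by simp
              show "S i / ?n \<noteq> 0 \<and> \<bar>S i / ?n\<bar> \<le> 1/2" for i
                using S(2)[of i] n ax[OF True, of "S i"] by auto
            qed
            then have "(\<lambda>i. (?\<Gamma> ?\<theta> (S i / ?n) - ?\<Gamma> ?\<theta> 0) / (S i / ?n) * (1 / ?n ^ (l + 2))) \<longlonglongrightarrow>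
                dual_slope N \<eta> ?\<theta> * (1 / ?n ^ (l + 2))"
              by (intro tendsto_mult tendsto_const)
            moreover have "(?\<Gamma> ?\<theta> (S i / ?n) - ?\<Gamma> ?\<theta> 0) / (S i / ?n) * (1 / ?n ^ (l + 2)) = (F (S i) x - F 0 x) / S i" for i
            proof -
              have "(g - g0) / (s / n) * (1 / n ^ (l + 2)) = (1 * (1 / n ^ (l + 1) * g) - 1 * (1 / n ^ (l + 1) * g0)) / s"
                if "n > 0" "s \<noteq> 0" for g g0 s n :: real
                using that by (simp add: field_simps)
              from this[OF n] S(2)[of i] show ?thesis using True by (simp add: F_def)
            qed
            ultimately show ?thesis using True by simp
          qed (simp add: F_def)
        qed
      qed (use intK in auto)
      moreover have E: "(LINT x|lborel. (F (S i) x - F 0 x) / S i) = (M (S i) - M 0) / S i" for i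
        using intF[of "S i"] intF[of 0] S(2)[of i] r by (simp add: M_def)
      ultimately show ?thesis unfolding E by - assumption
    qed
  qed
qed

text \<open>Let the averaging intervals shrink: the factor \<open>(1 - \<kappa> / r)\<^sup>p\<close> tends to 1.\<close>

lemma central_max_from_averages:
  fixes P :: "real \<Rightarrow> real"
  assumes a: "\<bar>a\<bar> < \<rho>" and \<rho>: "\<rho> < r" and P: "continuous_on {-\<rho>..\<rho>} P" "\<And>t. t \<in> {-\<rho>..\<rho>} \<Longrightarrow> P t \<ge> 0"
    and avg: "\<And>\<kappa>. 0 < \<kappa> \<Longrightarrow> \<bar>a\<bar> + \<kappa> \<le> \<rho> \<Longrightarrow> ennreal ((1 - \<kappa> / r) ^ p) * (\<integral>\<^sup>+t. indicator {a - \<kappa>..a + \<kappa>} t * ennreal (P t) \<partial>lborel)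
        \<le> (\<integral>\<^sup>+t. indicator {- \<kappa>..\<kappa>} t * ennreal (P t) \<partial>lborel)"
  shows "P a \<le> P 0"
proof (rule field_le_epsilon)
  fix e :: real assume "e > 0"
  then have e2: "e / 2 > 0" by simp
  have r: "r > 0" "\<rho> > 0" using a \<rho> by auto
  obtain d1 where d1: "d1 > 0" "\<And>t. t \<in> {-\<rho>..\<rho>} \<Longrightarrow> \<bar>t - a\<bar> < d1 \<Longrightarrow> \<bar>P t - P a\<bar> < e / 2"
    using P(1) a e2 unfolding continuous_on_iff dist_real_def by (metis abs_less_iff atLeastAtMost_iff less_imp_le minus_le_iff)
  obtain d2 where d2: "d2 > 0" "\<And>t. t \<in> {-\<rho>..\<rho>} \<Longrightarrow> \<bar>t - 0\<bar> < d2 \<Longrightarrow> \<bar>P t - P 0\<bar> < e / 2"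
  proof -
    have "0 \<in> {-\<rho>..\<rho>}" using r by simp
    then show thesis using P(1) e2 that unfolding continuous_on_iff dist_real_def by metis
  qed
  define \<kappa>0 where "\<kappa>0 = min (min (d1 / 2) (d2 / 2)) (\<rho> - \<bar>a\<bar>)"
  have \<kappa>0: "\<kappa>0 > 0" using d1 d2 a by (simp add: \<kappa>0_def)
  have P0: "P 0 \<ge> 0" using P(2) r by simp
  have key: "(1 - \<kappa> / r) ^ p * (P a - e / 2) \<le> P 0 + e / 2" if \<kappa>: "0 < \<kappa>" "\<kappa> < \<kappa>0" for \<kappa>
  proof (cases "P a - e / 2 \<ge> 0")
    case True
    have \<kappa>r: "0 \<le> 1 - \<kappa> / r" "\<bar>a\<bar> + \<kappa> \<le> \<rho>" using \<kappa> \<rho> r by (auto simp: \<kappa>0_def field_simps)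
    have "ennreal ((1 - \<kappa> / r) ^ p * (P a - e / 2) * (2 * \<kappa>)) = ennreal ((1 - \<kappa> / r) ^ p) * (\<integral>\<^sup>+t. indicator {a - \<kappa>..a + \<kappa>} t * ennreal (P a - e / 2) \<partial>lborel)"
      using \<kappa> True \<kappa>r by (subst nn_integral_multc) (auto simp: ennreal_mult[symmetric] mult_ac)
    also have "\<dots> \<le> ennreal ((1 - \<kappa> / r) ^ p) * (\<integral>\<^sup>+t. indicator {a - \<kappa>..a + \<kappa>} t * ennreal (P t) \<partial>lborel)"
    proof (rule mult_left_mono, rule nn_integral_mono)
      fix t
      show "indicator {a - \<kappa>..a + \<kappa>} t * ennreal (P a - e / 2) \<le> indicator {a - \<kappa>..a + \<kappa>} t * ennreal (P t)"
      proof (cases "t \<in> {a - \<kappa>..a + \<kappa>}")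
        case True
        then have "t \<in> {-\<rho>..\<rho>}" "\<bar>t - a\<bar> < d1" using \<kappa> \<kappa>r(2) by (auto simp: \<kappa>0_def abs_if split: if_splits)
        from d1(2)[OF this] have "P a - e / 2 \<le> P t" by linarith
        then show ?thesis by (intro mult_left_mono ennreal_leI) auto
      qed simp
    qed simp
    also have "\<dots> \<le> (\<integral>\<^sup>+t. indicator {- \<kappa>..\<kappa>} t * ennreal (P t) \<partial>lborel)"
      using \<kappa> \<kappa>r by (intro avg) auto
    also have "\<dots> \<le> (\<integral>\<^sup>+t. indicator {- \<kappa>..\<kappa>} t * ennreal (P 0 + e / 2) \<partial>lborel)"
    proof (rule nn_integral_mono)
      fix t
      show "indicator {- \<kappa>..\<kappa>} t * ennreal (P t) \<le> indicator {- \<kappa>..\<kappa>} t * ennreal (P 0 + e / 2)"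
      proof (cases "t \<in> {- \<kappa>..\<kappa>}")
        case True
        then have "t \<in> {-\<rho>..\<rho>}" "\<bar>t - 0\<bar> < d2" using \<kappa> \<kappa>r(2) by (auto simp: \<kappa>0_def abs_if split: if_splits)
        from d2(2)[OF this] have "P t \<le> P 0 + e / 2" by linarith
        then show ?thesis by (intro mult_left_mono ennreal_leI) auto
      qed simp
    qed
    also have "\<dots> = ennreal ((P 0 + e / 2) * (2 * \<kappa>))"
      using \<kappa> P0 e2 by (subst nn_integral_multc) (auto simp: ennreal_mult[symmetric] mult.commute simp del: ennreal_plus)
    finally have "(1 - \<kappa> / r) ^ p * (P a - e / 2) * (2 * \<kappa>) \<le> (P 0 + e / 2) * (2 * \<kappa>)"
      using P0 e2 \<kappa> by (subst (asm) ennreal_le_iff) auto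
    then show ?thesis using \<kappa> by simp
  next
    case False
    have "0 \<le> 1 - \<kappa> / r" using \<kappa> \<rho> r by (auto simp: \<kappa>0_def field_simps)
    then have "(1 - \<kappa> / r) ^ p * (P a - e / 2) \<le> 0"
      using False by (intro mult_nonneg_nonpos) auto
    then show ?thesis using P0 e2 by linarith
  qed
  have "((\<lambda>\<kappa>. (1 - \<kappa> / r) ^ p * (P a - e / 2)) \<longlongrightarrow> (1 - 0 / r) ^ p * (P a - e / 2)) (at_right 0)"
    using r by (intro tendsto_intros) auto
  moreover have "\<forall>\<^sub>F \<kappa> in at_right 0. (1 - \<kappa> / r) ^ p * (P a - e / 2) \<le> P 0 + e / 2"
    using key \<kappa>0 by (auto simp: eventually_at_right_field)
  ultimately have "(1 - 0 / r) ^ p * (P a - e / 2) \<le> P 0 + e / 2"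
    by (intro tendsto_upperbound) auto
  then show "P a \<le> P 0 + e" by simp
qed

text \<open>The mean section moment \<open>P\<close> has a maximum at 0, so its right derivative there is nonpositive. The
  ball contributes \<open>c\<^sub>0 (r\<^sup>2 - t\<^sup>2)\<^sup>p\<^sup>/\<^sup>2\<close> to \<open>P\<close>, with derivative 0 at 0; the rest contributes
  the integral of \<open>dual_slope\<close> divided by \<open>|x|\<^sup>l\<^sup>+\<^sup>2\<close>.\<close>

lemma first_variation_nonpos:
  fixes K :: "'a::euclidean_space set"
  assumes N: "N = DIM('a) - 1" and l: "1 \<le> l" "l + 2 \<le> DIM('a)" and K: "compact K" "convex K" and r: "r > 0" "cball 0 r \<subseteq> K"
    and max: "\<And>u t. norm u = 1 \<Longrightarrow> section_moment K l u t \<le> section_moment K l u 0"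
  shows "(LINT x|lborel. indicator (K - cball 0 r) x * (gauss_test \<eta> (dir x) / norm x ^ (l + 2))) \<le> 0"
proof -
  let ?K = "K - cball 0 r" and ?p = "DIM('a) - 1 - l"
  have N2: "N \<ge> 2" using l N by simp
  have Km[measurable]: "K \<in> sets borel" "?K \<in> sets borel" "cball (0::'a) r \<in> sets borel" using K by (auto simp: borel_compact)
  have bK: "bounded ?K" using compact_imp_bounded[OF K(1)] by (rule bounded_subset) auto
  have dK: "?K \<inter> cball 0 r = {}" by auto
  obtain M C where M: "C > 0"
    "\<And>a. \<bar>a\<bar> \<le> r / 2 \<Longrightarrow> 0 \<le> M a \<and> (\<integral>\<^sup>+x. indicator ?K x * (outer_density N l \<eta> a x) \<partial>lborel) = ennreal (M a)"
    "\<And>a b. \<bar>a\<bar> \<le> r / 2 \<Longrightarrow> \<bar>b\<bar> \<le> r / 2 \<Longrightarrow> \<bar>M a - M b\<bar> \<le> C * \<bar>a - b\<bar>"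
    "\<And>S. S \<longlonglongrightarrow> 0 \<Longrightarrow> (\<And>i. S i \<noteq> 0 \<and> \<bar>S i\<bar> \<le> r / 2) \<Longrightarrow> (\<lambda>i. (M (S i) - M 0) / S i) \<longlonglongrightarrow>
       (LINT x|lborel. indicator ?K x * (dual_slope N \<eta> (dir x) / norm x ^ (l + 2)))"
    by (rule outer_moment_regular[OF N N2 Km(2) bK dK r(1), of l \<eta>]) blast
  \<comment> \<open>\<open>c0\<close> collects the constants of \<open>mean_slab_moment_ball\<close>.\<close>
  define c0 where "c0 = enn2real ((\<integral>\<^sup>+\<xi>. ennreal (weight \<eta> \<xi>) \<partial>lborel) * unit_ball_mass (DIM('a) - 1)) * (real (DIM('a) - 1) / real ?p)"
  have c0: "c0 \<ge> 0" by (simp add: c0_def)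
  define P where "P = (\<lambda>a. c0 * sqrt (r\<^sup>2 - a\<^sup>2) ^ ?p + M a)"
  have ar: "a\<^sup>2 \<le> r\<^sup>2" if "\<bar>a\<bar> \<le> r / 2" for a
    using that r abs_le_square_iff[of a r] by simp
  have P0: "P a \<ge> 0" if "\<bar>a\<bar> \<le> r / 2" for a
    using M(2)[OF that] ar[OF that] c0 by (simp add: P_def)
  have msm: "mean_slab_moment \<eta> K l {\<alpha>..\<beta>} = (\<integral>\<^sup>+t. indicator {\<alpha>..\<beta>} t * ennreal (P t) \<partial>lborel)"
    if I: "- (r / 2) \<le> \<alpha>" "\<alpha> \<le> \<beta>" "\<beta> \<le> r / 2" for \<alpha> \<beta>
  proof -
    let ?b = "\<lambda>t. ennreal (real (DIM('a) - 1) / real ?p * sqrt (r\<^sup>2 - t\<^sup>2) ^ ?p)"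
    let ?m = "(\<integral>\<^sup>+\<xi>. ennreal (weight \<eta> \<xi>) \<partial>lborel) * unit_ball_mass (DIM('a) - 1)"
    have "?m < \<infinity>"
      using weight_mass_finite[of \<eta>] emeasure_unit_ball(3)[OF perp_subspace[of "SOME b::'a. b \<in> Basis"]] l
        dim_perp[of "SOME b::'a. b \<in> Basis"] by (simp add: ennreal_mult_less_top SOME_Basis)
    then have m: "?m = ennreal (enn2real ?m)" by simp
    have K_eq: "K = cball 0 r \<union> ?K" using r(2) by auto
    have "mean_slab_moment \<eta> K l {\<alpha>..\<beta>} = mean_slab_moment \<eta> (cball 0 r) l {\<alpha>..\<beta>} + mean_slab_moment \<eta> ?K l {\<alpha>..\<beta>}"
      by (subst K_eq, rule mean_slab_moment_Un) auto
    also have "mean_slab_moment \<eta> (cball 0 r) l {\<alpha>..\<beta>} = ?m * (\<integral>\<^sup>+t. indicator {\<alpha>..\<beta>} t * ?b t \<partial>lborel)"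
      using I r(1) by (intro mean_slab_moment_ball l) auto
    also have "\<dots> = (\<integral>\<^sup>+t. indicator {\<alpha>..\<beta>} t * ennreal (c0 * sqrt (r\<^sup>2 - t\<^sup>2) ^ ?p) \<partial>lborel)"
    proof (subst m, subst nn_integral_cmult[symmetric], measurable, rule nn_integral_cong)
      fix t
      show "ennreal (enn2real ?m) * (indicator {\<alpha>..\<beta>} t * ?b t) = indicator {\<alpha>..\<beta>} t * ennreal (c0 * sqrt (r\<^sup>2 - t\<^sup>2) ^ ?p)"
        using ar[of t] I by (cases "t \<in> {\<alpha>..\<beta>}") (auto simp: c0_def ennreal_mult[symmetric] mult_ac)
    qed
    also have "mean_slab_moment \<eta> ?K l {\<alpha>..\<beta>} = (\<integral>\<^sup>+a. indicator {\<alpha>..\<beta>} a *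
     (\<integral>\<^sup>+x. indicator ?K x * (outer_density N l \<eta> a x) \<partial>lborel) \<partial>lborel)"
      using I r(1) by (intro mean_slab_moment_dual[OF Km(2) N N2 _ r(1)]) auto
    also have "(\<integral>\<^sup>+t. indicator {\<alpha>..\<beta>} t * ennreal (c0 * sqrt (r\<^sup>2 - t\<^sup>2) ^ ?p) \<partial>lborel) + \<dots>
       = (\<integral>\<^sup>+t. indicator {\<alpha>..\<beta>} t * ennreal (P t) \<partial>lborel)"
    proof (subst nn_integral_add[symmetric], measurable, rule nn_integral_cong)
      fix t
      show "indicator {\<alpha>..\<beta>} t * ennreal (c0 * sqrt (r\<^sup>2 - t\<^sup>2) ^ ?p) + indicator {\<alpha>..\<beta>} t *
          (\<integral>\<^sup>+x. indicator ?K x * (outer_density N l \<eta> t x) \<partial>lborel)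
        = indicator {\<alpha>..\<beta>} t * ennreal (P t)"
      proof (cases "t \<in> {\<alpha>..\<beta>}")
        case True
        then have t: "\<bar>t\<bar> \<le> r / 2" using I by (auto simp: abs_le_iff)
        show ?thesis using True M(2)[OF t] ar[OF t] c0 by (simp add: P_def)
      qed simp
    qed
    finally show ?thesis .
  qed
  have contP: "continuous_on {- (r / 2)..r / 2} P"
  proof -
    have "C-lipschitz_on {- (r / 2)..r / 2} M"
      using M(1,3) by (intro lipschitz_onI) (auto simp: dist_real_def abs_le_iff)
    then have "continuous_on {- (r / 2)..r / 2} M" by (rule lipschitz_on_continuous_on)
    then show ?thesis unfolding P_def by (intro continuous_intros)
  qed
  have maxP: "P a \<le> P 0" if a: "\<bar>a\<bar> < r / 2" for a
  proof (rule central_max_from_averages[OF a _ contP, where r = r and p = ?p])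
    show "ennreal ((1 - \<kappa> / r) ^ ?p) * (\<integral>\<^sup>+t. indicator {a - \<kappa>..a + \<kappa>} t * ennreal (P t) \<partial>lborel)
        \<le> (\<integral>\<^sup>+t. indicator {- \<kappa>..\<kappa>} t * ennreal (P t) \<partial>lborel)" if \<kappa>: "0 < \<kappa>" "\<bar>a\<bar> + \<kappa> \<le> r / 2" for \<kappa>
      using mean_slab_moment_le_central[OF l(2) K r(2) max \<kappa>(1), of \<eta> a] \<kappa> r(1) msm[of "a - \<kappa>" "a + \<kappa>"] msm[of "- \<kappa>" \<kappa>]
      by (auto simp: abs_if split: if_splits)
  qed (use r P0 in \<open>auto simp: abs_le_iff\<close>)
  \<comment> \<open>Heights tending to 0 from the right, inside the range \<open>|a| < r / 2\<close> covered by \<open>maxP\<close>.\<close>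
  define S where "S = (\<lambda>i. (r / 4) * inverse (real (Suc i)))"
  have S: "S \<longlonglongrightarrow> 0" "\<And>i. S i > 0" "\<And>i. S i < r / 2"
  proof -
    show "S \<longlonglongrightarrow> 0" unfolding S_def using tendsto_mult[OF tendsto_const LIMSEQ_inverse_real_of_nat] by simp
    show "S i > 0" for i using r by (simp add: S_def)
    have "S i \<le> r / 4 * 1" for i unfolding S_def using r by (intro mult_left_mono) (auto simp: field_simps)
    then have "S i \<le> r / 4" for i by simp
    moreover have "r / 4 < r / 2" using r by simp
    ultimately show "S i < r / 2" for i by (rule order_le_less_trans)
  qed
  let ?L = "LINT x|lborel. indicator ?K x * (dual_slope N \<eta> (dir x) / norm x ^ (l + 2))"
  have "(\<lambda>i. (P (S i) - P 0) / S i) \<longlonglongrightarrow> 0 + ?L"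
  proof -
    have "((\<lambda>a. c0 * sqrt (r\<^sup>2 - a\<^sup>2) ^ ?p) has_real_derivative 0) (at 0)"
      using r by (auto intro!: derivative_eq_intros)
    then have "((\<lambda>h. (c0 * sqrt (r\<^sup>2 - h\<^sup>2) ^ ?p - c0 * sqrt (r\<^sup>2 - 0\<^sup>2) ^ ?p) / h) \<longlongrightarrow> 0) (at 0)"
      by (simp add: DERIV_def)
    moreover have "filterlim S (at 0) sequentially"
      using S(1,2) by (auto simp: filterlim_at less_imp_neq[symmetric])
    ultimately have "(\<lambda>i. (c0 * sqrt (r\<^sup>2 - (S i)\<^sup>2) ^ ?p - c0 * sqrt (r\<^sup>2 - 0\<^sup>2) ^ ?p) / S i) \<longlonglongrightarrow> 0"
      by (rule filterlim_compose)
    moreover have "(\<lambda>i. (M (S i) - M 0) / S i) \<longlonglongrightarrow> ?L"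
      using S by (intro M(4)) (auto simp: less_imp_le abs_of_pos less_imp_neq[symmetric])
    ultimately have "(\<lambda>i. (c0 * sqrt (r\<^sup>2 - (S i)\<^sup>2) ^ ?p - c0 * sqrt (r\<^sup>2 - 0\<^sup>2) ^ ?p) / S i + (M (S i) - M 0) / S i) \<longlonglongrightarrow> 0 + ?L"
      by (rule tendsto_add)
    moreover have "(c0 * sqrt (r\<^sup>2 - (S i)\<^sup>2) ^ ?p - c0 * sqrt (r\<^sup>2 - 0\<^sup>2) ^ ?p) / S i + (M (S i) - M 0) / S i = (P (S i) - P 0) / S i" for i
      unfolding P_def add_divide_distrib[symmetric] by (simp add: algebra_simps)
    ultimately show ?thesis by simp
  qed
  moreover have "(P (S i) - P 0) / S i \<le> 0" for i
    using maxP[of "S i"] S(2,3)[of i] by (intro divide_nonpos_pos) auto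
  ultimately have "?L \<le> 0" by (simp add: LIMSEQ_le_const2)
  moreover have "?L = gauss_mass_real N * exp ((norm \<eta>)\<^sup>2 / 2) *
     (LINT x|lborel. indicator ?K x * (gauss_test \<eta> (dir x) / norm x ^ (l + 2)))"
  proof (subst integral_mult_right_zero[symmetric], rule Bochner_Integration.integral_cong[OF refl])
    fix x
    have "exp (((norm \<eta>)\<^sup>2 - (dir x \<bullet> \<eta>)\<^sup>2) / 2) = exp ((norm \<eta>)\<^sup>2 / 2) * exp (- (dir x \<bullet> \<eta>)\<^sup>2 / 2)"
      unfolding exp_add[symmetric] by (simp add: diff_divide_distrib)
    then show "indicator ?K x * (dual_slope N \<eta> (dir x) / norm x ^ (l + 2))
      = gauss_mass_real N * exp ((norm \<eta>)\<^sup>2 / 2) * (indicator ?K x * (gauss_test \<eta> (dir x) / norm x ^ (l + 2)))"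
      by (simp only: mult_ac times_divide_eq_right times_divide_eq_left)
  qed
  ultimately have "gauss_mass_real N * exp ((norm \<eta>)\<^sup>2 / 2) *
     (LINT x|lborel. indicator ?K x * (gauss_test \<eta> (dir x) / norm x ^ (l + 2)))
     \<le> gauss_mass_real N * exp ((norm \<eta>)\<^sup>2 / 2) * 0" by (simp only: mult_zero_right)
  moreover have "gauss_mass_real N * exp ((norm \<eta>)\<^sup>2 / 2) > 0" using gauss_mass_real(2) by simp
  ultimately show ?thesis by (simp only: mult_le_cancel_left_pos)
qed

section \<open>Density of the test functions\<close>

text \<open>\<open>sinh s / s\<close> is a continuous function of \<open>exp (- s\<^sup>2)\<close> for \<open>s\<close> in a bounded interval, hence a
  uniform limit of polynomials in it.\<close>

lemma sinh_approx_gaussians: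
  fixes b e :: real
  assumes "b \<ge> 0" "e > 0"
  obtains c :: "nat \<Rightarrow> real" and n where
    "\<And>s. \<bar>s\<bar> \<le> b \<Longrightarrow> \<bar>sinh s - (\<Sum>j\<le>n. c j * (s * exp (- (real j * s\<^sup>2))))\<bar> \<le> e"
proof -
  define g where "g = (\<lambda>s::real. if s = 0 then 1 else sinh s / s)"
  have g_cont: "isCont g s" for s
  proof (cases "s = 0")
    case True
    have "(sinh has_real_derivative cosh 0) (at (0::real))" by (auto intro!: derivative_eq_intros)
    then have "((\<lambda>h::real. sinh h / h) \<longlongrightarrow> 1) (at 0)" by (simp add: DERIV_def)
    moreover have "\<forall>\<^sub>F h in at 0. sinh h / h = g h" by (auto simp: g_def eventually_at_filter)
    ultimately have "(g \<longlongrightarrow> 1) (at 0)" by (rule Lim_transform_eventually)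
    then show ?thesis using True by (simp add: isCont_def g_def)
  next
    case False
    have "isCont (\<lambda>s. sinh s / s) s" using False by (intro continuous_intros) auto
    moreover have "\<forall>\<^sub>F t in nhds s. g t = sinh t / t"
      using False t1_space_nhds[of s 0] by (auto simp: g_def elim: eventually_mono)
    ultimately show ?thesis by (subst isCont_cong)
  qed
  have g_even: "g \<bar>s\<bar> = g s" for s by (cases "s \<ge> 0") (auto simp: g_def)
  let ?Z = "{exp (- b\<^sup>2)..1}"
  define h where "h = (\<lambda>z. g (sqrt (- ln z)))"
  have pos: "z > 0" if "z \<in> ?Z" for z using that by (intro less_le_trans[OF exp_gt_zero[of "- b\<^sup>2"]]) auto
  have "continuous_on ?Z h"
    unfolding h_def
  proof (rule continuous_on_compose2[where g = g and t = UNIV])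
    show "continuous_on UNIV g" using g_cont by (simp add: continuous_at_imp_continuous_on)
    show "continuous_on ?Z (\<lambda>z. sqrt (- ln z))" using pos by (intro continuous_intros) force
  qed auto
  then obtain p where p: "real_polynomial_function p" "\<And>z. z \<in> ?Z \<Longrightarrow> \<bar>h z - p z\<bar> < e / (b + 1)"
    using Stone_Weierstrass_real_polynomial_function[of ?Z h "e / (b + 1)"] assms by auto
  obtain c n where cn: "p = (\<lambda>x. \<Sum>i\<le>n. c i * x ^ i)"
    using real_polynomial_function_imp_sum[OF p(1)] by blast
  show ?thesis
  proof (rule that)
    fix s :: real assume s: "\<bar>s\<bar> \<le> b"
    have "s\<^sup>2 \<le> b\<^sup>2" using s assms(1) abs_le_square_iff[of s b] by simp
    then have "exp (- s\<^sup>2) \<in> ?Z" by simp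
    then have "\<bar>h (exp (- s\<^sup>2)) - p (exp (- s\<^sup>2))\<bar> < e / (b + 1)" by (rule p(2))
    moreover have "h (exp (- s\<^sup>2)) = g s" by (simp add: h_def g_even)
    moreover have "p (exp (- s\<^sup>2)) = (\<Sum>j\<le>n. c j * exp (- (real j * s\<^sup>2)))"
      by (simp add: cn exp_of_nat_mult[symmetric])
    ultimately have *: "\<bar>g s - (\<Sum>j\<le>n. c j * exp (- (real j * s\<^sup>2)))\<bar> \<le> e / (b + 1)" by simp
    have "sinh s - (\<Sum>j\<le>n. c j * (s * exp (- (real j * s\<^sup>2)))) = s * (g s - (\<Sum>j\<le>n. c j * exp (- (real j * s\<^sup>2))))"
      by (simp add: g_def right_diff_distrib sum_distrib_left mult_ac)
    then have "\<bar>sinh s - (\<Sum>j\<le>n. c j * (s * exp (- (real j * s\<^sup>2))))\<bar> \<le> (b + 1) * (e / (b + 1))"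
      unfolding \<open>sinh s - _ = _\<close> abs_mult using s assms by (intro mult_mono *) auto
    then show "\<bar>sinh s - (\<Sum>j\<le>n. c j * (s * exp (- (real j * s\<^sup>2))))\<bar> \<le> e" using assms by simp
  qed
qed

text \<open>The linear span of the functions \<open>exp (x \<bullet> \<eta>)\<close>; it is closed under products by the addition theorem.\<close>

inductive_set exp_algebra :: "('a::euclidean_space \<Rightarrow> real) set" where
  exp: "(\<lambda>x. exp (x \<bullet> \<eta>)) \<in> exp_algebra"
| scale: "f \<in> exp_algebra \<Longrightarrow> (\<lambda>x. c * f x) \<in> exp_algebra"
| add: "f \<in> exp_algebra \<Longrightarrow> g \<in> exp_algebra \<Longrightarrow> (\<lambda>x. f x + g x) \<in> exp_algebra"

lemma exp_algebra_mult:
  assumes "f \<in> exp_algebra" "g \<in> exp_algebra"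
  shows "(\<lambda>x. f x * g x) \<in> exp_algebra"
  using assms
proof (induction f rule: exp_algebra.induct)
  case (exp \<eta>)
  from exp show ?case
  proof (induction g rule: exp_algebra.induct)
    case (exp \<zeta>)
    show ?case using exp_algebra.exp[of "\<eta> + \<zeta>"] by (simp add: inner_add_right exp_add)
  next
    case (scale f c)
    then show ?case using exp_algebra.scale[of "\<lambda>x. exp (x \<bullet> \<eta>) * f x" c] by (simp add: mult_ac)
  next
    case (add f g)
    then show ?case using exp_algebra.add by (simp add: distrib_left)
  qed
next
  case (scale f c)
  then show ?case using exp_algebra.scale[of "\<lambda>x. f x * g x" c] by (simp add: mult_ac)
next
  case (add f f')
  then show ?case using exp_algebra.add by (simp add: distrib_right)
qed

lemma exp_algebra_continuous: "f \<in> exp_algebra \<Longrightarrow> continuous_on A f"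
  by (induction f rule: exp_algebra.induct) (auto intro!: continuous_intros)

lemma exp_algebra_dense:
  fixes q :: "'a::euclidean_space \<Rightarrow> real"
  assumes "continuous_on (sphere 0 1) q" "e > 0"
  obtains f where "f \<in> exp_algebra" "\<And>x. x \<in> sphere 0 1 \<Longrightarrow> \<bar>q x - f x\<bar> < e"
proof -
  interpret function_ring_on exp_algebra "sphere (0::'a) 1"
  proof
    show "(\<lambda>_. c) \<in> exp_algebra" for c :: real
      using exp_algebra.scale[OF exp_algebra.exp[of 0], of c] by simp
    show "\<exists>f\<in>exp_algebra. f x \<noteq> f y" if "x \<noteq> y" for x y :: 'a
    proof (rule bexI)
      have "(x - y) \<bullet> (x - y) \<noteq> 0" using that by simp
      then show "exp (x \<bullet> (x - y)) \<noteq> exp (y \<bullet> (x - y))" by (simp add: inner_diff_left)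
    qed (rule exp_algebra.exp)
  qed (auto intro: exp_algebra_continuous exp_algebra.add exp_algebra_mult)
  show ?thesis using Stone_Weierstrass_basic[OF assms] that by blast
qed

text \<open>Replacing \<open>\<eta>\<close> by multiples gives the test functions \<open>s exp (- j s\<^sup>2)\<close> with \<open>s = \<theta> \<bullet> \<eta>\<close>, hence
  \<open>2 sinh s = exp s - exp (- s)\<close>, hence the odd parts of all functions in \<^const>\<open>exp_algebra\<close>, which is dense.\<close>

lemma odd_moments_vanish:
  fixes w :: "'a::euclidean_space \<Rightarrow> real"
  assumes w: "integrable lborel w" and w0: "w 0 = 0"
    and m: "\<And>\<eta>. (LINT x|lborel. w x * gauss_test \<eta> (dir x)) = 0"
    and q: "continuous_on (sphere 0 1) q" "(\<lambda>x. q (dir x)) \<in> borel_measurable borel"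
  shows "(LINT x|lborel. w x * (q (dir x) - q (- (dir x)))) = 0"
proof -
  define W where "W = (LINT x|lborel. \<bar>w x\<bar>)"
  have W: "W \<ge> 0" by (simp add: W_def)
  have [measurable]: "w \<in> borel_measurable borel" using w by auto
  have [measurable]: "(sinh :: real \<Rightarrow> real) \<in> borel_measurable borel"
    by (intro borel_measurable_continuous_onI continuous_intros)
  have intw: "integrable lborel (\<lambda>x. w x * f x)" if [measurable]: "f \<in> borel_measurable borel" and B: "\<And>x. x \<noteq> 0 \<Longrightarrow> \<bar>f x\<bar> \<le> B" for f B
  proof (rule Bochner_Integration.integrable_bound[OF integrable_mult_right[OF integrable_abs[OF w], of B]])
    show "AE x in lborel. norm (w x * f x) \<le> norm (B * \<bar>w x\<bar>)"
    proof (rule AE_I2)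
      fix x
      show "norm (w x * f x) \<le> norm (B * \<bar>w x\<bar>)"
      proof (cases "x = 0")
        case False
        have "\<bar>w x\<bar> * \<bar>f x\<bar> \<le> \<bar>w x\<bar> * \<bar>B\<bar>" using B[OF False] by (intro mult_left_mono) auto
        then show ?thesis by (simp add: abs_mult mult.commute)
      qed (simp add: w0)
    qed
  qed auto
  have small: "\<bar>LINT x|lborel. w x * f x\<bar> \<le> B * W"
    if [measurable]: "f \<in> borel_measurable borel" and B: "\<And>x. x \<noteq> 0 \<Longrightarrow> \<bar>f x\<bar> \<le> B" for f B
  proof -
    have "\<bar>LINT x|lborel. w x * f x\<bar> \<le> (LINT x|lborel. \<bar>w x * f x\<bar>)" by (rule integral_abs_bound)
    also have "\<dots> \<le> (LINT x|lborel. B * \<bar>w x\<bar>)"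
    proof (rule integral_mono)
      show "integrable lborel (\<lambda>x. \<bar>w x * f x\<bar>)" by (intro integrable_abs intw[OF that])
      show "integrable lborel (\<lambda>x. B * \<bar>w x\<bar>)" using w by (intro integrable_mult_right integrable_abs)
      show "\<bar>w x * f x\<bar> \<le> B * \<bar>w x\<bar>" for x
        using B[of x] mult_right_mono[of "\<bar>f x\<bar>" B "\<bar>w x\<bar>"] by (cases "x = 0") (auto simp: w0 abs_mult mult.commute)
    qed
    finally show ?thesis by (simp add: W_def)
  qed
  have le_eps: "A = 0" if "\<And>e. e > 0 \<Longrightarrow> \<bar>A\<bar> \<le> e * W" for A
  proof -
    have "\<bar>A\<bar> \<le> 0"
    proof (rule field_le_epsilon)
      fix e :: real assume e: "e > 0"
      have "\<bar>A\<bar> \<le> e / (W + 1) * W" using e W by (intro that) (auto simp: add_nonneg_pos)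
      also have "\<dots> \<le> e" using e W by (simp add: field_simps)
      finally show "\<bar>A\<bar> \<le> 0 + e" by simp
    qed
    then show ?thesis by simp
  qed
  have s: "\<bar>dir x \<bullet> \<eta>\<bar> \<le> norm \<eta>" if "x \<noteq> 0" for x \<eta> :: 'a
    using Cauchy_Schwarz_ineq2[of "dir x" \<eta>] that by simp
  have gauss: "(LINT x|lborel. w x * ((dir x \<bullet> \<eta>) * exp (- (real j * (dir x \<bullet> \<eta>)\<^sup>2)))) = 0" for \<eta> j
  proof (cases "j = 0")
    case False
    have "(LINT x|lborel. sqrt (2 * real j) * (w x * ((dir x \<bullet> \<eta>) * exp (- (real j * (dir x \<bullet> \<eta>)\<^sup>2))))) = 0"
      using m[of "sqrt (2 * real j) *\<^sub>R \<eta>"] by (simp add: power_mult_distrib mult_ac)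
    then show ?thesis using False by (subst (asm) integral_mult_right_zero) simp
  next
    case True
    \<comment> \<open>The linear function is the limit of \<open>gauss_test (\<epsilon> \<eta>) / \<epsilon>\<close> as \<open>\<epsilon>\<close> tends to 0.\<close>
    let ?t = "\<lambda>x. dir x \<bullet> \<eta>"
    let ?\<epsilon> = "\<lambda>i. inverse (real (Suc i))"
    have "(\<lambda>i. LINT x|lborel. w x * (?t x * exp (- (?\<epsilon> i * ?t x)\<^sup>2 / 2))) \<longlonglongrightarrow> (LINT x|lborel. w x * ?t x)"
    proof (rule integral_dominated_convergence[where w = "\<lambda>x. \<bar>w x * ?t x\<bar>"])
      show "integrable lborel (\<lambda>x. \<bar>w x * ?t x\<bar>)" using s by (intro integrable_abs intw) auto
      show "AE x in lborel. (\<lambda>i. w x * (?t x * exp (- (?\<epsilon> i * ?t x)\<^sup>2 / 2))) \<longlonglongrightarrow> w x * ?t x"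
      proof (rule AE_I2)
        fix x
        have "(\<lambda>i. w x * (?t x * exp (- (?\<epsilon> i * ?t x)\<^sup>2 / 2))) \<longlonglongrightarrow> w x * (?t x * exp (- (0 * ?t x)\<^sup>2 / 2))"
          by (intro tendsto_intros LIMSEQ_inverse_real_of_nat) simp
        then show "(\<lambda>i. w x * (?t x * exp (- (?\<epsilon> i * ?t x)\<^sup>2 / 2))) \<longlonglongrightarrow> w x * ?t x" by simp
      qed
      show "AE x in lborel. norm (w x * (?t x * exp (- (?\<epsilon> i * ?t x)\<^sup>2 / 2))) \<le> \<bar>w x * ?t x\<bar>" for i
        by (intro AE_I2) (auto simp: abs_mult mult.assoc[symmetric] intro!: mult_right_le_one_le)
    qed auto
    moreover have "(LINT x|lborel. w x * (?t x * exp (- (?\<epsilon> i * ?t x)\<^sup>2 / 2))) = 0" for i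
    proof -
      have "(LINT x|lborel. ?\<epsilon> i * (w x * (?t x * exp (- (?\<epsilon> i * ?t x)\<^sup>2 / 2)))) = 0"
        using m[of "?\<epsilon> i *\<^sub>R \<eta>"] by (simp add: mult_ac)
      then show ?thesis by (subst (asm) integral_mult_right_zero) simp
    qed
    ultimately have "(LINT x|lborel. w x * ?t x) = 0" by (simp add: LIMSEQ_const_iff)
    then show ?thesis using True by simp
  qed
  have sinh: "(LINT x|lborel. w x * sinh (dir x \<bullet> \<eta>)) = 0" for \<eta>
  proof (rule le_eps)
    fix e :: real assume e: "e > 0"
    let ?t = "\<lambda>x. dir x \<bullet> \<eta>"
    obtain c n where c: "\<And>s. \<bar>s\<bar> \<le> norm \<eta> \<Longrightarrow> \<bar>sinh s - (\<Sum>j\<le>n. c j * (s * exp (- (real j * s\<^sup>2))))\<bar> \<le> e"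
      using sinh_approx_gaussians[OF norm_ge_zero e] by metis
    let ?p = "\<lambda>x. \<Sum>j\<le>n. c j * (?t x * exp (- (real j * (?t x)\<^sup>2)))"
    have i: "integrable lborel (\<lambda>x. w x * (?t x * exp (- (real j * (?t x)\<^sup>2))))" for j
    proof (rule intw)
      show "\<bar>?t x * exp (- (real j * (?t x)\<^sup>2))\<bar> \<le> norm \<eta>" if "x \<noteq> 0" for x
        using s[OF that, of \<eta>] mult_mono[of "\<bar>?t x\<bar>" "norm \<eta>" "exp (- (real j * (?t x)\<^sup>2))" 1] by (simp add: abs_mult)
    qed auto
    have i': "integrable lborel (\<lambda>x. w x * (c j * (?t x * exp (- (real j * (?t x)\<^sup>2)))))" for j
      using integrable_mult_right[OF i[of j], of "c j"] by (simp add: mult_ac)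
    have "(LINT x|lborel. w x * ?p x) = (\<Sum>j\<le>n. LINT x|lborel. w x * (c j * (?t x * exp (- (real j * (?t x)\<^sup>2)))))"
      unfolding sum_distrib_left by (rule Bochner_Integration.integral_sum[OF i'])
    also have "\<dots> = (\<Sum>j\<le>n. c j * (LINT x|lborel. w x * (?t x * exp (- (real j * (?t x)\<^sup>2)))))"
      by (intro sum.cong refl) (subst integral_mult_right_zero[symmetric], simp add: mult_ac)
    finally have p0: "(LINT x|lborel. w x * ?p x) = 0" by (simp only: gauss) simp
    have ip: "integrable lborel (\<lambda>x. w x * ?p x)"
      unfolding sum_distrib_left by (rule Bochner_Integration.integrable_sum[OF i'])
    have [measurable]: "(\<lambda>x. sinh (?t x) - ?p x) \<in> borel_measurable borel"
      by measurable
    have id: "integrable lborel (\<lambda>x. w x * (sinh (?t x) - ?p x))" and sm: "\<bar>LINT x|lborel. w x * (sinh (?t x) - ?p x)\<bar> \<le> e * W"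
      by (rule intw[where B = e] small, measurable, rule c, rule s, assumption)+
    have "(LINT x|lborel. w x * sinh (?t x)) = (LINT x|lborel. w x * (sinh (?t x) - ?p x) + w x * ?p x)"
      by (simp add: algebra_simps)
    also have "\<dots> = (LINT x|lborel. w x * (sinh (?t x) - ?p x))"
      using id ip p0 by simp
    finally show "\<bar>LINT x|lborel. w x * sinh (?t x)\<bar> \<le> e * W" using sm by simp
  qed
  have alg: "(LINT x|lborel. w x * (f (dir x) - f (- (dir x)))) = 0
      \<and> integrable lborel (\<lambda>x. w x * (f (dir x) - f (- (dir x))))" if "f \<in> exp_algebra" for f
    using that
  proof (induction f rule: exp_algebra.induct)
    case (exp \<eta>)
    have eq: "exp (dir x \<bullet> \<eta>) - exp (- dir x \<bullet> \<eta>) = 2 * sinh (dir x \<bullet> \<eta>)" for x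
      by (simp add: sinh_def)
    have "integrable lborel (\<lambda>x. w x * (2 * sinh (dir x \<bullet> \<eta>)))"
    proof (rule intw)
      show "\<bar>2 * sinh (dir x \<bullet> \<eta>)\<bar> \<le> 2 * sinh (norm \<eta>)" if "x \<noteq> 0" for x
      proof -
        have "sinh \<bar>dir x \<bullet> \<eta>\<bar> \<le> sinh (norm \<eta>)" using s[OF that] by (simp only: sinh_real_le_iff)
        then show ?thesis unfolding sinh_real_abs by (simp only: abs_mult)
      qed
    qed auto
    moreover have "(LINT x|lborel. w x * (2 * sinh (dir x \<bullet> \<eta>))) = 2 * (LINT x|lborel. w x * sinh (dir x \<bullet> \<eta>))"
      by (subst integral_mult_right_zero[symmetric]) (simp add: mult_ac)
    ultimately show ?case unfolding eq using sinh by simp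
  next
    case (scale f c)
    have "w x * (c * f (dir x) - c * f (- (dir x))) = c * (w x * (f (dir x) - f (- (dir x))))" for x
      by (simp add: algebra_simps)
    then show ?case using scale.IH by (simp only: integral_mult_right_zero integrable_mult_right) simp
  next
    case (add f g)
    have "w x * (f (dir x) + g (dir x) - (f (- (dir x)) + g (- (dir x))))
        = w x * (f (dir x) - f (- (dir x))) + w x * (g (dir x) - g (- (dir x)))" for x
      by (simp add: algebra_simps)
    then show ?case
      using add.IH by (simp only: Bochner_Integration.integral_add Bochner_Integration.integrable_add) simp
  qed
  show ?thesis
  proof (rule le_eps)
    fix e :: real assume e: "e > 0"
    obtain f where f: "f \<in> exp_algebra" "\<And>x. x \<in> sphere 0 1 \<Longrightarrow> \<bar>q x - f x\<bar> < e / 2"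
      using exp_algebra_dense[OF q(1), of "e / 2"] e by auto
    have [measurable]: "f \<in> borel_measurable borel"
      using exp_algebra_continuous[OF f(1), of UNIV] by (rule borel_measurable_continuous_onI)
    note [measurable] = q(2)
    have qm: "(\<lambda>x. q (- (dir x))) \<in> borel_measurable borel"
    proof -
      have "(\<lambda>x. (\<lambda>y. q (dir y)) (- x)) \<in> borel_measurable borel" by measurable
      then show ?thesis by simp
    qed
    note [measurable] = qm
    let ?q = "\<lambda>x. q (dir x) - q (- (dir x))" and ?f = "\<lambda>x. f (dir x) - f (- (dir x))"
    have B: "\<bar>?q x - ?f x\<bar> \<le> e" if "x \<noteq> 0" for x
    proof -
      have "dir x \<in> sphere 0 1" "- (dir x) \<in> sphere 0 1" using that by auto
      from this[THEN f(2)] show ?thesis by linarith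
    qed
    have id: "integrable lborel (\<lambda>x. w x * (?q x - ?f x))" and sm: "\<bar>LINT x|lborel. w x * (?q x - ?f x)\<bar> \<le> e * W"
      by (rule intw[where B = e] small; use B in simp)+
    have "(LINT x|lborel. w x * ?q x) = (LINT x|lborel. w x * (?q x - ?f x) + w x * ?f x)"
      by (simp add: algebra_simps)
    also have "\<dots> = (LINT x|lborel. w x * (?q x - ?f x))"
      using id alg[OF f(1)] by simp
    finally show "\<bar>LINT x|lborel. w x * ?q x\<bar> \<le> e * W" using sm by simp
  qed
qed

section \<open>Symmetry\<close>

lemma lborel_integral_uminus:
  fixes f :: "'a::euclidean_space \<Rightarrow> real"
  assumes "f \<in> borel_measurable borel"
  shows "(LINT x|lborel. f (- x)) = (LINT x|lborel. f x)"
    and "integrable lborel f \<Longrightarrow> integrable lborel (\<lambda>x. f (- x))"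
proof -
  have *: "lborel = distr lborel borel (\<lambda>x::'a. - x)"
    using lborel_affine[of "-1" "0::'a"] by (simp add: density_1)
  show "(LINT x|lborel. f (- x)) = (LINT x|lborel. f x)"
    using assms by (subst (2) *) (simp add: integral_distr)
  show "integrable lborel f \<Longrightarrow> integrable lborel (\<lambda>x. f (- x))"
    using assms by (subst (asm) *) (simp add: integrable_distr_eq)
qed

lemma open_not_AE_avoided:
  fixes U :: "'a::euclidean_space set"
  assumes "open U" "AE x in lborel. x \<notin> U"
  shows "U = {}"
proof (rule ccontr)
  assume "U \<noteq> {}"
  have "U \<in> null_sets lborel" using assms AE_iff_null_sets[of U lborel] by simp
  then have "negligible U" by (auto simp: negligible_iff_null_sets intro: null_sets_completionI)
  with open_not_negligible[OF assms(1) \<open>U \<noteq> {}\<close>] show False by blast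
qed

lemma C1_on_sphere_imp_continuous_on:
  assumes "C1_on_sphere f"
  shows "continuous_on (sphere 0 1) f"
proof -
  obtain U g g' where g: "sphere 0 1 \<subseteq> U" "\<forall>x\<in>U. (g has_derivative blinfun_apply (g' x)) (at x)" "\<forall>x\<in>sphere 0 1. g x = f x"
    using assms unfolding C1_on_sphere_def by blast
  have "continuous_on (sphere 0 1) g"
    using g(1,2) by (intro continuous_at_imp_continuous_on ballI) (blast intro: has_derivative_continuous)
  then show ?thesis using g(3) by (subst continuous_on_cong[OF refl]) auto
qed

text \<open>Take the radial function for \<open>q\<close> in \<open>odd_moments_vanish\<close> and symmetrise: \<open>w x - w (- x)\<close> and
  \<open>q (\<theta>) - q (- \<theta>)\<close> have the same sign everywhere, so their product has integral 0 only if it vanishes almost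
  everywhere. A point of \<open>K\<close> outside \<open>- K\<close> would give an open set on which it is positive.\<close>

lemma central_symmetry_from_sections:
  fixes K :: "'a::euclidean_space set"
  assumes l: "1 \<le> l" "l + 2 \<le> DIM('a)" and K: "compact K" "convex K" "0 \<in> interior K"
    and cont: "continuous_on (sphere 0 1) (radial_function K)"
    and max: "\<And>u t. norm u = 1 \<Longrightarrow> section_moment K l u t \<le> section_moment K l u 0"
    and x: "x \<in> K"
  shows "- x \<in> K"
proof (rule ccontr)
  assume nx: "- x \<notin> K"
  obtain r where r: "r > 0" "cball 0 r \<subseteq> K" using K(3) unfolding mem_interior_cball by blast
  have [measurable]: "K \<in> sets borel" "cball (0::'a) r \<in> sets borel" using K(1) by (auto simp: borel_compact)
  define q where "q = radial_function K"
  define w where "w = (\<lambda>x. indicator (K - cball 0 r) x / norm x ^ (l + 2))"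
  have [measurable]: "w \<in> borel_measurable borel" unfolding w_def by measurable
  have w0: "w 0 = 0" using r by (simp add: w_def)
  have "bounded (K - cball 0 r)" using compact_imp_bounded[OF K(1)] by (rule bounded_subset) auto
  then have "emeasure lborel (K - cball 0 r) < \<infinity>" by (rule emeasure_bounded_finite)
  then have intw: "integrable lborel w"
  proof (rule integrableI_bounded_set[where B = "1 / r ^ (l + 2)", rotated 2])
    have "\<bar>w x\<bar> \<le> 1 / r ^ (l + 2)" if "x \<in> K - cball 0 r" for x
    proof -
      have "r \<le> norm x" using that by simp
      then have "1 / norm x ^ (l + 2) \<le> 1 / r ^ (l + 2)"
        using r(1) by (intro divide_left_mono power_mono mult_pos_pos zero_less_power) auto
      then show ?thesis using that by (simp add: w_def)
    qed
    then show "AE x in lborel. x \<in> K - cball 0 r \<longrightarrow> norm (w x) \<le> 1 / r ^ (l + 2)" by auto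
  qed (auto simp: w_def)
  have rad: "y \<in> K \<longleftrightarrow> norm y \<le> q (dir y)" if "y \<noteq> 0" for y
  proof -
    have n: "norm (dir y) = 1" using that by simp
    then have "r *\<^sub>R (dir y) \<in> K" using r by (intro subsetD[OF r(2)]) simp
    moreover have "0 \<in> K" using r by (intro subsetD[OF r(2)]) simp
    ultimately have "norm y *\<^sub>R (dir y) \<in> K \<longleftrightarrow> norm y \<le> q (dir y)"
      using radial_function_props(2)[OF K(1,2) _ r(1) _ n, of "norm y"] that by (simp add: q_def)
    then show ?thesis using that by simp
  qed
  have le: "(LINT x|lborel. w x * gauss_test \<eta> (dir x)) \<le> 0" for \<eta>
    using first_variation_nonpos[OF refl l K(1,2) r max, of \<eta>] by (simp add: w_def)
  have zero: "(LINT x|lborel. w x * gauss_test \<eta> (dir x)) = 0" for \<eta>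
  proof -
    have "(LINT x|lborel. w x * gauss_test (- \<eta>) (dir x))
       = (LINT x|lborel. - (w x * gauss_test \<eta> (dir x)))"
      by (rule Bochner_Integration.integral_cong) auto
    then show ?thesis using le[of \<eta>] le[of "- \<eta>"] by (simp only: integral_minus)
  qed
  have qm[measurable]: "(\<lambda>x. q (dir x)) \<in> borel_measurable borel"
  proof (rule borel_measurable_continuous_countable_exceptions[where X = "{0}"])
    show "continuous_on (- {0}) (\<lambda>x. q (dir x))"
      unfolding q_def
    proof (rule continuous_on_compose2[OF cont])
      show "continuous_on (- {0}) (\<lambda>x::'a. dir x)" by (intro continuous_intros) auto
      show "(\<lambda>x. dir x) ` (- {0}) \<subseteq> sphere (0::'a) 1" by (auto, rule ccontr, simp)
    qed
  qed auto
  have nqm: "(\<lambda>x. q (- (dir x))) \<in> borel_measurable borel"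
  proof -
    have "(\<lambda>x. (\<lambda>y. q (dir y)) (- x)) \<in> borel_measurable borel" by measurable
    then show ?thesis by simp
  qed
  note [measurable] = nqm
  define d where "d = (\<lambda>x. q (dir x) - q (- (dir x)))"
  have [measurable]: "d \<in> borel_measurable borel" unfolding d_def by measurable
  have d_odd: "d (- x) = - d x" for x by (simp add: d_def)
  have wd: "(LINT x|lborel. w x * d x) = 0"
    unfolding d_def using odd_moments_vanish[OF intw w0 zero _ qm] cont by (simp add: q_def)
  obtain B where "\<forall>x\<in>sphere 0 1. \<bar>q x\<bar> \<le> B"
    using compact_imp_bounded[OF compact_continuous_image[OF cont compact_sphere]] by (auto simp: bounded_iff q_def)
  then have B: "\<bar>q x\<bar> \<le> B" if "norm x = 1" for x using that by simp
  have int_wd: "integrable lborel (\<lambda>x. w x * d x)"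
  proof (rule Bochner_Integration.integrable_bound[OF integrable_mult_right[OF integrable_abs[OF intw], of "2 * B"]])
    show "AE x in lborel. norm (w x * d x) \<le> norm (2 * B * \<bar>w x\<bar>)"
    proof (rule AE_I2)
      fix x
      show "norm (w x * d x) \<le> norm (2 * B * \<bar>w x\<bar>)"
      proof (cases "x = 0")
        case False
        then have "\<bar>d x\<bar> \<le> \<bar>2 * B\<bar>"
          using B[of "dir x"] B[of "- (dir x)"] by (simp add: d_def)
        then have "\<bar>w x\<bar> * \<bar>d x\<bar> \<le> \<bar>w x\<bar> * \<bar>2 * B\<bar>" by (intro mult_left_mono) auto
        then show ?thesis by (simp add: abs_mult mult_ac)
      qed (simp add: w0)
    qed
  qed auto
  have int_wd': "integrable lborel (\<lambda>x. w (- x) * d x)"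
    using integrable_minus[OF lborel_integral_uminus(2)[OF _ int_wd]] by (simp add: d_odd)
  have "(LINT x|lborel. w (- x) * d x) = - (LINT x|lborel. (\<lambda>x. w x * d x) (- x))"
    by (simp add: d_odd)
  also have "\<dots> = 0"
    by (subst lborel_integral_uminus(1)) (auto simp: wd)
  finally have I0: "(LINT x|lborel. (w x - w (- x)) * d x) = 0"
    using int_wd int_wd' wd by (simp add: left_diff_distrib)
  have pos: "w y * d y > 0 \<and> w (- y) = 0" if y: "y \<in> K" "- y \<notin> K" for y
  proof -
    have "- y \<notin> cball 0 r" using r(2) y(2) by blast
    then have nr: "norm y > r" by simp
    then have y0: "y \<noteq> 0" using r by auto
    then have "norm y \<le> q (dir y)" "\<not> norm (- y) \<le> q (- (dir y))"
      using rad[of y] rad[of "- y"] y by auto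
    then have "d y > 0" by (simp add: d_def)
    moreover have "w y > 0" using y nr y0 by (simp add: w_def)
    moreover have "w (- y) = 0" using y by (simp add: w_def)
    ultimately show ?thesis by simp
  qed
  have nonneg: "(w y - w (- y)) * d y \<ge> 0" for y
  proof -
    consider "y \<in> K" "- y \<notin> K" | "- y \<in> K" "y \<notin> K" | "y \<in> K \<longleftrightarrow> - y \<in> K" by blast
    then show ?thesis
    proof cases
      case 1
      then show ?thesis using pos[of y] by (simp add: left_diff_distrib less_imp_le)
    next
      case 2
      then show ?thesis using pos[of "- y"] by (simp add: left_diff_distrib less_imp_le d_odd)
    next
      case 3
      then have "w y = w (- y)" by (simp add: w_def indicator_def)
      then show ?thesis by simp
    qed
  qed
  have "AE y in lborel. (w y - w (- y)) * d y = 0"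
    using I0 int_wd int_wd' nonneg
    by (subst integral_nonneg_eq_0_iff_AE[symmetric]) (auto simp: left_diff_distrib)
  \<comment> \<open>The closed set \<open>- K\<close> misses \<open>x\<close>, and \<open>x\<close> is a limit of interior points of \<open>K\<close>, so \<open>U\<close> cannot be empty.\<close>
  moreover define U where "U = interior K \<inter> - uminus ` K"
  have "y \<notin> U" if "(w y - w (- y)) * d y = 0" for y
    using pos[of y] that interior_subset[of K] by (force simp: U_def left_diff_distrib image_iff)
  ultimately have "AE y in lborel. y \<notin> U" by (auto elim: eventually_mono)
  moreover have oV: "open (- uminus ` K)"
    by (intro open_Compl compact_imp_closed compact_continuous_image continuous_intros K(1))
  then have "open U" unfolding U_def by (intro open_Int) auto
  ultimately have "U = {}" by (intro open_not_AE_avoided)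
  moreover have "x \<in> closure (interior K) \<inter> - uminus ` K"
    using x nx convex_closure_interior[OF K(2)] K(3) closure_subset[of K] by (auto simp: image_iff)
  ultimately show False
    using open_Int_closure_eq_empty[OF oV, of "interior K"] by (auto simp: U_def)
qed

theorem theorem7:
  fixes K :: "(real ^ 'n) set" and l :: nat
  assumes "C1_convex_body K"
    and "1 \<le> l" and "l + 2 \<le> CARD('n)"
    and "\<And>\<xi>. \<xi> \<in> sphere 0 1 \<Longrightarrow>
           is_max_over_reals
             (\<lambda>t. dual_quermassintegral (perp \<xi>) l ((\<lambda>x. x - t *\<^sub>R \<xi>) ` K \<inter> perp \<xi>))
             (dual_quermassintegral (perp \<xi>) l (K \<inter> perp \<xi>))"
  shows "K = uminus ` K"
proof -
  have K: "compact K" "convex K" "0 \<in> interior K" "continuous_on (sphere 0 1) (radial_function K)"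
    using assms(1) by (auto simp: C1_convex_body_def convex_body_in_def intro: C1_on_sphere_imp_continuous_on)
  have l: "l + 2 \<le> DIM(real ^ 'n)" using assms(3) by simp
  have "section_moment K l u t \<le> section_moment K l u 0" if "norm u = 1" for u t
    using that by (intro section_moment_le_central l K assms(4)) auto
  then have "- x \<in> K" if "x \<in> K" for x
    using that by (intro central_symmetry_from_sections[OF assms(2) l K])
  then show ?thesis by (force simp: image_iff)
qed

end
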